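(* Let $\mathcal{G}$ be a simplicial graph with vertex set $I$, and for each $i\in I$ let $\Delta_i$ be a finite building of some type $(W_i,S_i)$ such that $G_i=\mathrm{Aut}(\Delta_i)$ acts transitively on the chambers of $\Delta_i$. Let $E_i$ be the rank-one building with chamber set $\Delta_i$, let $E=\prod_{i\in I}E_i$ and $\widetilde{E}=\prod_{\mathcal{G}}E_i$, and let $\widetilde{G}$ be the group of all lifts to $\widetilde{E}$ of the action of $\prod_{i\in I}G_i$ on $E$. Then $\widetilde{G}$ (the standard lattice) is residually finite.
   Context: Buildings are in the $W$-metric sense; $\mathrm{Aut}(\Delta_i)$ is the group of type preserving automorphisms (sending $s$-panels to $s$-panels for every $s\in S_i$), where an $s$-panel is a class of chambers under "equal or at distance $s$". A rank-one building is a set with distance $\delta(C,C')=s$, the generator of $\mathbb{Z}_2$, whenever $C\ne C'$. Let $W$ be the right-angled Coxeter group with generating set $I$, where $i\neq j$ commute iff $\{i,j\}$ is an edge of $\mathcal{G}$, and $m(i,j)=\infty$ otherwise. Definition of $\widetilde{E}$. $E=\prod_iE_i$ is a building of type $\prod_i\mathbb{Z}_2$ with componentwise distance $\delta$. Let $K'$ be the Davis chamber of $(W,I)$: the geometric realization of the poset of spherical subsets of $I$ (subsets, including $\emptyset$, generating a finite subgroup of $W$), with mirrors $K'_i$ = realization of the subposet of spherical subsets containing $i$. Let $\mathcal{U}(E,K')=(E\times K')/\!\sim$, where $(C,x)\sim(D,y)$ iff $x=y$ and $\delta(C,D)$ lies in the subgroup generated by $\{i:x\in K'_i\}$. The graph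 product $\widetilde{E}=\prod_{\mathcal{G}}E_i$ is the set of copies of $K'$ in the universal cover of $\mathcal{U}(E,K')$, two distinct copies being $i$-adjacent if they share their $i$-mirror; it is a right-angled building of type $(W,I)$. The covering map induces $p:\widetilde{E}\to E$. Group of lifts. $\prod_iG_i$ acts on $E$ componentwise; $\widetilde{G}$ is the group of all automorphisms $\widetilde{g}$ of $\widetilde{E}$ (type preserving: preserving $i$-adjacency for every $i$) for which there is $g\in\prod_iG_i$ with $p\circ\widetilde{g}=g\circ p$. The index set $I$ is finite. *)

theory Defs
  imports "HOL-Analysis.Analysis" "HOL-Algebra.Bij"
    "HOL-Algebra.Multiplicative_Group" "HOL-Algebra.Product_Groups"
begin

section \<open>Coxeter groups and buildings\<close>

text \<open>
  The congruence on words over \<open>S\<close> generated by the Coxeter relations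
  \<open>(s t) ^ m s t = 1\<close>. A Coxeter matrix has \<open>m s s = 1\<close>, so \<open>s s = 1\<close> is among them and no
  formal inverses are needed; the entry \<open>m s t = 0\<close> encodes \<open>\<infinity>\<close> (the relator is then empty).
\<close>

inductive cox_eq :: "('a \<Rightarrow> 'a \<Rightarrow> nat) \<Rightarrow> 'a set \<Rightarrow> 'a list \<Rightarrow> 'a list \<Rightarrow> bool"
  for m S where
  relator: "\<lbrakk>s \<in> S; t \<in> S; u \<in> lists S; v \<in> lists S\<rbrakk>
      \<Longrightarrow> cox_eq m S (u @ concat (replicate (m s t) [s, t]) @ v) (u @ v)"
| refl: "u \<in> lists S \<Longrightarrow> cox_eq m S u u"
| sym: "cox_eq m S u v \<Longrightarrow> cox_eq m S v u"
| trans: "\<lbrakk>cox_eq m S u v; cox_eq m S v w\<rbrakk> \<Longrightarrow> cox_eq m S u w"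

definition cox_class :: "('a \<Rightarrow> 'a \<Rightarrow> nat) \<Rightarrow> 'a set \<Rightarrow> 'a list \<Rightarrow> 'a list set" where
  "cox_class m S u = {v. cox_eq m S u v}"

definition coxeter_group :: "('a \<Rightarrow> 'a \<Rightarrow> nat) \<Rightarrow> 'a set \<Rightarrow> 'a list set monoid" where
  "coxeter_group m S =
     \<lparr>carrier = cox_class m S ` lists S,
      mult = (\<lambda>A B. \<Union>u\<in>A. \<Union>v\<in>B. cox_class m S (u @ v)),
      one = cox_class m S []\<rparr>"

locale coxeter_system = group W for W :: "('w, 'm) monoid_scheme" (structure) +
  fixes S :: "'w set"
  assumes gens_closed: "S \<subseteq> carrier W"
    and gens_involutions: "s \<in> S \<Longrightarrow> ord s = 2"
    and presentation:
      "\<exists>\<phi> \<in> iso (coxeter_group (\<lambda>s t. ord (s \<otimes> t)) S) W.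
         \<forall>s\<in>S. \<phi> (cox_class (\<lambda>s t. ord (s \<otimes> t)) S [s]) = s"

definition word_length :: "('w, 'm) monoid_scheme \<Rightarrow> 'w set \<Rightarrow> 'w \<Rightarrow> nat" where
  "word_length W S w =
     (LEAST n. \<exists>u \<in> lists S. length u = n \<and> foldr (mult W) u (one W) = w)"

locale building = coxeter_system W S for W :: "('w, 'm) monoid_scheme" (structure) and S +
  fixes Ch :: "'c set" and dst :: "'c \<Rightarrow> 'c \<Rightarrow> 'w"
  assumes nonempty: "Ch \<noteq> {}"
    and dst_closed: "\<lbrakk>C \<in> Ch; D \<in> Ch\<rbrakk> \<Longrightarrow> dst C D \<in> carrier W"
    and WD1: "\<lbrakk>C \<in> Ch; D \<in> Ch\<rbrakk> \<Longrightarrow> dst C D = \<one> \<longleftrightarrow> C = D"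
    and WD2: "\<lbrakk>C \<in> Ch; D \<in> Ch; C' \<in> Ch; s \<in> S; dst C' C = s\<rbrakk>
      \<Longrightarrow> dst C' D \<in> {s \<otimes> dst C D, dst C D}"
    and WD2': "\<lbrakk>C \<in> Ch; D \<in> Ch; C' \<in> Ch; s \<in> S; dst C' C = s;
        word_length W S (s \<otimes> dst C D) = word_length W S (dst C D) + 1\<rbrakk>
      \<Longrightarrow> dst C' D = s \<otimes> dst C D"
    and WD3: "\<lbrakk>C \<in> Ch; D \<in> Ch; s \<in> S\<rbrakk>
      \<Longrightarrow> \<exists>C' \<in> Ch. dst C' C = s \<and> dst C' D = s \<otimes> dst C D"

definition panels :: "'c set \<Rightarrow> ('c \<Rightarrow> 'c \<Rightarrow> 'w) \<Rightarrow> 'w \<Rightarrow> 'c set set" where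
  "panels Ch dst s = {{D \<in> Ch. C = D \<or> dst C D = s} | C. C \<in> Ch}"

definition building_aut :: "'w set \<Rightarrow> 'c set \<Rightarrow> ('c \<Rightarrow> 'c \<Rightarrow> 'w) \<Rightarrow> ('c \<Rightarrow> 'c) monoid" where
  "building_aut S Ch dst =
     BijGroup Ch \<lparr>carrier :=
       {f \<in> Bij Ch. \<forall>s\<in>S. \<forall>P \<in> panels Ch dst s. f ` P \<in> panels Ch dst s}\<rparr>"

section \<open>Residual finiteness\<close>

definition residually_finite :: "('g, 'm) monoid_scheme \<Rightarrow> bool" where
  "residually_finite G \<longleftrightarrow> group G \<and>
     (\<forall>g \<in> carrier G - {\<one>\<^bsub>G\<^esub>}. \<exists>N. N \<lhd> G \<and> finite (carrier (G Mod N)) \<and> g \<notin> N)"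

section \<open>Quotient spaces and universal covers\<close>

definition quotient_topology :: "'a topology \<Rightarrow> 'a rel \<Rightarrow> 'a set topology" where
  "quotient_topology X R =
     topology (\<lambda>\<V>. \<V> \<subseteq> topspace X // R \<and> openin X {x \<in> topspace X. R `` {x} \<in> \<V>})"

lemma openin_quotient_topology:
  "openin (quotient_topology X R) \<V> \<longleftrightarrow>
     \<V> \<subseteq> topspace X // R \<and> openin X {x \<in> topspace X. R `` {x} \<in> \<V>}"
proof -
  have "istopology (\<lambda>\<V>. \<V> \<subseteq> topspace X // R \<and> openin X {x \<in> topspace X. R `` {x} \<in> \<V>})"
    unfolding istopology_def
  proof (intro conjI allI impI; (elim conjE)?)
    fix S T
    assume "openin X {x \<in> topspace X. R `` {x} \<in> S}" "openin X {x \<in> topspace X. R `` {x} \<in> T}"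
    from openin_Int[OF this] show "openin X {x \<in> topspace X. R `` {x} \<in> S \<inter> T}"
      by (simp add: Collect_conj_eq[symmetric] Int_def conj_commute conj_left_commute)
  next
    fix \<K>
    assume *: "\<forall>K\<in>\<K>. K \<subseteq> topspace X // R \<and> openin X {x \<in> topspace X. R `` {x} \<in> K}"
    have "{x \<in> topspace X. R `` {x} \<in> \<Union>\<K>} = (\<Union>K\<in>\<K>. {x \<in> topspace X. R `` {x} \<in> K})"
      by auto
    with * show "openin X {x \<in> topspace X. R `` {x} \<in> \<Union>\<K>}" by auto
  qed auto
  then show ?thesis by (simp add: quotient_topology_def topology_inverse')
qed

text \<open>The following two notions are those of \<^const>\<open>covering_space\<close> and
  \<^const>\<open>simply_connected\<close>, for abstract topologies.\<close>

definition covering_map :: "'a topology \<Rightarrow> 'b topology \<Rightarrow> ('a \<Rightarrow> 'b) \<Rightarrow> bool" where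
  "covering_map X Y q \<longleftrightarrow>
     continuous_map X Y q \<and> q ` topspace X = topspace Y \<and>
     (\<forall>y \<in> topspace Y. \<exists>V. y \<in> V \<and> openin Y V \<and>
        (\<exists>\<U>. \<Union>\<U> = {x \<in> topspace X. q x \<in> V} \<and>
             (\<forall>U\<in>\<U>. openin X U) \<and>
             pairwise disjnt \<U> \<and>
             (\<forall>U\<in>\<U>. homeomorphic_map (subtopology X U) (subtopology Y V) q)))"

definition simply_connected_space :: "'a topology \<Rightarrow> bool" where
  "simply_connected_space X \<longleftrightarrow>
     (\<forall>p p'. pathin X p \<and> p 1 = p 0 \<and> pathin X p' \<and> p' 1 = p' 0 \<longrightarrow>
        homotopic_with (\<lambda>r. r 1 = r 0) (top_of_set {0..1}) X p p')"

definition universal_cover :: "'a topology \<Rightarrow> 'b topology \<Rightarrow> ('a \<Rightarrow> 'b) \<Rightarrow> bool" where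
  "universal_cover X Y q \<longleftrightarrow> covering_map X Y q \<and> simply_connected_space X"

section \<open>The Davis chamber of a right-angled Coxeter group\<close>

definition ra_matrix :: "'i set set \<Rightarrow> 'i \<Rightarrow> 'i \<Rightarrow> nat" where
  "ra_matrix edges i j = (if i = j then 1 else if {i, j} \<in> edges then 2 else 0)"

definition spherical_subsets :: "'i set \<Rightarrow> 'i set set \<Rightarrow> 'i set set" where
  "spherical_subsets I edges =
     {T. T \<subseteq> I \<and>
         finite (generate (coxeter_group (ra_matrix edges) I)
                   ((\<lambda>i. cox_class (ra_matrix edges) I [i]) ` T))}"

text \<open>
  The geometric realization of the poset \<open>(P, \<subseteq>)\<close>, i.e. of the simplicial complex of its finite
  chains, in barycentric coordinates. It is only used for finite \<open>P\<close>, where the topology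
  inherited from the product topology is the usual one.
\<close>

definition poset_realization :: "'a set set \<Rightarrow> ('a set \<Rightarrow> real) set" where
  "poset_realization P =
     {x. (\<forall>\<sigma>. 0 \<le> x \<sigma>) \<and> finite {\<sigma>. x \<sigma> \<noteq> 0} \<and> subset.chain P {\<sigma>. x \<sigma> \<noteq> 0} \<and>
         (\<Sum>\<sigma> | x \<sigma> \<noteq> 0. x \<sigma>) = 1}"

definition davis_chamber :: "'i set \<Rightarrow> 'i set set \<Rightarrow> ('i set \<Rightarrow> real) set" where
  "davis_chamber I edges = poset_realization (spherical_subsets I edges)"

definition davis_mirror :: "'i set \<Rightarrow> 'i set set \<Rightarrow> 'i \<Rightarrow> ('i set \<Rightarrow> real) set" where
  "davis_mirror I edges i = poset_realization {T \<in> spherical_subsets I edges. i \<in> T}"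

section \<open>The product building and its realization\<close>

definition rank_one_dist :: "'c \<Rightarrow> 'c \<Rightarrow> int" where
  "rank_one_dist C D = (if C = D then 0 else 1)"

definition Z2_product :: "'i set \<Rightarrow> ('i \<Rightarrow> int) monoid" where
  "Z2_product I = product_group I (\<lambda>_. integer_mod_group 2)"

definition Z2_gen :: "'i set \<Rightarrow> 'i \<Rightarrow> 'i \<Rightarrow> int" where
  "Z2_gen I i = (\<lambda>j\<in>I. if j = i then 1 else 0)"

definition product_dist :: "'i set \<Rightarrow> ('i \<Rightarrow> 'c) \<Rightarrow> ('i \<Rightarrow> 'c) \<Rightarrow> 'i \<Rightarrow> int" where
  "product_dist I C D = (\<lambda>i\<in>I. rank_one_dist (C i) (D i))"

text \<open>In what follows \<open>E\<close> is the chamber set of the product building.\<close>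

definition U_rel ::
  "'i set \<Rightarrow> 'i set set \<Rightarrow> ('i \<Rightarrow> 'c) set \<Rightarrow> (('i \<Rightarrow> 'c) \<times> ('i set \<Rightarrow> real)) rel" where
  "U_rel I edges E =
     {((C, x), (D, y)). C \<in> E \<and> D \<in> E \<and> x \<in> davis_chamber I edges \<and> y \<in> davis_chamber I edges \<and>
        x = y \<and>
        product_dist I C D
          \<in> generate (Z2_product I) (Z2_gen I ` {i \<in> I. x \<in> davis_mirror I edges i})}"

definition U_space ::
  "'i set \<Rightarrow> 'i set set \<Rightarrow> ('i \<Rightarrow> 'c) set \<Rightarrow> (('i \<Rightarrow> 'c) \<times> ('i set \<Rightarrow> real)) set topology" where
  "U_space I edges E =
     quotient_topology (prod_topology (discrete_topology E) (top_of_set (davis_chamber I edges)))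
       (U_rel I edges E)"

definition U_chamber ::
  "'i set \<Rightarrow> 'i set set \<Rightarrow> ('i \<Rightarrow> 'c) set \<Rightarrow> ('i \<Rightarrow> 'c)
     \<Rightarrow> (('i \<Rightarrow> 'c) \<times> ('i set \<Rightarrow> real)) set set" where
  "U_chamber I edges E C = {U_rel I edges E `` {(C, x)} | x. x \<in> davis_chamber I edges}"

definition U_mirror ::
  "'i set \<Rightarrow> 'i set set \<Rightarrow> ('i \<Rightarrow> 'c) set \<Rightarrow> ('i \<Rightarrow> 'c) \<Rightarrow> 'i
     \<Rightarrow> (('i \<Rightarrow> 'c) \<times> ('i set \<Rightarrow> real)) set set" where
  "U_mirror I edges E C i = {U_rel I edges E `` {(C, x)} | x. x \<in> davis_mirror I edges i}"

section \<open>The graph product\<close>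

text \<open>
  Here \<open>q\<close> is a universal covering map from \<open>X\<close> to \<^term>\<open>U_space I edges E\<close>. A copy of the Davis
  chamber in \<open>X\<close> is a subset that \<open>q\<close> maps homeomorphically onto the image of \<open>{C} \<times> K'\<close> for some
  chamber \<open>C\<close>. That \<open>C\<close> is unique, because \<open>\<emptyset>\<close> is a vertex of \<open>K'\<close> lying in no mirror.
\<close>

definition gp_chambers ::
  "'i set \<Rightarrow> 'i set set \<Rightarrow> ('i \<Rightarrow> 'c) set \<Rightarrow> 'u topology
     \<Rightarrow> ('u \<Rightarrow> (('i \<Rightarrow> 'c) \<times> ('i set \<Rightarrow> real)) set) \<Rightarrow> 'u set set" where
  "gp_chambers I edges E X q =
     {A. A \<subseteq> topspace X \<and>
         (\<exists>C\<in>E. homeomorphic_map (subtopology X A)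
                  (subtopology (U_space I edges E) (U_chamber I edges E C)) q)}"

definition gp_proj ::
  "'i set \<Rightarrow> 'i set set \<Rightarrow> ('i \<Rightarrow> 'c) set
     \<Rightarrow> ('u \<Rightarrow> (('i \<Rightarrow> 'c) \<times> ('i set \<Rightarrow> real)) set) \<Rightarrow> 'u set \<Rightarrow> 'i \<Rightarrow> 'c" where
  "gp_proj I edges E q A = (THE C. C \<in> E \<and> q ` A = U_chamber I edges E C)"

definition gp_mirror ::
  "'i set \<Rightarrow> 'i set set \<Rightarrow> ('i \<Rightarrow> 'c) set
     \<Rightarrow> ('u \<Rightarrow> (('i \<Rightarrow> 'c) \<times> ('i set \<Rightarrow> real)) set) \<Rightarrow> 'i \<Rightarrow> 'u set \<Rightarrow> 'u set" where
  "gp_mirror I edges E q i A = {a \<in> A. q a \<in> U_mirror I edges E (gp_proj I edges E q A) i}"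

definition gp_adjacent ::
  "'i set \<Rightarrow> 'i set set \<Rightarrow> ('i \<Rightarrow> 'c) set
     \<Rightarrow> ('u \<Rightarrow> (('i \<Rightarrow> 'c) \<times> ('i set \<Rightarrow> real)) set) \<Rightarrow> 'i \<Rightarrow> 'u set \<Rightarrow> 'u set \<Rightarrow> bool" where
  "gp_adjacent I edges E q i A B \<longleftrightarrow>
     A \<noteq> B \<and> gp_mirror I edges E q i A = gp_mirror I edges E q i B"

definition gp_aut ::
  "'i set \<Rightarrow> 'i set set \<Rightarrow> ('i \<Rightarrow> 'c) set \<Rightarrow> 'u topology
     \<Rightarrow> ('u \<Rightarrow> (('i \<Rightarrow> 'c) \<times> ('i set \<Rightarrow> real)) set) \<Rightarrow> ('u set \<Rightarrow> 'u set) set" where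
  "gp_aut I edges E X q =
     {h \<in> Bij (gp_chambers I edges E X q).
        \<forall>i\<in>I. \<forall>A \<in> gp_chambers I edges E X q. \<forall>B \<in> gp_chambers I edges E X q.
          gp_adjacent I edges E q i (h A) (h B) \<longleftrightarrow> gp_adjacent I edges E q i A B}"

definition product_action :: "'i set \<Rightarrow> ('i \<Rightarrow> 'c \<Rightarrow> 'c) \<Rightarrow> ('i \<Rightarrow> 'c) \<Rightarrow> 'i \<Rightarrow> 'c" where
  "product_action I g C = (\<lambda>i\<in>I. g i (C i))"

text \<open>The group of all lifts of the action on \<open>E\<close> of the product of the groups \<open>G i\<close>.\<close>

definition lift_group ::
  "'i set \<Rightarrow> 'i set set \<Rightarrow> ('i \<Rightarrow> 'c) set \<Rightarrow> 'u topology
     \<Rightarrow> ('u \<Rightarrow> (('i \<Rightarrow> 'c) \<times> ('i set \<Rightarrow> real)) set) \<Rightarrow> ('i \<Rightarrow> ('c \<Rightarrow> 'c) monoid)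
     \<Rightarrow> ('u set \<Rightarrow> 'u set) monoid" where
  "lift_group I edges E X q G =
     BijGroup (gp_chambers I edges E X q) \<lparr>carrier :=
       {h \<in> gp_aut I edges E X q.
          \<exists>g \<in> carrier (product_group I G). \<forall>A \<in> gp_chambers I edges E X q.
            gp_proj I edges E q (h A) = product_action I g (gp_proj I edges E q A)}\<rparr>"

end

theory Submission
  imports Defs "HOL-Combinatorics.Transposition"
begin

text \<open>
  A lift \<open>h \<noteq> 1\<close> moves some chamber \<open>A\<close> of the graph product, and it suffices to find a map \<open>f\<close> from the
  chambers to a finite set with \<open>f (h A) \<noteq> f A\<close> that has only finitely many translates \<open>f \<circ> g\<close> under
  lifts \<open>g\<close>: the group of lifts then acts on this finite set of translates, \<open>h\<close> acts nontrivially, and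
  the kernel of the action is the normal subgroup looked for
  (\<open>finite_action_separates\<close>, \<open>finite_translates\<close>).

  The maps \<open>f\<close> are morphisms of chamber systems. Changing the \<open>i\<close>-th coordinate of a chamber to \<open>c\<close>
  inside its \<open>i\<close>-panel defines operations \<open>op i c\<close> on the chambers of the product building, and on those
  of the graph product; the operations of \<open>i\<close> and \<open>j\<close> commute when \<open>{i, j}\<close> is an edge. A chamber system is
  a set over the product building with such operations. A lift of \<open>g\<close> carries \<open>op i c\<close> to
  \<open>op i (g i c)\<close>, and the graph product is connected by galleries, so \<open>f \<circ> h\<close> is determined by one value
  and by the element of the finite group \<open>\<Prod> G\<^sub>i\<close> that \<open>h\<close> lifts.

  Topology enters through the universal property of the graph product (\<open>universality\<close>): every chamber
  system receives a morphism from it with a prescribed value. Indeed a chamber system has a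
  geometric realization, glued from copies of the Davis chamber exactly like that of the product
  building, and it covers the latter, because spherical subsets are cliques and because residues
  whose generators commute pairwise are mapped bijectively. The universal covering map factors
  through this covering, by lifting paths and homotopies. The same argument, applied to a union of
  gallery components, gives connectedness by galleries (\<open>chambers_induct\<close>).

  It remains to separate two chambers by a finite chamber system (\<open>finite_separation\<close>). The word
  problem for graph products is solved by pilings: stacks, one for each generator, on which a gallery
  leaves a record that is empty only if the gallery is closed. Cutting this infinite chamber
  system off at \<open>N\<close> beads on each stack makes it finite, while galleries of length at most \<open>N\<close> are
  still recorded faithfully.
\<close>

section \<open>Lifting through covering maps\<close>

lemma covering_map_continuous: "covering_map X Y q \<Longrightarrow> continuous_map X Y q"
  by (simp add: covering_map_def)

definition evenly_covered :: "'a topology \<Rightarrow> 'b topology \<Rightarrow> ('a \<Rightarrow> 'b) \<Rightarrow> 'b set \<Rightarrow> 'a set set \<Rightarrow> bool" where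
  "evenly_covered X Y q V \<U> \<longleftrightarrow> openin Y V \<and> \<Union>\<U> = {x \<in> topspace X. q x \<in> V} \<and>
     (\<forall>U\<in>\<U>. openin X U) \<and> pairwise disjnt \<U> \<and>
     (\<forall>U\<in>\<U>. homeomorphic_map (subtopology X U) (subtopology Y V) q)"

lemma covering_map_evenly_covered:
  assumes "covering_map X Y q" "y \<in> topspace Y"
  shows "\<exists>V \<U>. y \<in> V \<and> evenly_covered X Y q V \<U>"
proof -
  have "\<exists>V. y \<in> V \<and> openin Y V \<and> (\<exists>\<U>. \<Union>\<U> = {x \<in> topspace X. q x \<in> V} \<and>
      (\<forall>U\<in>\<U>. openin X U) \<and> pairwise disjnt \<U> \<and>
      (\<forall>U\<in>\<U>. homeomorphic_map (subtopology X U) (subtopology Y V) q))"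
    using assms by (simp only: covering_map_def)
  then show ?thesis unfolding evenly_covered_def by (elim exE conjE) (intro exI conjI)
qed

text \<open>Over an evenly covered set the inverse of the projection of a sheet is a continuous section.\<close>

lemma evenly_covered_section:
  assumes ev: "evenly_covered X Y q V \<U>" and x: "x \<in> topspace X" "q x \<in> V"
  shows "\<exists>U \<tau>. U \<in> \<U> \<and> x \<in> U \<and> openin X U \<and> continuous_map (subtopology Y V) X \<tau> \<and>
    (\<forall>v\<in>V. \<tau> v \<in> U \<and> q (\<tau> v) = v) \<and> (\<forall>u\<in>U. \<tau> (q u) = u)"
proof -
  have "x \<in> \<Union>\<U>" using ev x by (simp add: evenly_covered_def)
  then obtain U where "U \<in> \<U>" "x \<in> U" by blast
  then have U: "openin X U" "openin Y V" "homeomorphic_map (subtopology X U) (subtopology Y V) q"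
    using ev by (auto simp: evenly_covered_def)
  obtain \<tau> where "homeomorphic_maps (subtopology X U) (subtopology Y V) q \<tau>"
    using U(3) homeomorphic_map_maps by blast
  moreover have "topspace (subtopology X U) = U" "topspace (subtopology Y V) = V"
    using openin_subset[OF U(1)] openin_subset[OF U(2)] by (simp_all add: inf.absorb2)
  ultimately have "continuous_map (subtopology Y V) X \<tau>"
    "\<And>v. v \<in> V \<Longrightarrow> \<tau> v \<in> U \<and> q (\<tau> v) = v" "\<And>u. u \<in> U \<Longrightarrow> \<tau> (q u) = u"
    by (auto simp: homeomorphic_maps_def continuous_map_in_subtopology Pi_iff)
  then show ?thesis using \<open>U \<in> \<U>\<close> \<open>x \<in> U\<close> U(1) by blast
qed

text \<open>Near a point each of two lifts stays in one sheet. Hence the sets where they agree and where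
  they differ are both open.\<close>

lemma covering_lift_unique:
  assumes cov: "covering_map X Y q" and Z: "connected_space Z"
    and f: "continuous_map Z X f" and g: "continuous_map Z X g"
    and eq: "\<And>z. z \<in> topspace Z \<Longrightarrow> q (f z) = q (g z)"
    and z0: "z0 \<in> topspace Z" "f z0 = g z0" and z: "z \<in> topspace Z"
  shows "f z = g z"
proof -
  have fX: "f z \<in> topspace X" and gX: "g z \<in> topspace X" if "z \<in> topspace Z" for z
    using f g that continuous_map_image_subset_topspace by blast+
  let ?S = "{z \<in> topspace Z. f z = g z}"
  have nb: "\<exists>N. openin Z N \<and> z \<in> N \<and> (\<forall>w\<in>N. f w = g w \<longleftrightarrow> f z = g z)" if z: "z \<in> topspace Z" for z
  proof -
    have "q (f z) \<in> topspace Y"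
      using covering_map_continuous[OF cov] fX[OF z] continuous_map_image_subset_topspace by blast
    then obtain V \<U> where V: "q (f z) \<in> V" "evenly_covered X Y q V \<U>"
      using covering_map_evenly_covered[OF cov] by blast
    from evenly_covered_section[OF V(2) fX[OF z] V(1)]
    obtain U1 \<tau> where U1: "U1 \<in> \<U>" "f z \<in> U1" "openin X U1" "\<forall>u\<in>U1. \<tau> (q u) = u" by blast
    have "q (g z) \<in> V" using V(1) eq[OF z] by simp
    from evenly_covered_section[OF V(2) gX[OF z] this]
    obtain U2 where U2: "U2 \<in> \<U>" "g z \<in> U2" "openin X U2" by blast
    let ?N = "{w \<in> topspace Z. f w \<in> U1} \<inter> {w \<in> topspace Z. g w \<in> U2}"
    have "openin Z ?N"
      using openin_continuous_map_preimage[OF f U1(3)]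
        openin_continuous_map_preimage[OF g U2(3)] by (rule openin_Int)
    moreover have "f w = g w \<longleftrightarrow> f z = g z" if w: "w \<in> ?N" for w
    proof (cases "U1 = U2")
      case True
      have "f w \<in> U1" "g w \<in> U1" "g z \<in> U1" using True U2(2) w by simp_all
      then have \<tau>: "\<tau> (q (f w)) = f w" "\<tau> (q (g w)) = g w" "\<tau> (q (f z)) = f z" "\<tau> (q (g z)) = g z"
        using U1(2,4) by blast+
      have "q (f w) = q (g w)" using eq w by blast
      then show ?thesis using \<tau> eq[OF z] by metis
    next
      case False
      then have "U1 \<inter> U2 = {}"
        using V(2) U1 U2 by (auto simp: evenly_covered_def pairwise_def disjnt_def)
      then show ?thesis using U1 U2 w by auto
    qed
    ultimately show ?thesis using U1 U2 z by blast
  qed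
  have "openin Z {z \<in> topspace Z. (f z = g z) = b}" for b
    unfolding openin_subopen[of Z "{z \<in> topspace Z. (f z = g z) = b}"]
  proof
    fix z assume "z \<in> {z \<in> topspace Z. (f z = g z) = b}"
    then have z: "z \<in> topspace Z" "(f z = g z) = b" by auto
    obtain N where N: "openin Z N" "z \<in> N" "\<forall>w\<in>N. (f w = g w) = (f z = g z)" using nb[OF z(1)] by blast
    have "N \<subseteq> {z \<in> topspace Z. (f z = g z) = b}"
      using N(3) z(2) openin_subset[OF N(1)] by blast
    then show "\<exists>T. openin Z T \<and> z \<in> T \<and> T \<subseteq> {z \<in> topspace Z. (f z = g z) = b}" using N(1,2) by blast
  qed
  from this[of True] this[of False] have "openin Z ?S" "openin Z (topspace Z - ?S)"
    by (simp_all add: set_diff_eq conj_commute cong: conj_cong)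
  then have "?S = {} \<or> ?S = topspace Z"
    using Z by (auto simp: connected_space_clopen_in closedin_def)
  then show ?thesis using z0 z by blast
qed

abbreviation unit_interval :: "real topology" where
  "unit_interval \<equiv> top_of_set {0..1}"

lemma connected_unit_interval: "connected_space unit_interval"
  using connectedin_absolute connectedin_iff_connected connected_Icc connectedin_def
  by (metis (no_types))

lemma path_lift_unique:
  assumes "covering_map X Y q" "pathin X f" "pathin X g"
    and "\<And>t. t \<in> {0..1} \<Longrightarrow> q (f t) = q (g t)" "s \<in> {0..1}" "f s = g s" "t \<in> {0..1}"
  shows "f t = g t"
  by (rule covering_lift_unique[OF assms(1) connected_unit_interval assms(2,3)[unfolded pathin_def]])
    (use assms(4-) in simp_all)

text \<open>The induction follows the unit interval in steps so short that the homotopy stays in one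
  evenly covered set, on a neighbourhood of the given point of the parameter space.\<close>

lemma local_homotopy_lift:
  assumes cov: "covering_map X Y q"
    and h: "continuous_map (prod_topology unit_interval Z) Y h"
    and f: "continuous_map Z X f"
    and qf: "\<And>z. z \<in> topspace Z \<Longrightarrow> q (f z) = h (0, z)" and z0: "z0 \<in> topspace Z"
  obtains N G where "openin Z N" "z0 \<in> N"
    "continuous_map (prod_topology unit_interval (subtopology Z N)) X G"
    "\<And>t z. t \<in> {0..1} \<Longrightarrow> z \<in> N \<Longrightarrow> q (G (t, z)) = h (t, z)"
    "\<And>z. z \<in> N \<Longrightarrow> G (0, z) = f z"
proof -
  have hY: "h (t, z) \<in> topspace Y" if "t \<in> {0..1}" "z \<in> topspace Z" for t z
    using h that continuous_map_image_subset_topspace by fastforce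
  have "\<exists>J N. open J \<and> t \<in> J \<and> openin Z N \<and> z0 \<in> N \<and> (\<exists>V \<U>. evenly_covered X Y q V \<U> \<and> h ` ((J \<inter> {0..1}) \<times> N) \<subseteq> V)"
    if t: "t \<in> {0..1}" for t
  proof -
    obtain V \<U> where V: "evenly_covered X Y q V \<U>" "h (t, z0) \<in> V"
      using covering_map_evenly_covered[OF cov hY[OF t z0]] by blast
    let ?P = "{w \<in> topspace (prod_topology unit_interval Z). h w \<in> V}"
    have P: "openin (prod_topology unit_interval Z) ?P"
      using V(1) openin_continuous_map_preimage[OF h] by (simp add: evenly_covered_def)
    have "(t, z0) \<in> ?P" using t z0 V by simp
    from openin_prod_topology_alt[THEN iffD1, OF P, rule_format, OF this]
    obtain A N where AN: "openin unit_interval A" "openin Z N" "t \<in> A" "z0 \<in> N" "A \<times> N \<subseteq> ?P"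
      by (elim exE conjE)
    obtain J where "open J" "A = J \<inter> {0..1}"
      using AN(1) by (auto simp: openin_open)
    then show ?thesis using AN V(1) by (intro exI[of _ J] exI[of _ N]) auto
  qed
  then obtain J N where JN: "\<And>t. t \<in> {0..1} \<Longrightarrow> open (J t) \<and> t \<in> J t \<and> openin Z (N t) \<and> z0 \<in> N t
      \<and> (\<exists>V \<U>. evenly_covered X Y q V \<U> \<and> h ` ((J t \<inter> {0..1}) \<times> N t) \<subseteq> V)" by metis
  have "\<exists>e>0. \<forall>T. T \<subseteq> {0..1} \<longrightarrow> diameter T < e \<longrightarrow> (\<exists>B\<in>J ` {0..1}. T \<subseteq> B)"
  proof (rule Lebesgue_number_lemma[of "{0..1::real}" "J ` {0..1}"])
    show "{0..1} \<subseteq> \<Union>(J ` {0..1})" "\<And>B. B \<in> J ` {0..1} \<Longrightarrow> open B" using JN by blast+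
  qed auto
  then obtain e where e: "e > 0" "\<And>T. T \<subseteq> {0..1} \<Longrightarrow> diameter T < e \<Longrightarrow> \<exists>B\<in>J ` {0..1}. T \<subseteq> B"
    by blast
  obtain n where n: "n > 0" "1 / real n < e"
    using e(1) by (metis nat_approx_posE zero_less_Suc)
  define a where "a k = real k / real n" for k
  have aS: "a (Suc k) = a k + 1 / real n" for k by (simp add: a_def add_divide_distrib)
  have a01: "a k \<in> {0..1}" if "k \<le> n" for k using that n by (simp add: a_def)
  have "\<exists>t. t \<in> {0..1} \<and> {a k..a (Suc k)} \<subseteq> J t" if k: "k < n" for k
  proof -
    have "{a k..a (Suc k)} \<subseteq> {0..1}" using a01[of k] a01[of "Suc k"] k by auto
    moreover have "diameter {a k..a (Suc k)} < e" using n by (simp add: aS)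
    ultimately show ?thesis using e(2) by blast
  qed
  then obtain t where t: "\<And>k. k < n \<Longrightarrow> t k \<in> {0..1} \<and> {a k..a (Suc k)} \<subseteq> J (t k)" by metis
  have step: "\<exists>N G. openin Z N \<and> z0 \<in> N \<and>
      continuous_map (prod_topology (top_of_set {0..a k}) (subtopology Z N)) X G \<and>
      (\<forall>s\<in>{0..a k}. \<forall>z\<in>N. q (G (s, z)) = h (s, z)) \<and> (\<forall>z\<in>N. G (0, z) = f z)"
    if "k \<le> n" for k
    using that
  proof (induction k)
    case 0
    have "continuous_map (prod_topology (top_of_set {0..a 0}) (subtopology Z (topspace Z))) X (f \<circ> snd)"
      using f by (auto intro: continuous_map_compose[OF continuous_map_snd])
    then show ?case using z0 qf by (intro exI[of _ "topspace Z"] exI[of _ "f \<circ> snd"]) (auto simp: a_def o_def)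
  next
    case (Suc k)
    then obtain M G where M: "openin Z M" "z0 \<in> M"
      and G: "continuous_map (prod_topology (top_of_set {0..a k}) (subtopology Z M)) X G"
      and qG: "\<forall>s\<in>{0..a k}. \<forall>z\<in>M. q (G (s, z)) = h (s, z)" and G0: "\<forall>z\<in>M. G (0, z) = f z"
      by auto
    have k: "k < n" using Suc by simp
    note tk = t[OF k]
    obtain V \<U> where V: "evenly_covered X Y q V \<U>" "h ` ((J (t k) \<inter> {0..1}) \<times> N (t k)) \<subseteq> V"
      using JN[of "t k"] tk by blast
    have ak: "0 \<le> a k" "a k \<le> a (Suc k)" "a (Suc k) \<le> 1" using a01[of k] a01[of "Suc k"] k aS by auto
    have hV: "h (s, z) \<in> V" if "s \<in> {a k..a (Suc k)}" "z \<in> N (t k)" for s z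
    proof -
      have "s \<in> J (t k) \<inter> {0..1}" using tk that(1) ak by auto
      then show ?thesis using V(2) that by blast
    qed
    have N: "openin Z (N (t k))" "z0 \<in> N (t k)" using JN tk by auto
    have Gk: "continuous_map (subtopology Z M) X (\<lambda>z. G (a k, z))"
      by (rule continuous_map_compose[OF _ G, unfolded o_def])
        (use ak in \<open>auto intro!: continuous_map_pairedI simp: continuous_map_const\<close>)
    have "q (G (a k, z0)) \<in> V" using qG M ak hV[of "a k" z0] N by auto
    moreover have "G (a k, z0) \<in> topspace X"
      using continuous_map_image_subset_topspace[OF Gk] M z0 by auto
    ultimately obtain U \<tau> where U: "U \<in> \<U>" "G (a k, z0) \<in> U" "openin X U"
      and \<tau>: "continuous_map (subtopology Y V) X \<tau>" "\<forall>v\<in>V. \<tau> v \<in> U \<and> q (\<tau> v) = v"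
      "\<forall>u\<in>U. \<tau> (q u) = u"
      using evenly_covered_section[OF V(1)] by blast
    define M' where "M' = {z \<in> topspace (subtopology Z M). G (a k, z) \<in> U} \<inter> N (t k)"
    have "openin (subtopology Z M) {z \<in> topspace (subtopology Z M). G (a k, z) \<in> U}"
      using openin_continuous_map_preimage[OF Gk U(3)] .
    then have M'o: "openin Z M'"
      unfolding M'_def using N(1) M(1) openin_open_subtopology[OF M(1)] by (metis (lifting) openin_Int)
    have M'sub: "M' \<subseteq> M" "M' \<subseteq> N (t k)" "\<And>z. z \<in> M' \<Longrightarrow> G (a k, z) \<in> U" by (auto simp: M'_def)
    have M'z: "z0 \<in> M'" using M U N z0 by (auto simp: M'_def)
    let ?P = "prod_topology (top_of_set {0..a (Suc k)}) (subtopology Z M')"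
    let ?G = "\<lambda>w. if fst w \<le> a k then G w else \<tau> (h w)"
    have topP: "topspace ?P = {0..a (Suc k)} \<times> M'"
      using openin_subset[OF M'o] by auto
    have "continuous_map ?P X ?G"
    proof (rule continuous_map_cases_le)
      show "continuous_map ?P euclideanreal fst"
        using continuous_map_fst[of "top_of_set {0..a (Suc k)}" "subtopology Z M'"]
        by (simp add: continuous_map_in_subtopology)
      have "subtopology ?P {w \<in> topspace ?P. fst w \<le> a k} = prod_topology (top_of_set {0..a k}) (subtopology Z M')"
      proof -
        have "{w \<in> topspace ?P. fst w \<le> a k} = {0..a k} \<times> M'" using ak topP by auto
        then show ?thesis using ak
          by (simp add: subtopology_Times subtopology_subtopology inf.absorb2)
      qed
      moreover have "continuous_map (prod_topology (top_of_set {0..a k}) (subtopology Z M')) X G"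
      proof -
        have "prod_topology (top_of_set {0..a k}) (subtopology Z M') =
            subtopology (prod_topology (top_of_set {0..a k}) (subtopology Z M)) ({0..a k} \<times> M')"
          using M'sub(1) by (simp add: subtopology_Times subtopology_subtopology inf.absorb2)
        then show ?thesis using G by (simp add: continuous_map_from_subtopology)
      qed
      ultimately show "continuous_map (subtopology ?P {w \<in> topspace ?P. fst w \<le> a k}) X G" by (simp only:)
      let ?Q = "{w \<in> topspace ?P. a k \<le> fst w}"
      have Q: "?Q = {a k..a (Suc k)} \<times> M'" using ak topP by auto
      have "subtopology ?P ?Q = subtopology (prod_topology unit_interval Z) ?Q"
        unfolding Q using ak by (simp add: subtopology_Times subtopology_subtopology inf.absorb2)
      then have "continuous_map (subtopology ?P ?Q) Y h"
        by (simp only: continuous_map_from_subtopology[OF h])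
      moreover have "h \<in> topspace (subtopology ?P ?Q) \<rightarrow> V"
      proof
        fix w assume "w \<in> topspace (subtopology ?P ?Q)"
        then have "w \<in> {a k..a (Suc k)} \<times> M'" unfolding Q topspace_subtopology by blast
        then show "h w \<in> V" using hV M'sub(2) by blast
      qed
      ultimately have "continuous_map (subtopology ?P ?Q) (subtopology Y V) h"
        unfolding continuous_map_in_subtopology by (rule conjI)
      then show "continuous_map (subtopology ?P ?Q) X (\<lambda>w. \<tau> (h w))"
        by (rule continuous_map_compose[OF _ \<tau>(1), unfolded o_def])
      fix w assume w: "w \<in> topspace ?P" "fst w = a k"
      then obtain z where z: "w = (a k, z)" "z \<in> M'" using topP by auto
      then have "G w \<in> U" "q (G w) = h w" using M'sub qG ak by auto
      then show "G w = \<tau> (h w)" using \<tau>(3) by force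
    qed (auto simp: continuous_map_const)
    moreover have "q (?G (s, z)) = h (s, z)" if "s \<in> {0..a (Suc k)}" "z \<in> M'" for s z
    proof (cases "s \<le> a k")
      case True
      have "z \<in> M" "s \<in> {0..a k}" using that M'sub(1) True by auto
      then show ?thesis using qG True by simp
    next
      case False
      have "s \<in> {a k..a (Suc k)}" "z \<in> N (t k)" using that M'sub(2) False by auto
      then show ?thesis using hV \<tau>(2) False by simp
    qed
    moreover have "?G (0, z) = f z" if "z \<in> M'" for z
    proof -
      have "z \<in> M" using that M'sub(1) by blast
      then show ?thesis using G0 ak(1) by simp
    qed
    ultimately show ?case
      by (intro exI[of _ M'] exI[of _ ?G] conjI ballI M'o M'z)
  qed
  have an: "a n = 1" using n by (simp add: a_def)
  from step[OF order_refl, unfolded an]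
  obtain N G where NG: "openin Z N" "z0 \<in> N"
      "continuous_map (prod_topology unit_interval (subtopology Z N)) X G"
      "\<forall>s\<in>{0..1}. \<forall>z\<in>N. q (G (s, z)) = h (s, z)" "\<forall>z\<in>N. G (0, z) = f z"
    by (elim exE conjE)
  show thesis
  proof (rule that)
    show "openin Z N" "z0 \<in> N" "continuous_map (prod_topology unit_interval (subtopology Z N)) X G"
      by (fact NG)+
    fix t z assume "t \<in> {0..1::real}" "z \<in> N"
    with NG(4) show "q (G (t, z)) = h (t, z)" by blast
  next
    fix z assume "z \<in> N"
    with NG(5) show "G (0, z) = f z" by blast
  qed
qed

text \<open>The local lifts agree on overlaps, because they agree at time \<open>0\<close> and are unique along
  the paths \<open>t \<mapsto> h (t, z)\<close>.\<close>

theorem covering_homotopy_lift: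
  assumes cov: "covering_map X Y q"
    and h: "continuous_map (prod_topology unit_interval Z) Y h"
    and f: "continuous_map Z X f"
    and qf: "\<And>z. z \<in> topspace Z \<Longrightarrow> q (f z) = h (0, z)"
  shows "\<exists>G. continuous_map (prod_topology unit_interval Z) X G \<and>
    (\<forall>t\<in>{0..1}. \<forall>z\<in>topspace Z. q (G (t, z)) = h (t, z)) \<and> (\<forall>z\<in>topspace Z. G (0, z) = f z)"
proof -
  have "\<forall>z\<in>topspace Z. \<exists>N G. openin Z N \<and> z \<in> N \<and>
      continuous_map (prod_topology unit_interval (subtopology Z N)) X G \<and>
      (\<forall>t\<in>{0..1}. \<forall>z\<in>N. q (G (t, z)) = h (t, z)) \<and> (\<forall>z\<in>N. G (0, z) = f z)"
    by (metis local_homotopy_lift[OF cov h f qf])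
  then obtain N G where NG: "\<And>z. z \<in> topspace Z \<Longrightarrow> openin Z (N z) \<and> z \<in> N z \<and>
      continuous_map (prod_topology unit_interval (subtopology Z (N z))) X (G z) \<and>
      (\<forall>t\<in>{0..1}. \<forall>w\<in>N z. q (G z (t, w)) = h (t, w)) \<and> (\<forall>w\<in>N z. G z (0, w) = f w)"
    by metis
  have path: "pathin X (\<lambda>t. G z (t, w))" if "z \<in> topspace Z" "w \<in> N z" for z w
    unfolding pathin_def
  proof (rule continuous_map_compose[of _ "prod_topology unit_interval (subtopology Z (N z))", unfolded o_def])
    show "continuous_map unit_interval (prod_topology unit_interval (subtopology Z (N z))) (\<lambda>t. (t, w))"
      using that NG[OF that(1)] openin_subset by (fastforce intro!: continuous_map_pairedI simp: continuous_map_const)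
  qed (use that NG in blast)
  have agree: "G z (t, w) = G z' (t, w)"
    if "z \<in> topspace Z" "z' \<in> topspace Z" "w \<in> N z" "w \<in> N z'" "t \<in> {0..1}" for z z' w t
    by (rule path_lift_unique[OF cov path[OF that(1,3)] path[OF that(2,4)], where s = 0]) (use that NG in auto)
  define H where "H w = G (snd w) w" for w
  have "continuous_map (prod_topology unit_interval Z) X H"
  proof (rule pasting_lemma[where I = "topspace Z" and T = "\<lambda>z. {0..1} \<times> N z" and f = G])
    fix z assume z: "z \<in> topspace Z"
    show "openin (prod_topology unit_interval Z) ({0..1} \<times> N z)"
      using NG[OF z] by (simp add: openin_prod_Times_iff)
    have "subtopology (prod_topology unit_interval Z) ({0..1} \<times> N z)
        = prod_topology unit_interval (subtopology Z (N z))"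
      by (simp add: subtopology_Times subtopology_subtopology)
    then show "continuous_map (subtopology (prod_topology unit_interval Z) ({0..1} \<times> N z)) X (G z)"
      using NG[OF z] by (simp only:)
  next
    fix z z' w assume "z \<in> topspace Z" "z' \<in> topspace Z"
      "w \<in> topspace (prod_topology unit_interval Z) \<inter> {0..1} \<times> N z \<inter> {0..1} \<times> N z'"
    moreover then obtain t v where "w = (t, v)" "t \<in> {0..1}" "v \<in> N z" "v \<in> N z'" by blast
    ultimately show "G z w = G z' w" using agree by blast
  next
    fix w assume "w \<in> topspace (prod_topology unit_interval Z)"
    then show "\<exists>j. j \<in> topspace Z \<and> w \<in> {0..1} \<times> N j \<and> H w = G j w"
      using NG by (intro exI[of _ "snd w"]) (auto simp: H_def)
  qed
  moreover have "\<forall>t\<in>{0..1}. \<forall>z\<in>topspace Z. q (H (t, z)) = h (t, z)" "\<forall>z\<in>topspace Z. H (0, z) = f z"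
    using NG by (auto simp: H_def)
  ultimately show ?thesis by blast
qed

lemma covering_path_lift:
  assumes cov: "covering_map X Y q" and g: "pathin Y g" and x: "x \<in> topspace X" "q x = g 0"
  shows "\<exists>k. pathin X k \<and> k 0 = x \<and> (\<forall>t\<in>{0..1}. q (k t) = g t)"
proof -
  let ?Z = "discrete_topology {()}"
  have "continuous_map (prod_topology unit_interval ?Z) Y (g \<circ> fst)"
    by (rule continuous_map_compose[OF continuous_map_fst]) (use g in \<open>simp add: pathin_def\<close>)
  moreover have "continuous_map ?Z X (\<lambda>_. x)" using x by (simp add: continuous_map_const)
  ultimately obtain G where G: "continuous_map (prod_topology unit_interval ?Z) X G"
    "\<forall>t\<in>{0..1}. \<forall>z\<in>topspace ?Z. q (G (t, z)) = (g \<circ> fst) (t, z)" "\<forall>z\<in>topspace ?Z. G (0, z) = x"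
    using covering_homotopy_lift[OF cov, of ?Z "g \<circ> fst" "\<lambda>_. x"] x by auto
  have "pathin X (\<lambda>t. G (t, ()))"
    unfolding pathin_def
    by (rule continuous_map_compose[OF _ G(1), unfolded o_def])
      (auto intro!: continuous_map_pairedI simp: continuous_map_const)
  moreover have "G (0, ()) = x" "\<forall>t\<in>{0..1}. q (G (t, ())) = g t" using G(2,3) by auto
  ultimately show ?thesis by blast
qed

lemma pathin_reparam:
  assumes "pathin X g" "continuous_on {0..1} r" "r ` {0..1} \<subseteq> {0..1}"
  shows "pathin X (\<lambda>t. g (r t))"
  unfolding pathin_def
  by (rule continuous_map_compose[OF _ assms(1)[unfolded pathin_def], unfolded o_def])
    (use assms in \<open>auto simp: continuous_map_in_subtopology\<close>)

lemma pathin_join: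
  assumes "pathin X f" "pathin X g" "f 1 = g 0"
  shows "pathin X (\<lambda>t. if t \<le> 1/2 then f (2 * t) else g (2 * t - 1))"
  unfolding pathin_def
proof (rule continuous_map_cases_le)
  have *: "continuous_map (top_of_set S) X (\<lambda>t. k (r t))"
    if "pathin X k" "continuous_on S r" "r ` S \<subseteq> {0..1}" for k r and S :: "real set"
    by (rule continuous_map_compose[OF _ that(1)[unfolded pathin_def], unfolded o_def])
      (use that in \<open>auto simp: continuous_map_in_subtopology\<close>)
  show "continuous_map (subtopology unit_interval {t \<in> topspace unit_interval. t \<le> 1/2}) X (\<lambda>t. f (2 * t))"
    "continuous_map (subtopology unit_interval {t \<in> topspace unit_interval. 1/2 \<le> t}) X (\<lambda>t. g (2 * t - 1))"
    unfolding subtopology_subtopology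
    by (rule *; use assms in \<open>auto intro!: continuous_intros\<close>)+
  show "f (2 * t) = g (2 * t - 1)" if "t = 1/2" for t
    using assms(3) by (simp add: that)
qed auto

text \<open>The homotopy through loops lifts. It ends in a lift of a constant path, which is constant, and
  the two lifts of the track of the base point that agree there agree everywhere.\<close>

lemma null_homotopic_lift_closed:
  assumes cov: "covering_map X Y q"
    and h: "continuous_map (prod_topology unit_interval unit_interval) Y h"
    and loops: "\<And>t. t \<in> {0..1} \<Longrightarrow> h (t, 1) = h (t, 0)"
    and const: "\<And>s. s \<in> {0..1} \<Longrightarrow> h (1, s) = y"
    and k: "pathin X k" "\<And>s. s \<in> {0..1} \<Longrightarrow> q (k s) = h (0, s)"
  shows "k 1 = k 0"
proof -
  obtain G where G: "continuous_map (prod_topology unit_interval unit_interval) X G"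
    "\<And>t s. t \<in> {0..1} \<Longrightarrow> s \<in> {0..1} \<Longrightarrow> q (G (t, s)) = h (t, s)"
    "\<And>s. s \<in> {0..1} \<Longrightarrow> G (0, s) = k s"
    using covering_homotopy_lift[OF cov h, of k] k by (auto simp: pathin_def)
  have hor: "pathin X (\<lambda>s. G (t, s))" and ver: "pathin X (\<lambda>s. G (s, t))" if "t \<in> {0..1}" for t
    unfolding pathin_def using that
    by (auto intro!: continuous_map_compose[OF _ G(1), unfolded o_def] continuous_map_pairedI
        simp: continuous_map_const)
  have c: "pathin X (\<lambda>s. G (1, 0))"
    using continuous_map_image_subset_topspace[OF G(1)] by (force simp: pathin_def continuous_map_const)
  have z: "(0::real) \<in> {0..1}" "(1::real) \<in> {0..1}" by auto
  have "q (G (1, s)) = q (G (1, 0))" if "s \<in> {0..1}" for s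
    using G(2)[OF z(2)] const that z by simp
  from path_lift_unique[OF cov hor[OF z(2)] c this z(1) HOL.refl z(2)]
  have e: "G (1, 1) = G (1, 0)" .
  have "q (G (t, 1)) = q (G (t, 0))" if "t \<in> {0..1}" for t
    using G(2)[OF that] loops[OF that] z by simp
  from path_lift_unique[OF cov ver[OF z(2)] ver[OF z(1)] this z(2) e z(1)]
  have "G (0, 1) = G (0, 0)" .
  then show ?thesis using G(3) by simp
qed

lemma simply_connected_space_path:
  assumes sc: "simply_connected_space X" and u: "u \<in> topspace X" "v \<in> topspace X"
  shows "\<exists>g. pathin X g \<and> g 0 = u \<and> g 1 = v"
proof -
  have "pathin X (\<lambda>_. w)" if "w \<in> topspace X" for w
    using that by (simp add: pathin_def continuous_map_const)
  then have "homotopic_with (\<lambda>r. r 1 = r 0) unit_interval X (\<lambda>_. u) (\<lambda>_. v)"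
    using sc u unfolding simply_connected_space_def by blast
  then obtain h where h: "continuous_map (prod_topology unit_interval unit_interval) X h"
    "\<forall>x. h (0, x) = u" "\<forall>x. h (1, x) = v"
    by (auto simp: homotopic_with_def)
  have "pathin X (\<lambda>t. h (t, 0))"
    unfolding pathin_def
    by (rule continuous_map_compose[OF _ h(1), unfolded o_def]) (auto intro!: continuous_intros)
  then show ?thesis using h by auto
qed

text \<open>The value at the end of a path from the base point is the end of the lifted path, and this
  depends only on the end point because the loop formed by two such paths is null-homotopic. Without
  local path-connectedness the lift need not be continuous, but it carries paths to paths.\<close>

theorem simply_connected_lift:
  assumes sc: "simply_connected_space X" and q: "continuous_map X Y q"
    and cov: "covering_map Z Y \<pi>" and u0: "u0 \<in> topspace X" and z0: "z0 \<in> topspace Z" "\<pi> z0 = q u0"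
  shows "\<exists>\<Lambda>. \<Lambda> u0 = z0 \<and> (\<forall>g. pathin X g \<longrightarrow> pathin Z (\<lambda>t. \<Lambda> (g t))) \<and>
    (\<forall>u\<in>topspace X. \<pi> (\<Lambda> u) = q u)"
proof -
  have homot: "homotopic_with (\<lambda>r. r 1 = r 0) unit_interval X g g'"
    if "pathin X g" "g 1 = g 0" "pathin X g'" "g' 1 = g' 0" for g g'
    using sc that unfolding simply_connected_space_def by blast
  have constp: "pathin X (\<lambda>_. u)" if "u \<in> topspace X" for u
    using that by (simp add: pathin_def continuous_map_const)
  note conn = simply_connected_space_path[OF sc u0]
  have qpath: "pathin Y (\<lambda>t. q (g t))" if "pathin X g" for g
    using that continuous_map_compose[OF _ q] by (auto simp: pathin_def o_def)
  have closed: "k 1 = k 0"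
    if g: "pathin X g" "g 1 = g 0" and k: "pathin Z k" "\<And>t. t \<in> {0..1} \<Longrightarrow> \<pi> (k t) = q (g t)" for g k
  proof -
    obtain h where h: "continuous_map (prod_topology unit_interval unit_interval) X h"
      "\<forall>x. h (0, x) = g x" "\<forall>x. h (1, x) = u0" "\<forall>t\<in>{0..1}. h (t, 1) = h (t, 0)"
      using homot[OF g constp[OF u0]] by (auto simp: homotopic_with_def)
    show ?thesis
    proof (rule null_homotopic_lift_closed[OF cov, of "q \<circ> h" "q u0"])
      show "continuous_map (prod_topology unit_interval unit_interval) Y (q \<circ> h)"
        using continuous_map_compose[OF h(1) q] .
    qed (use h k in auto)
  qed
  define lifts where "lifts g k \<longleftrightarrow> pathin X g \<and> g 0 = u0 \<and> pathin Z k \<and> k 0 = z0 \<and>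
      (\<forall>t\<in>{0..1}. \<pi> (k t) = q (g t))" for g k
  have lift_ex: "\<exists>k. lifts g k" if "pathin X g" "g 0 = u0" for g
  proof -
    have "\<pi> z0 = q (g 0)" using z0(2) that(2) by simp
    from covering_path_lift[OF cov qpath[OF that(1)] z0(1) this] show ?thesis
      using that unfolding lifts_def by blast
  qed
  have end_eq: "k 1 = k' 1" if l: "lifts g k" "lifts g' k'" and e: "g 1 = g' 1" for g g' k k'
  proof -
    \<comment> \<open>The loop \<open>g\<close> followed by the reverse of \<open>g'\<close>; its lift is closed.\<close>
    define m where "m t = (if t \<le> 1/2 then g (2 * t) else g' (1 - (2 * t - 1)))" for t :: real
    have rev: "pathin X (\<lambda>t. g' (1 - t))"
      by (rule pathin_reparam[where r = "\<lambda>t. 1 - t"])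
        (use l in \<open>auto simp: lifts_def intro!: continuous_intros\<close>)
    have m: "pathin X m" "m 0 = u0" "m 1 = u0"
      unfolding m_def
      by (rule pathin_join[OF _ rev]) (use l e in \<open>simp_all add: lifts_def\<close>)
    obtain n where n: "lifts m n" using lift_ex[OF m(1,2)] by blast
    have n1: "n 1 = z0" using closed[OF m(1), of n] m n by (auto simp: lifts_def)
    have "pathin Z n" using n by (simp add: lifts_def)
    then have np: "pathin Z (\<lambda>t. n (t / 2))" "pathin Z (\<lambda>t. n (1 - t / 2))"
      by (rule pathin_reparam[where r = "\<lambda>t. t / 2"] pathin_reparam[where r = "\<lambda>t. 1 - t / 2"];
          auto intro!: continuous_intros)+
    have "n (1 / 2) = k 1"
      by (rule path_lift_unique[OF cov np(1), where g = k and s = 0]) (use l n in \<open>auto simp: lifts_def m_def\<close>)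
    moreover have "n (1 - 1 / 2) = k' 1"
    proof (rule path_lift_unique[OF cov np(2), where g = k' and s = 0])
      fix t :: real assume t: "t \<in> {0..1}"
      then have "\<pi> (n (1 - t / 2)) = q (m (1 - t / 2))" using n by (auto simp: lifts_def)
      also have "m (1 - t / 2) = g' t"
        using t e by (cases "t = 1") (auto simp: m_def)
      finally show "\<pi> (n (1 - t / 2)) = \<pi> (k' t)" using l t by (auto simp: lifts_def)
    qed (use l n n1 in \<open>auto simp: lifts_def\<close>)
    ultimately show ?thesis by simp
  qed
  define \<Lambda> where "\<Lambda> u = (SOME z. \<exists>g k. lifts g k \<and> g 1 = u \<and> z = k 1)" for u
  have \<Lambda>: "\<Lambda> (g 1) = k 1" if "lifts g k" for g k
  proof -
    have "\<exists>z. \<exists>g' k'. lifts g' k' \<and> g' 1 = g 1 \<and> z = k' 1" using that by blast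
    from someI_ex[OF this] show ?thesis unfolding \<Lambda>_def using end_eq that by metis
  qed
  have along: "\<Lambda> (g t) = k t" if l: "lifts g k" and t: "t \<in> {0..1}" for g k t
  proof -
    have r: "(\<lambda>s. t * s) ` {0..1} \<subseteq> {0..1}" using t by (auto intro: mult_le_one)
    then have "lifts (\<lambda>s. g (t * s)) (\<lambda>s. k (t * s))"
      using l pathin_reparam[OF _ _ r, of X g] pathin_reparam[OF _ _ r, of Z k] t r
      by (auto simp: lifts_def image_subset_iff intro!: continuous_intros)
    from \<Lambda>[OF this] show ?thesis by simp
  qed
  show ?thesis
  proof (intro exI[of _ \<Lambda>] conjI allI impI ballI)
    obtain k where "lifts (\<lambda>_. u0) k" using lift_ex[OF constp[OF u0]] by auto
    from along[OF this, of 0] show "\<Lambda> u0 = z0" using \<open>lifts _ k\<close> by (simp add: lifts_def)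
  next
    fix g assume g: "pathin X g"
    then have "g 0 \<in> topspace X" using continuous_map_image_subset_topspace by (fastforce simp: pathin_def)
    then obtain e where e: "pathin X e" "e 0 = u0" "e 1 = g 0" using conn by blast
    define m where "m t = (if t \<le> 1/2 then e (2 * t) else g (2 * t - 1))" for t :: real
    have "pathin X m" "m 0 = u0" unfolding m_def using pathin_join[OF e(1) g e(3)] e by auto
    then obtain k where k: "lifts m k" using lift_ex by blast
    have eq: "\<Lambda> (g t) = k ((1 + t) / 2)" if "t \<in> {0..1}" for t
    proof -
      have "m ((1 + t) / 2) = g t" proof (cases "t = 0")
        case False
        have "2 * ((1 + t) / 2) - 1 = t" by (simp add: field_simps)
        with False that show ?thesis by (simp add: m_def)
      qed (simp add: m_def e)
      then show ?thesis using along[OF k, of "(1 + t) / 2"] that by auto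
    qed
    have "pathin Z (\<lambda>t. k ((1 + t) / 2))"
      by (rule pathin_reparam[where r = "\<lambda>t. (1 + t) / 2"])
        (use k in \<open>auto simp: lifts_def intro!: continuous_intros\<close>)
    then show "pathin Z (\<lambda>t. \<Lambda> (g t))"
      unfolding pathin_def by (rule continuous_map_eq) (simp add: eq)
  next
    fix u assume "u \<in> topspace X"
    then obtain g where "pathin X g" "g 0 = u0" "g 1 = u" using conn by blast
    moreover from this obtain k where "lifts g k" using lift_ex by blast
    ultimately show "\<pi> (\<Lambda> u) = q u" using \<Lambda>[of g k] by (auto simp: lifts_def)
  qed
qed

section \<open>Spherical subsets are cliques\<close>

abbreviation ra_group :: "'i set \<Rightarrow> 'i set set \<Rightarrow> 'i list set monoid" where
  "ra_group I edges \<equiv> coxeter_group (ra_matrix edges) I"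

abbreviation ra_class :: "'i set \<Rightarrow> 'i set set \<Rightarrow> 'i list \<Rightarrow> 'i list set" where
  "ra_class I edges \<equiv> cox_class (ra_matrix edges) I"

lemma cox_eq_lists: "cox_eq m S u v \<Longrightarrow> u \<in> lists S \<and> v \<in> lists S"
proof (induction rule: cox_eq.induct)
  case (relator s t u v)
  have "set (concat (replicate (m s t) [s, t])) \<subseteq> {s, t}" by auto
  with relator show ?case by (auto simp: in_lists_conv_set)
qed auto

lemma cox_eq_append:
  assumes "cox_eq m S u v" "a \<in> lists S" "b \<in> lists S"
  shows "cox_eq m S (a @ u @ b) (a @ v @ b)"
  using assms
proof (induction rule: cox_eq.induct)
  case (relator s t u v)
  then show ?case using cox_eq.relator[of s S t "a @ u" "v @ b" m] by simp
next
  case (refl u)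
  then show ?case by (intro cox_eq.refl) auto
qed (auto intro: cox_eq.sym cox_eq.trans)

lemma cox_eq_append2:
  assumes "cox_eq m S u u'" "cox_eq m S v v'"
  shows "cox_eq m S (u @ v) (u' @ v')"
proof -
  have "cox_eq m S ([] @ u @ v) ([] @ u' @ v)" "cox_eq m S (u' @ v @ []) (u' @ v' @ [])"
    using assms cox_eq_lists by (blast intro: cox_eq_append lists.Nil)+
  then show ?thesis using cox_eq.trans by fastforce
qed

lemma cox_class_eq_iff:
  assumes "u \<in> lists S"
  shows "cox_class m S u = cox_class m S v \<longleftrightarrow> cox_eq m S u v"
proof
  assume "cox_class m S u = cox_class m S v"
  moreover have "u \<in> cox_class m S u" using cox_eq.refl[OF assms] by (simp add: cox_class_def)
  ultimately have "cox_eq m S v u" by (simp add: cox_class_def)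
  then show "cox_eq m S u v" by (rule cox_eq.sym)
next
  assume "cox_eq m S u v"
  then show "cox_class m S u = cox_class m S v"
    unfolding cox_class_def using cox_eq.sym cox_eq.trans by blast
qed

lemma coxeter_mult:
  assumes "u \<in> lists S" "v \<in> lists S"
  shows "cox_class m S u \<otimes>\<^bsub>coxeter_group m S\<^esub> cox_class m S v = cox_class m S (u @ v)"
proof -
  have "cox_class m S (u' @ v') = cox_class m S (u @ v)"
    if "u' \<in> cox_class m S u" "v' \<in> cox_class m S v" for u' v'
    using that assms cox_eq_append2 by (subst eq_commute, subst cox_class_eq_iff) (auto simp: cox_class_def)
  moreover have "u \<in> cox_class m S u" "v \<in> cox_class m S v"
    using assms by (simp_all add: cox_class_def cox_eq.refl)
  ultimately have "(\<Union>u'\<in>cox_class m S u. \<Union>v'\<in>cox_class m S v. cox_class m S (u' @ v')) = cox_class m S (u @ v)"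
    by blast
  then show ?thesis by (simp add: coxeter_group_def)
qed

lemma coxeter_one: "\<one>\<^bsub>coxeter_group m S\<^esub> = cox_class m S []"
  and coxeter_carrier: "carrier (coxeter_group m S) = cox_class m S ` lists S"
  by (simp_all add: coxeter_group_def)

lemma ra_square: "i \<in> I \<Longrightarrow> cox_eq (ra_matrix edges) I [i, i] []"
  using cox_eq.relator[of i I i "[]" "[]" "ra_matrix edges"] by (simp add: ra_matrix_def)

lemma ra_rev: "u \<in> lists I \<Longrightarrow> cox_eq (ra_matrix edges) I (rev u @ u) []"
proof (induction u)
  case (Cons i u)
  then have "cox_eq (ra_matrix edges) I (rev u @ [i, i] @ u) (rev u @ [] @ u)"
    by (intro cox_eq_append ra_square) (auto simp: in_lists_conv_set)
  with Cons show ?case using cox_eq.trans by fastforce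
qed (simp add: cox_eq.refl)

lemma ra_group_group: "group (ra_group I edges)"
proof (rule groupI)
  fix x y assume "x \<in> carrier (ra_group I edges)" "y \<in> carrier (ra_group I edges)"
  then obtain u v where "u \<in> lists I" "v \<in> lists I" "x = ra_class I edges u" "y = ra_class I edges v"
    by (auto simp only: coxeter_carrier)
  then show "x \<otimes>\<^bsub>ra_group I edges\<^esub> y \<in> carrier (ra_group I edges)"
    by (simp only: coxeter_carrier coxeter_mult append_in_lists_conv image_eqI[OF HOL.refl])
next
  fix x y z
  assume "x \<in> carrier (ra_group I edges)" "y \<in> carrier (ra_group I edges)" "z \<in> carrier (ra_group I edges)"
  then obtain u v w where "u \<in> lists I" "v \<in> lists I" "w \<in> lists I"
      "x = ra_class I edges u" "y = ra_class I edges v" "z = ra_class I edges w"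
    by (auto simp: coxeter_carrier)
  moreover from this have "u @ v \<in> lists I" "v @ w \<in> lists I" by simp_all
  ultimately show "x \<otimes>\<^bsub>ra_group I edges\<^esub> y \<otimes>\<^bsub>ra_group I edges\<^esub> z
      = x \<otimes>\<^bsub>ra_group I edges\<^esub> (y \<otimes>\<^bsub>ra_group I edges\<^esub> z)"
    by (simp only: coxeter_mult append_assoc)
next
  fix x assume "x \<in> carrier (ra_group I edges)"
  then obtain u where u: "u \<in> lists I" "x = ra_class I edges u" by (auto simp: coxeter_carrier)
  then show "\<one>\<^bsub>ra_group I edges\<^esub> \<otimes>\<^bsub>ra_group I edges\<^esub> x = x"
    by (simp add: coxeter_one coxeter_mult)
  have "rev u \<in> lists I" using u by (auto simp: in_lists_conv_set)
  moreover from this have "ra_class I edges (rev u @ u) = ra_class I edges []"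
    using ra_rev[OF u(1)] u(1) by (subst cox_class_eq_iff) simp_all
  ultimately show "\<exists>y\<in>carrier (ra_group I edges). y \<otimes>\<^bsub>ra_group I edges\<^esub> x = \<one>\<^bsub>ra_group I edges\<^esub>"
    using u by (intro bexI[of _ "ra_class I edges (rev u)"]) (auto simp: coxeter_one coxeter_mult coxeter_carrier)
qed (auto simp: coxeter_one coxeter_carrier)

lemma generate_involution_finite:
  assumes G: "group G" and s: "s \<in> carrier G" "s \<otimes>\<^bsub>G\<^esub> s = \<one>\<^bsub>G\<^esub>"
    and t: "t \<in> carrier G" "t \<otimes>\<^bsub>G\<^esub> t = \<one>\<^bsub>G\<^esub>" and st: "s \<otimes>\<^bsub>G\<^esub> t = t \<otimes>\<^bsub>G\<^esub> s"
  shows "finite (generate G {s, t})"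
proof -
  interpret group G by fact
  have inv: "inv\<^bsub>G\<^esub> s = s" "inv\<^bsub>G\<^esub> t = t" using s t by (auto intro: inv_equality)
  let ?S = "{\<one>\<^bsub>G\<^esub>, s, t, s \<otimes>\<^bsub>G\<^esub> t}"
  have sst: "s \<otimes>\<^bsub>G\<^esub> (s \<otimes>\<^bsub>G\<^esub> x) = x" "t \<otimes>\<^bsub>G\<^esub> (t \<otimes>\<^bsub>G\<^esub> x) = x" "t \<otimes>\<^bsub>G\<^esub> (s \<otimes>\<^bsub>G\<^esub> x) = s \<otimes>\<^bsub>G\<^esub> (t \<otimes>\<^bsub>G\<^esub> x)"
    if "x \<in> carrier G" for x
    using that s t st[symmetric] by (simp_all add: m_assoc[symmetric])
  have "generate G {s, t} \<subseteq> ?S"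
  proof
    fix x assume "x \<in> generate G {s, t}"
    then show "x \<in> ?S"
    proof (induction rule: generate.induct)
      case (eng h1 h2)
      then show ?case using s t st[symmetric] sst by (auto simp: m_assoc)
    qed (auto simp: inv)
  qed
  then show ?thesis using finite_subset by blast
qed

text \<open>Two letters \<open>i\<close>, \<open>j\<close> with \<open>m(i, j) = \<infinity>\<close> generate an infinite dihedral group: it acts on the
  integers by the reflections \<open>x \<mapsto> - x\<close> and \<open>x \<mapsto> 1 - x\<close>, all other letters acting trivially.\<close>

definition dihedral_act :: "'i \<Rightarrow> 'i \<Rightarrow> 'i \<Rightarrow> int \<Rightarrow> int" where
  "dihedral_act i j s x = (if s = i then - x else if s = j then 1 - x else x)"

lemma dihedral_act_cox_eq:
  assumes "cox_eq (ra_matrix edges) I u v" "i \<noteq> j" "{i, j} \<notin> edges"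
  shows "foldr (dihedral_act i j) u x = foldr (dihedral_act i j) v x"
  using assms
proof (induction arbitrary: x rule: cox_eq.induct)
  case (relator s t u v)
  have "foldr (dihedral_act i j) (concat (replicate (ra_matrix edges s t) [s, t])) y = y" for y
  proof (cases "s = t \<or> {s, t} \<in> edges")
    case True
    then have "s = t \<or> ra_matrix edges s t = 2 \<and> \<not> (s = i \<and> t = j) \<and> \<not> (s = j \<and> t = i) \<and> s \<noteq> t"
      using relator.prems by (auto simp: ra_matrix_def insert_commute)
    then show ?thesis
      by (auto simp: ra_matrix_def dihedral_act_def numeral_2_eq_2)
  qed (simp add: ra_matrix_def)
  then show ?case by simp
qed auto

lemma dihedral_act_power:
  assumes "i \<noteq> j"
  shows "foldr (dihedral_act i j) (concat (replicate n [i, j])) x = x - int n"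
  using assms by (induction n) (auto simp: dihedral_act_def)

lemma infinite_dihedral:
  assumes ij: "i \<in> I" "j \<in> I" "i \<noteq> j" "{i, j} \<notin> edges"
  shows "infinite (generate (ra_group I edges) {ra_class I edges [i], ra_class I edges [j]})" (is "infinite ?H")
proof
  assume fin: "finite ?H"
  interpret group "ra_group I edges" by (rule ra_group_group)
  have gens: "{ra_class I edges [i], ra_class I edges [j]} \<subseteq> carrier (ra_group I edges)"
    using ij by (auto simp: coxeter_carrier)
  let ?w = "\<lambda>n. concat (replicate n [i, j])"
  have wI: "?w n \<in> lists I" for n using ij by (auto simp: in_lists_conv_set)
  have "ra_class I edges (?w n) \<in> ?H" for n
  proof (induction n)
    case 0
    then show ?case using generate.one[of "ra_group I edges"] by (simp add: coxeter_one)
  next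
    case (Suc n)
    have "ra_class I edges [i] \<otimes>\<^bsub>ra_group I edges\<^esub> (ra_class I edges [j] \<otimes>\<^bsub>ra_group I edges\<^esub> ra_class I edges (?w n)) \<in> ?H"
      by (intro generate.eng Suc.IH generate.incl) auto
    then show ?case using ij wI[of n] by (simp add: coxeter_mult)
  qed
  then have "finite (range (\<lambda>n. ra_class I edges (?w n)))"
    by (intro finite_subset[OF _ fin] image_subsetI)
  moreover have "inj (\<lambda>n. ra_class I edges (?w n))"
  proof (rule injI)
    fix m n assume "ra_class I edges (?w m) = ra_class I edges (?w n)"
    then have "cox_eq (ra_matrix edges) I (?w m) (?w n)" using wI cox_class_eq_iff by metis
    from dihedral_act_cox_eq[OF this ij(3,4), of 0] show "m = n"
      by (simp add: dihedral_act_power[OF ij(3)])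
  qed
  ultimately show False using finite_imageD by blast
qed

lemma spherical_clique:
  assumes "\<sigma> \<in> spherical_subsets I edges" "i \<in> \<sigma>" "j \<in> \<sigma>" "i \<noteq> j"
  shows "{i, j} \<in> edges"
proof (rule ccontr)
  assume n: "{i, j} \<notin> edges"
  interpret group "ra_group I edges" by (rule ra_group_group)
  have "generate (ra_group I edges) {ra_class I edges [i], ra_class I edges [j]}
      \<subseteq> generate (ra_group I edges) ((\<lambda>i. ra_class I edges [i]) ` \<sigma>)"
    by (rule mono_generate) (use assms in auto)
  then have "finite (generate (ra_group I edges) {ra_class I edges [i], ra_class I edges [j]})"
    using assms(1) finite_subset by (auto simp: spherical_subsets_def)
  then show False using infinite_dihedral[of i I j edges] n assms by (auto simp: spherical_subsets_def)
qed

lemma spherical_empty: "{} \<in> spherical_subsets I edges"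
  using group.generate_empty[OF ra_group_group[where I = I and edges = edges]] by (simp add: spherical_subsets_def)

lemma spherical_pair:
  assumes "i \<in> I" "j \<in> I" "i = j \<or> {i, j} \<in> edges"
  shows "{i, j} \<in> spherical_subsets I edges"
proof -
  interpret group "ra_group I edges" by (rule ra_group_group)
  have "cox_eq (ra_matrix edges) I [i, j] [j, i]"
  proof (cases "i = j")
    case False
    have 1: "cox_eq (ra_matrix edges) I ([] @ [i,j,i,j] @ [j, i]) ([] @ [] @ [j, i])"
      using cox_eq.relator[of i I j "[]" "[j, i]" "ra_matrix edges"] assms False
      by (simp add: ra_matrix_def numeral_2_eq_2)
    have 2: "cox_eq (ra_matrix edges) I ([i,j] @ rev [j, i] @ [j, i]) ([i,j] @ [])"
      using assms by (intro cox_eq_append2 ra_rev cox_eq.refl) auto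
    show ?thesis using cox_eq.trans[OF cox_eq.sym[OF 2[simplified]] 1[simplified]] by simp
  qed (use assms in \<open>auto intro: cox_eq.refl\<close>)
  then have "finite (generate (ra_group I edges) {ra_class I edges [i], ra_class I edges [j]})"
    using assms
    by (intro generate_involution_finite[OF ra_group_group])
      (auto simp: coxeter_carrier coxeter_mult coxeter_one cox_class_eq_iff ra_square)
  then show ?thesis using assms by (simp add: spherical_subsets_def)
qed

section \<open>The product of the two-element groups\<close>

lemma product_dist_generate:
  fixes I :: "'i set"
  assumes I: "finite I" and T: "T \<subseteq> I"
  shows "product_dist I C D \<in> generate (Z2_product I) (Z2_gen I ` T) \<longleftrightarrow> (\<forall>i\<in>I - T. C i = D i)"
proof
  have mult: "(f \<otimes>\<^bsub>Z2_product I\<^esub> g) i = (f i + g i) mod 2" if "i \<in> I" for f g i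
    using that by (simp add: Z2_product_def integer_mod_group_def mult_integer_mod_group)
  assume "product_dist I C D \<in> generate (Z2_product I) (Z2_gen I ` T)"
  then have "\<forall>i\<in>I - T. product_dist I C D i = 0"
  proof (induction rule: generate.induct)
    case one
    then show ?case by (simp add: Z2_product_def)
  next
    case (incl h)
    then show ?case by (auto simp: Z2_gen_def)
  next
    case (inv h)
    have "h \<in> carrier (Z2_product I)"
      using inv by (auto simp: Z2_product_def Z2_gen_def carrier_integer_mod_group)
    then have "inv\<^bsub>Z2_product I\<^esub> h = (\<lambda>i\<in>I. inv\<^bsub>integer_mod_group 2\<^esub> (h i))"
      by (simp add: Z2_product_def inv_product_group)
    moreover have "h i = 0" if "i \<in> I - T" for i using inv that by (auto simp: Z2_gen_def)
    moreover have "inv\<^bsub>integer_mod_group 2\<^esub> 0 = 0"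
      using monoid.inv_one[OF group.is_monoid[OF group_integer_mod_group], of 2] by simp
    ultimately show ?case by simp
  next
    case (eng h1 h2)
    then show ?case by (simp add: mult)
  qed
  then show "\<forall>i\<in>I - T. C i = D i" by (auto simp: product_dist_def rank_one_dist_def split: if_splits)
next
  assume eq: "\<forall>i\<in>I - T. C i = D i"
  define ind :: "'i set \<Rightarrow> 'i \<Rightarrow> int" where "ind A = (\<lambda>i\<in>I. if i \<in> A then 1 else 0)" for A
  have ind: "ind A \<in> generate (Z2_product I) (Z2_gen I ` T)" if "finite A" "A \<subseteq> T" for A
    using that
  proof (induction A rule: finite_induct)
    case empty
    have "ind {} = \<one>\<^bsub>Z2_product I\<^esub>" by (simp add: ind_def Z2_product_def)
    then show ?case using generate.one by metis
  next
    case (insert t A)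
    have "ind (insert t A) = Z2_gen I t \<otimes>\<^bsub>Z2_product I\<^esub> ind A"
      using insert by (auto simp: ind_def Z2_gen_def Z2_product_def mult_integer_mod_group fun_eq_iff restrict_def)
    then show ?case using insert by (auto intro: generate.eng generate.incl)
  qed
  have "product_dist I C D = ind {i \<in> I. C i \<noteq> D i}"
    by (auto simp: product_dist_def ind_def rank_one_dist_def)
  then show "product_dist I C D \<in> generate (Z2_product I) (Z2_gen I ` T)"
    using ind[of "{i \<in> I. C i \<noteq> D i}"] I eq by auto
qed

section \<open>The Davis chamber\<close>

definition mirror_set :: "'i set \<Rightarrow> 'i set set \<Rightarrow> ('i set \<Rightarrow> real) \<Rightarrow> 'i set" where
  "mirror_set I edges k = {i \<in> I. k \<in> davis_mirror I edges i}"

definition davis_vertex :: "'i set \<Rightarrow> 'i set \<Rightarrow> real" where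
  "davis_vertex \<sigma> = (\<lambda>\<tau>. if \<tau> = \<sigma> then 1 else 0)"

definition davis_segment :: "('i set \<Rightarrow> real) \<Rightarrow> ('i set \<Rightarrow> real) \<Rightarrow> real \<Rightarrow> 'i set \<Rightarrow> real" where
  "davis_segment k l t = (\<lambda>\<sigma>. (1 - t) * k \<sigma> + t * l \<sigma>)"

lemma davis_segment_ends [simp]: "davis_segment k l 0 = k" "davis_segment k l 1 = l"
  by (simp_all add: davis_segment_def)

lemma davis_vertex_support: "{\<tau>. davis_vertex \<sigma> \<tau> \<noteq> 0} = {\<sigma>}"
  by (auto simp: davis_vertex_def)

lemma davis_vertex_in:
  assumes "\<sigma> \<in> P"
  shows "davis_vertex \<sigma> \<in> poset_realization P"
proof -
  have "\<forall>\<tau>. 0 \<le> davis_vertex \<sigma> \<tau>" "(\<Sum>\<tau>\<in>{\<sigma>}. davis_vertex \<sigma> \<tau>) = 1"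
    by (simp_all add: davis_vertex_def)
  moreover have "subset.chain P {\<sigma>}" unfolding subset.chain_def using assms by blast
  ultimately show ?thesis
    unfolding poset_realization_def mem_Collect_eq davis_vertex_support by blast
qed

lemma poset_realization_subset_iff:
  assumes "P \<subseteq> Q"
  shows "x \<in> poset_realization P \<longleftrightarrow> x \<in> poset_realization Q \<and> {\<sigma>. x \<sigma> \<noteq> 0} \<subseteq> P"
proof -
  have "subset.chain P S \<longleftrightarrow> subset.chain Q S \<and> S \<subseteq> P" for S
    using assms unfolding subset.chain_def by blast
  from this[of "{\<sigma>. x \<sigma> \<noteq> 0}"] show ?thesis
    unfolding poset_realization_def mem_Collect_eq by argo
qed

lemma poset_realization_support:
  assumes "x \<in> poset_realization P"
  shows "{\<sigma>. x \<sigma> \<noteq> 0} \<subseteq> P" "{\<sigma>. x \<sigma> \<noteq> 0} \<noteq> {}"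
proof -
  show "{\<sigma>. x \<sigma> \<noteq> 0} \<subseteq> P" using assms by (simp add: poset_realization_def subset.chain_def)
  have "(\<Sum>\<sigma> | x \<sigma> \<noteq> 0. x \<sigma>) = 1" using assms by (simp add: poset_realization_def)
  then show "{\<sigma>. x \<sigma> \<noteq> 0} \<noteq> {}" by (metis sum.empty zero_neq_one)
qed

text \<open>Adding the least element to a chain gives a chain, so the realization is a cone with that
  vertex as its apex.\<close>

lemma poset_realization_cone:
  assumes k: "k \<in> poset_realization P" and \<sigma>: "\<sigma> \<in> P" "\<And>\<tau>. \<tau> \<in> P \<Longrightarrow> \<sigma> \<subseteq> \<tau>" and t: "t \<in> {0..1}"
  shows "davis_segment (davis_vertex \<sigma>) k t \<in> poset_realization P"
proof -
  let ?x = "davis_segment (davis_vertex \<sigma>) k t"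
  let ?S = "insert \<sigma> {\<tau>. k \<tau> \<noteq> 0}"
  have k': "\<And>\<tau>. 0 \<le> k \<tau>" "finite {\<tau>. k \<tau> \<noteq> 0}" "subset.chain P {\<tau>. k \<tau> \<noteq> 0}" "(\<Sum>\<tau> | k \<tau> \<noteq> 0. k \<tau>) = 1"
    using k by (auto simp: poset_realization_def)
  have supp: "{\<tau>. ?x \<tau> \<noteq> 0} \<subseteq> ?S" by (auto simp: davis_segment_def davis_vertex_def)
  have "subset.chain P ?S" using k'(3) \<sigma> unfolding subset.chain_def by blast
  moreover have "subset.chain P A" if "subset.chain P B" "A \<subseteq> B" for A B
    using that unfolding subset.chain_def by blast
  ultimately have "subset.chain P {\<tau>. ?x \<tau> \<noteq> 0}" using supp by metis
  moreover have "(\<Sum>\<tau> | ?x \<tau> \<noteq> 0. ?x \<tau>) = 1"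
  proof -
    have "(\<Sum>\<tau> | ?x \<tau> \<noteq> 0. ?x \<tau>) = (\<Sum>\<tau>\<in>?S. ?x \<tau>)"
      using k'(2) supp by (intro sum.mono_neutral_left) auto
    also have "\<dots> = (1 - t) * (\<Sum>\<tau>\<in>?S. davis_vertex \<sigma> \<tau>) + t * (\<Sum>\<tau>\<in>?S. k \<tau>)"
      by (simp only: davis_segment_def sum.distrib sum_distrib_left)
    also have "(\<Sum>\<tau>\<in>?S. davis_vertex \<sigma> \<tau>) = 1"
      using k'(2) by (simp add: davis_vertex_def)
    also have "(\<Sum>\<tau>\<in>?S. k \<tau>) = (\<Sum>\<tau> | k \<tau> \<noteq> 0. k \<tau>)"
      using k'(2) by (intro sum.mono_neutral_right) auto
    finally show ?thesis using k'(4) by simp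
  qed
  moreover have "0 \<le> ?x \<tau>" for \<tau> using k'(1)[of \<tau>] t by (simp add: davis_segment_def davis_vertex_def)
  moreover have "finite {\<tau>. ?x \<tau> \<noteq> 0}" using supp k'(2) finite_subset by blast
  ultimately show ?thesis by (simp add: poset_realization_def)
qed

lemma davis_mirror_subset: "davis_mirror I edges i \<subseteq> davis_chamber I edges"
  unfolding davis_mirror_def davis_chamber_def
  using poset_realization_subset_iff[of "{T \<in> spherical_subsets I edges. i \<in> T}" "spherical_subsets I edges"]
  by blast

lemma davis_mirror_iff:
  "k \<in> davis_mirror I edges i \<longleftrightarrow> k \<in> davis_chamber I edges \<and> (\<forall>\<sigma>. k \<sigma> \<noteq> 0 \<longrightarrow> i \<in> \<sigma>)"
proof -
  have "k \<in> davis_mirror I edges i \<longleftrightarrow>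
      k \<in> davis_chamber I edges \<and> {\<sigma>. k \<sigma> \<noteq> 0} \<subseteq> {T \<in> spherical_subsets I edges. i \<in> T}"
    unfolding davis_mirror_def davis_chamber_def by (rule poset_realization_subset_iff) blast
  then show ?thesis using poset_realization_support(1)[of k "spherical_subsets I edges"]
    unfolding davis_chamber_def by blast
qed

lemma mirror_set_clique:
  assumes "k \<in> davis_chamber I edges" "i \<in> mirror_set I edges k" "j \<in> mirror_set I edges k" "i \<noteq> j"
  shows "{i, j} \<in> edges"
proof -
  obtain \<sigma> where "k \<sigma> \<noteq> 0" "\<sigma> \<in> spherical_subsets I edges"
    using poset_realization_support[OF assms(1)[unfolded davis_chamber_def]] by blast
  moreover have "i \<in> \<sigma>" "j \<in> \<sigma>"
    using assms(2,3) \<open>k \<sigma> \<noteq> 0\<close> by (auto simp: mirror_set_def davis_mirror_iff)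
  ultimately show ?thesis using spherical_clique assms(4) by metis
qed

lemma mirror_set_vertex:
  assumes "\<sigma> \<in> spherical_subsets I edges"
  shows "mirror_set I edges (davis_vertex \<sigma>) = \<sigma>"
proof -
  have "\<sigma> \<subseteq> I" "davis_vertex \<sigma> \<in> davis_chamber I edges"
    using assms by (auto simp: spherical_subsets_def davis_chamber_def davis_vertex_in)
  then show ?thesis by (auto simp: mirror_set_def davis_mirror_iff davis_vertex_def)
qed

lemma davis_vertex_chamber: "\<sigma> \<in> spherical_subsets I edges \<Longrightarrow> davis_vertex \<sigma> \<in> davis_chamber I edges"
  by (simp add: davis_chamber_def davis_vertex_in)

lemma davis_chamber_cone:
  "k \<in> davis_chamber I edges \<Longrightarrow> t \<in> {0..1} \<Longrightarrow> davis_segment (davis_vertex {}) k t \<in> davis_chamber I edges"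
  unfolding davis_chamber_def using poset_realization_cone spherical_empty by blast

lemma davis_mirror_cone:
  assumes "i \<in> I" "k \<in> davis_mirror I edges i" "t \<in> {0..1}"
  shows "davis_segment (davis_vertex {i}) k t \<in> davis_mirror I edges i"
  using assms spherical_pair[of i I i edges] unfolding davis_mirror_def
  by (intro poset_realization_cone) auto

lemma continuous_on_davis_segment:
  "continuous_on A (\<lambda>w. davis_segment (f w) (g w) (h w))"
  if "continuous_on A f" "continuous_on A g" "continuous_on A h"
proof (rule continuous_on_coordinatewise_then_product)
  fix \<sigma>
  have "continuous_on A (\<lambda>w. f w \<sigma>)" "continuous_on A (\<lambda>w. g w \<sigma>)"
    using that by (auto intro: continuous_on_product_then_coordinatewise)
  then show "continuous_on A (\<lambda>w. davis_segment (f w) (g w) (h w) \<sigma>)"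
    unfolding davis_segment_def by (intro continuous_intros that)
qed

lemma closedin_davis_mirror: "closedin (top_of_set (davis_chamber I edges)) (davis_mirror I edges i)"
proof -
  have "davis_mirror I edges i = davis_chamber I edges \<inter> (\<Inter>\<sigma>\<in>{\<sigma>. i \<notin> \<sigma>}. {k. k \<sigma> = 0})"
    by (auto simp: davis_mirror_iff)
  moreover have "closed {k. k \<sigma> = (0::real)}" for \<sigma> :: "'a set"
    by (intro closed_Collect_eq continuous_on_product_coordinates continuous_on_const)
  ultimately show ?thesis by (metis (no_types, lifting) closed_INT closedin_closed_Int)
qed

lemma openin_mirror_set_subset:
  assumes "finite I"
  shows "openin (top_of_set (davis_chamber I edges)) {k \<in> davis_chamber I edges. mirror_set I edges k \<subseteq> T}"
proof -
  have "{k \<in> davis_chamber I edges. mirror_set I edges k \<subseteq> T}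
      = davis_chamber I edges - (\<Union>i\<in>I - T. davis_mirror I edges i)"
    by (auto simp: mirror_set_def)
  moreover have "closedin (top_of_set (davis_chamber I edges)) (\<Union>i\<in>I - T. davis_mirror I edges i)"
    using assms closedin_davis_mirror by (intro closedin_Union) auto
  ultimately show ?thesis by (metis openin_diff openin_topspace topspace_euclidean_subtopology)
qed

section \<open>Chamber systems over the product building\<close>

locale chamber_data =
  fixes I :: "'i set" and edges :: "'i set set" and \<Delta> :: "'i \<Rightarrow> 'c set"
  assumes finite_I: "finite I"
    and edges_card: "e \<in> edges \<Longrightarrow> e \<subseteq> I \<and> card e = 2"
    and finite_\<Delta>: "i \<in> I \<Longrightarrow> finite (\<Delta> i)"
    and \<Delta>_nonempty: "i \<in> I \<Longrightarrow> \<Delta> i \<noteq> {}"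
begin

abbreviation prod_chambers :: "('i \<Rightarrow> 'c) set" where
  "prod_chambers \<equiv> (\<Pi>\<^sub>E i\<in>I. \<Delta> i)"

abbreviation davis :: "('i set \<Rightarrow> real) set" where
  "davis \<equiv> davis_chamber I edges"

abbreviation mirrors :: "('i set \<Rightarrow> real) \<Rightarrow> 'i set" where
  "mirrors \<equiv> mirror_set I edges"

definition clique :: "'i set \<Rightarrow> bool" where
  "clique T \<longleftrightarrow> T \<subseteq> I \<and> (\<forall>i\<in>T. \<forall>j\<in>T. i \<noteq> j \<longrightarrow> {i, j} \<in> edges)"

lemma clique_mirrors: "k \<in> davis \<Longrightarrow> clique (mirrors k)"
  using mirror_set_clique by (fastforce simp: clique_def mirror_set_def)

end

lemma openin_prod_discrete:
  "openin (prod_topology (discrete_topology A) X) S \<longleftrightarrow>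
    S \<subseteq> A \<times> topspace X \<and> (\<forall>x\<in>A. openin X {k \<in> topspace X. (x, k) \<in> S})"
proof safe
  assume S: "openin (prod_topology (discrete_topology A) X) S"
  fix x assume "x \<in> A"
  then have "continuous_map X (prod_topology (discrete_topology A) X) (\<lambda>k. (x, k))"
    by (auto intro!: continuous_intros)
  from openin_continuous_map_preimage[OF this S] show "openin X {k \<in> topspace X. (x, k) \<in> S}" .
next
  assume S: "S \<subseteq> A \<times> topspace X" "\<forall>x\<in>A. openin X {k \<in> topspace X. (x, k) \<in> S}"
  have "S = (\<Union>x\<in>A. {x} \<times> {k \<in> topspace X. (x, k) \<in> S})" using S(1) by auto
  moreover have "openin (prod_topology (discrete_topology A) X) ({x} \<times> {k \<in> topspace X. (x, k) \<in> S})"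
    if "x \<in> A" for x
    using that S(2) by (simp add: openin_prod_Times_iff)
  ultimately show "openin (prod_topology (discrete_topology A) X) S"
    by (metis (no_types, lifting) openin_clauses(3) imageE)
qed (use openin_subset in fastforce)+

primrec walk :: "('i \<Rightarrow> 'c \<Rightarrow> 'x \<Rightarrow> 'x) \<Rightarrow> ('i \<Rightarrow> 'c) \<Rightarrow> 'i list \<Rightarrow> 'x \<Rightarrow> 'x" where
  "walk op D [] x = x"
| "walk op D (i # is) x = walk op D is (op i (D i) x)"

definition enum :: "'i set \<Rightarrow> 'i list" where
  "enum T = (SOME l. set l = T)"

lemma set_enum: "finite T \<Longrightarrow> set (enum T) = T"
  unfolding enum_def by (rule someI_ex) (rule finite_list)

text \<open>
  A combinatorial covering of the product building: \<open>p\<close> projects to the chambers of the product, and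
  \<open>op i c x\<close> is the chamber of the \<open>i\<close>-panel of \<open>x\<close> whose \<open>i\<close>-th coordinate is \<open>c\<close>. So every panel
  is mapped bijectively to a panel of the product, and for commuting generators the same is true
  of the residues of rank two.
\<close>

locale chamber_system = chamber_data I edges \<Delta>
  for I :: "'i set" and edges :: "'i set set" and \<Delta> :: "'i \<Rightarrow> 'c set" +
  fixes F :: "'x set" and p :: "'x \<Rightarrow> 'i \<Rightarrow> 'c" and op :: "'i \<Rightarrow> 'c \<Rightarrow> 'x \<Rightarrow> 'x"
  assumes F_nonempty: "F \<noteq> {}"
    and p_in: "x \<in> F \<Longrightarrow> p x \<in> prod_chambers"
    and op_in: "\<lbrakk>x \<in> F; i \<in> I; c \<in> \<Delta> i\<rbrakk> \<Longrightarrow> op i c x \<in> F"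
    and p_op: "\<lbrakk>x \<in> F; i \<in> I; c \<in> \<Delta> i\<rbrakk> \<Longrightarrow> p (op i c x) = (p x)(i := c)"
    and op_self: "\<lbrakk>x \<in> F; i \<in> I\<rbrakk> \<Longrightarrow> op i (p x i) x = x"
    and op_op: "\<lbrakk>x \<in> F; i \<in> I; c \<in> \<Delta> i; d \<in> \<Delta> i\<rbrakk> \<Longrightarrow> op i d (op i c x) = op i d x"
    and op_commute: "\<lbrakk>x \<in> F; {i, j} \<in> edges; c \<in> \<Delta> i; d \<in> \<Delta> j\<rbrakk>
      \<Longrightarrow> op i c (op j d x) = op j d (op i c x)"
begin

lemma p_coord: "x \<in> F \<Longrightarrow> i \<in> I \<Longrightarrow> p x i \<in> \<Delta> i"
  using p_in by fastforce

lemma walk_in: "x \<in> F \<Longrightarrow> set L \<subseteq> I \<Longrightarrow> D \<in> prod_chambers \<Longrightarrow> walk op D L x \<in> F"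
  by (induction L arbitrary: x) (auto intro: op_in)

lemma p_walk:
  "x \<in> F \<Longrightarrow> set L \<subseteq> I \<Longrightarrow> D \<in> prod_chambers \<Longrightarrow>
    p (walk op D L x) = (\<lambda>i. if i \<in> set L then D i else p x i)"
proof (induction L arbitrary: x)
  case (Cons j L)
  then have j: "j \<in> I" "D j \<in> \<Delta> j" by auto
  show ?case using Cons.IH[of "op j (D j) x"] Cons.prems op_in[OF Cons.prems(1) j] p_op[OF Cons.prems(1) j]
    by auto
qed auto

lemma walk_self: "x \<in> F \<Longrightarrow> set L \<subseteq> I \<Longrightarrow> walk op (p x) L x = x"
  by (induction L) (auto simp: op_self)

lemma walk_absorb_op:
  "\<lbrakk>x \<in> F; clique (set L); D \<in> prod_chambers; i \<in> set L; c \<in> \<Delta> i\<rbrakk>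
    \<Longrightarrow> walk op D L (op i c x) = walk op D L x"
proof (induction L arbitrary: x)
  case (Cons j L)
  then have j: "j \<in> I" "D j \<in> \<Delta> j" and i: "i \<in> I" by (auto simp: clique_def)
  show ?case
  proof (cases "i = j")
    case True
    then show ?thesis using Cons.prems j by (simp add: op_op)
  next
    case False
    then have e: "{j, i} \<in> edges" using Cons.prems by (auto simp: clique_def insert_commute)
    have "clique (set L)" using Cons.prems by (auto simp: clique_def)
    then show ?thesis
      using Cons.IH[of "op j (D j) x"] Cons.prems False op_in[OF Cons.prems(1) j]
        op_commute[OF Cons.prems(1) e j(2) Cons.prems(5)] by simp
  qed
qed auto

text \<open>Operations of pairwise commuting generators are overwritten by later ones for the same
  generators. This makes membership in a residue independent of the order of the adjustments.\<close>

lemma walk_absorb: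
  "\<lbrakk>x \<in> F; clique (set L); D \<in> prod_chambers; D' \<in> prod_chambers; set L' \<subseteq> set L\<rbrakk>
    \<Longrightarrow> walk op D L (walk op D' L' x) = walk op D L x"
proof (induction L' arbitrary: x)
  case (Cons j L')
  then have j: "j \<in> I" "D' j \<in> \<Delta> j" "j \<in> set L" by (auto simp: clique_def)
  show ?case using Cons op_in[OF Cons.prems(1) j(1,2)] walk_absorb_op[OF Cons.prems(1-3) j(3,2)] by simp
qed auto

text \<open>
  Two chambers in the same \<open>T\<close>-residue, where \<open>T\<close> is a clique: the residue is swept out by
  adjusting the coordinates in \<open>T\<close> one after the other, in any fixed order.
\<close>

definition near :: "'i set \<Rightarrow> 'x \<Rightarrow> 'x \<Rightarrow> bool" where
  "near T x y \<longleftrightarrow> x \<in> F \<and> y \<in> F \<and> y = walk op (p y) (enum T) x"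

lemma clique_enum: "clique T \<Longrightarrow> set (enum T) = T \<and> clique (set (enum T)) \<and> T \<subseteq> I"
  using set_enum[OF finite_subset[OF _ finite_I], of T] by (simp add: clique_def)

lemma near_F: "near T x y \<Longrightarrow> x \<in> F \<and> y \<in> F"
  by (simp add: near_def)

lemma near_refl: "clique T \<Longrightarrow> x \<in> F \<Longrightarrow> near T x x"
  using clique_enum by (simp add: near_def walk_self)

lemma near_mono:
  assumes "near S x y" "S \<subseteq> T" "clique T"
  shows "near T x y"
proof -
  have S: "clique S" using assms by (auto simp: clique_def)
  have F: "x \<in> F" "y \<in> F" and y: "y = walk op (p y) (enum S) x" using assms by (auto simp: near_def)
  have "walk op (p y) (enum T) x = walk op (p y) (enum T) (walk op (p y) (enum S) x)"
    using F assms clique_enum[OF S] clique_enum[OF assms(3)] by (simp add: walk_absorb p_in)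
  also have "\<dots> = y" using y F clique_enum[OF assms(3)] by (simp add: walk_self)
  finally show ?thesis using F by (simp add: near_def)
qed

lemma near_trans':
  assumes "near T x y" "clique T" "z \<in> F"
  shows "near T x z \<longleftrightarrow> near T y z"
proof -
  have F: "x \<in> F" "y \<in> F" and y: "y = walk op (p y) (enum T) x" using assms by (auto simp: near_def)
  have "walk op (p z) (enum T) y = walk op (p z) (enum T) (walk op (p y) (enum T) x)" using y by simp
  also have "\<dots> = walk op (p z) (enum T) x"
    using F assms clique_enum[OF assms(2)] by (simp add: walk_absorb p_in)
  finally show ?thesis using F by (simp add: near_def)
qed

lemma near_sym: "near T x y \<Longrightarrow> clique T \<Longrightarrow> near T y x"
  using near_trans'[of T x y x] near_refl near_F by blast

lemma near_trans: "near T x y \<Longrightarrow> near T y z \<Longrightarrow> clique T \<Longrightarrow> near T x z"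
  using near_trans'[of T x y z] near_F by blast

lemma near_unique: "near T x y \<Longrightarrow> near T x y' \<Longrightarrow> p y = p y' \<Longrightarrow> y = y'"
  by (simp add: near_def)

lemma near_p:
  assumes "near T x y" "clique T" "i \<notin> T"
  shows "p x i = p y i"
proof -
  have "p (walk op (p y) (enum T) x) i = p x i"
    using assms clique_enum[OF assms(2)] by (subst p_walk) (auto simp: near_def p_in)
  then show ?thesis using assms by (simp add: near_def)
qed

lemma near_ex:
  assumes "x \<in> F" "clique T" "D \<in> prod_chambers" "\<And>i. i \<in> I - T \<Longrightarrow> p x i = D i"
  shows "\<exists>y. near T x y \<and> p y = D"
proof -
  let ?y = "walk op D (enum T) x"
  have y: "?y \<in> F" using assms clique_enum[OF assms(2)] by (intro walk_in) auto
  have "p ?y i = D i" for i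
    using assms clique_enum[OF assms(2)] PiE_arb[OF assms(3)] PiE_arb[OF p_in[OF assms(1)]]
    by (subst p_walk) (auto, metis DiffI)
  then have "p ?y = D" by blast
  then show ?thesis using y assms(1) by (auto simp: near_def)
qed

lemma near_op:
  assumes "x \<in> F" "clique T" "i \<in> T" "c \<in> \<Delta> i"
  shows "near T x (op i c x)"
proof -
  have i: "i \<in> I" using assms by (auto simp: clique_def)
  let ?y = "op i c x"
  have y: "?y \<in> F" using assms i op_in by blast
  have "walk op (p ?y) (enum T) x = walk op (p ?y) (enum T) ?y"
    using walk_absorb_op[of x "enum T" "p ?y" i c] assms clique_enum[OF assms(2)] p_in[OF y] by simp
  also have "\<dots> = ?y" using walk_self[OF y] clique_enum[OF assms(2)] by simp
  finally show ?thesis using y assms(1) by (simp add: near_def)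
qed

lemma near_induct:
  assumes "near T x y" "clique T" "Q x"
    and "\<And>z i c. z \<in> F \<Longrightarrow> i \<in> T \<Longrightarrow> c \<in> \<Delta> i \<Longrightarrow> Q z \<Longrightarrow> Q (op i c z)"
  shows "Q y"
proof -
  have "Q (walk op D L z)" if "z \<in> F" "set L \<subseteq> T" "D \<in> prod_chambers" "Q z" for D L z
    using that
  proof (induction L arbitrary: z)
    case (Cons j L)
    then have j: "j \<in> I" "D j \<in> \<Delta> j" "j \<in> T" using assms(2) by (auto simp: clique_def)
    show ?case using Cons op_in[OF Cons.prems(1) j(1,2)] assms(4)[OF Cons.prems(1) j(3,2)] by simp
  qed simp
  from this[of x "enum T" "p y"] show ?thesis
    using assms(1,3) clique_enum[OF assms(2)] p_in by (simp add: near_def)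
qed

lemma clique_empty: "clique {}" by (simp add: clique_def)

lemma near_empty: "near {} x y \<longleftrightarrow> x \<in> F \<and> x = y"
  using clique_enum[OF clique_empty] by (auto simp: near_def)

text \<open>
  The space glued from copies of the Davis chamber, one for each \<open>x \<in> F\<close>, in the same way as
  \<^const>\<open>U_space\<close>, which is the case of the product building itself. A point \<open>k\<close> lies in the mirrors of
  a clique, so the points identified with it form a residue.
\<close>

definition glue :: "('x \<times> ('i set \<Rightarrow> real)) rel" where
  "glue = {((x, k), (y, l)). k \<in> davis \<and> k = l \<and> near (mirrors k) x y}"

definition pt :: "'x \<Rightarrow> ('i set \<Rightarrow> real) \<Rightarrow> ('x \<times> ('i set \<Rightarrow> real)) set" where
  "pt x k = glue `` {(x, k)}"

definition realization :: "('x \<times> ('i set \<Rightarrow> real)) set topology" where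
  "realization = quotient_topology (prod_topology (discrete_topology F) (top_of_set davis)) glue"

lemma pt_altdef: "k \<in> davis \<Longrightarrow> pt x k = {(y, k) | y. near (mirrors k) x y}"
  by (auto simp: pt_def glue_def)

lemma pt_eq_iff:
  assumes "x \<in> F" "y \<in> F" "k \<in> davis" "l \<in> davis"
  shows "pt x k = pt y l \<longleftrightarrow> k = l \<and> near (mirrors k) x y"
proof
  assume eq: "pt x k = pt y l"
  have "(y, l) \<in> pt y l" using assms near_refl clique_mirrors by (simp add: pt_altdef)
  then show "k = l \<and> near (mirrors k) x y" using eq assms by (auto simp: pt_altdef)
next
  assume kl: "k = l \<and> near (mirrors k) x y"
  then have "near (mirrors k) x z \<longleftrightarrow> near (mirrors k) y z" for z
    using near_trans'[of "mirrors k" x y z] clique_mirrors[OF assms(3)] near_F by blast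
  then show "pt x k = pt y l" using kl assms by (simp add: pt_altdef)
qed

lemma openin_realization:
  "openin realization V \<longleftrightarrow> V \<subseteq> {pt x k | x k. x \<in> F \<and> k \<in> davis} \<and>
     (\<forall>x\<in>F. openin (top_of_set davis) {k \<in> davis. pt x k \<in> V})"
proof -
  have cls: "(F \<times> davis) // glue = {pt x k | x k. x \<in> F \<and> k \<in> davis}"
    by (auto simp: quotient_def pt_def)
  have *: "{k \<in> davis. (x, k) \<in> {w \<in> F \<times> davis. glue `` {w} \<in> V}} = {k \<in> davis. pt x k \<in> V}"
    if "x \<in> F" for x
    using that by (auto simp: pt_def)
  show ?thesis
    unfolding realization_def openin_quotient_topology openin_prod_discrete
    using * by (simp add: cls Collect_conj_eq cong: ball_cong)
qed

lemma topspace_realization: "topspace realization = {pt x k | x k. x \<in> F \<and> k \<in> davis}"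
proof -
  have "openin realization {pt x k | x k. x \<in> F \<and> k \<in> davis}"
  proof -
    have "{k \<in> davis. pt x k \<in> {pt x k | x k. x \<in> F \<and> k \<in> davis}} = davis" if "x \<in> F" for x
      using that by auto
    then show ?thesis
      unfolding openin_realization by (metis (no_types, lifting) openin_subtopology_self subset_refl)
  qed
  moreover have "topspace realization \<subseteq> {pt x k | x k. x \<in> F \<and> k \<in> davis}"
    using openin_realization[of "topspace realization"] by simp
  ultimately show ?thesis by (intro antisym openin_subset)
qed

lemma pt_in: "x \<in> F \<Longrightarrow> k \<in> davis \<Longrightarrow> pt x k \<in> topspace realization"
  by (auto simp: topspace_realization)

lemma continuous_map_pt:
  assumes "x \<in> F"
  shows "continuous_map (top_of_set davis) realization (pt x)"
  unfolding continuous_map_def using assms pt_in openin_realization by auto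

lemma continuous_map_from_realization:
  assumes cont: "\<And>x. x \<in> F \<Longrightarrow> continuous_map (top_of_set davis) X (\<lambda>k. g (pt x k))"
  shows "continuous_map realization X g"
  unfolding continuous_map_def
proof (intro conjI allI impI)
  show "g \<in> topspace realization \<rightarrow> topspace X"
    using continuous_map_image_subset_topspace[OF cont] by (fastforce simp: topspace_realization)
  fix W assume W: "openin X W"
  show "openin realization {c \<in> topspace realization. g c \<in> W}"
    unfolding openin_realization
  proof (intro conjI ballI)
    fix x assume x: "x \<in> F"
    have "{k \<in> davis. pt x k \<in> {c \<in> topspace realization. g c \<in> W}} = {k \<in> topspace (top_of_set davis). g (pt x k) \<in> W}"
      using x pt_in by auto
    then show "openin (top_of_set davis) {k \<in> davis. pt x k \<in> {c \<in> topspace realization. g c \<in> W}}"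
      using openin_continuous_map_preimage[OF cont[OF x] W] by simp
  qed (auto simp: topspace_realization)
qed

lemma realization_cases:
  assumes "c \<in> topspace realization"
  obtains x k where "x \<in> F" "k \<in> davis" "c = pt x k"
  using assms by (auto simp: topspace_realization)

text \<open>The star of the point \<open>k\<close> in the residue of \<open>x\<close>. Stars are evenly covered.\<close>

definition star :: "('i set \<Rightarrow> real) \<Rightarrow> 'x \<Rightarrow> ('x \<times> ('i set \<Rightarrow> real)) set set" where
  "star k x = {pt y l | y l. near (mirrors k) x y \<and> l \<in> davis \<and> mirrors l \<subseteq> mirrors k}"

lemma pt_in_star:
  assumes "k \<in> davis" "x \<in> F" "y \<in> F" "l \<in> davis"
  shows "pt y l \<in> star k x \<longleftrightarrow> mirrors l \<subseteq> mirrors k \<and> near (mirrors k) x y"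
proof
  note cl = clique_mirrors[OF assms(1)]
  assume "pt y l \<in> star k x"
  then obtain y' l' where y': "pt y l = pt y' l'" "near (mirrors k) x y'" "l' \<in> davis" "mirrors l' \<subseteq> mirrors k"
    by (auto simp: star_def)
  then have "l = l'" "near (mirrors l) y y'"
    using pt_eq_iff[of y y' l l'] near_F[OF y'(2)] assms by auto
  then have "near (mirrors k) y y'" using y'(4) near_mono cl by blast
  then show "mirrors l \<subseteq> mirrors k \<and> near (mirrors k) x y"
    using near_trans[OF y'(2) near_sym cl] cl y'(4) \<open>l = l'\<close> by blast
qed (use assms in \<open>auto simp: star_def\<close>)

lemma star_subset: "star k x \<subseteq> topspace realization"
  using near_F by (fastforce simp: star_def topspace_realization)

lemma openin_star:
  assumes "k \<in> davis" "x \<in> F"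
  shows "openin realization (star k x)"
  unfolding openin_realization
proof (intro conjI ballI)
  show "star k x \<subseteq> {pt x k | x k. x \<in> F \<and> k \<in> davis}"
    using star_subset topspace_realization by simp
  fix y assume y: "y \<in> F"
  have "{l \<in> davis. pt y l \<in> star k x} =
      (if near (mirrors k) x y then {l \<in> davis. mirrors l \<subseteq> mirrors k} else {})"
    using pt_in_star[OF assms y] by auto
  then show "openin (top_of_set davis) {l \<in> davis. pt y l \<in> star k x}"
    using openin_mirror_set_subset[OF finite_I] by simp
qed

end

section \<open>The covering of the product building by a chamber system\<close>

sublocale chamber_data \<subseteq> E: chamber_system I edges \<Delta> prod_chambers "\<lambda>C. C" "\<lambda>i c C. C(i := c)"
proof
  show "prod_chambers \<noteq> {}" using \<Delta>_nonempty by (simp add: PiE_eq_empty_iff)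
  fix C :: "'i \<Rightarrow> 'c" and i j :: 'i and c d
  assume C: "C \<in> prod_chambers"
  show "C \<in> prod_chambers" by fact
  show "C(i := c) \<in> prod_chambers" if "i \<in> I" "c \<in> \<Delta> i"
    using C that by (auto simp: PiE_iff extensional_def)
  assume e: "{i, j} \<in> edges"
  then have "i \<noteq> j" using edges_card[OF e] by auto
  then show "C(j := d, i := c) = C(i := c, j := d)" by (simp add: fun_upd_twist)
qed auto

context chamber_data
begin

lemma E_near_iff:
  assumes T: "clique T"
  shows "E.near T C D \<longleftrightarrow> C \<in> prod_chambers \<and> D \<in> prod_chambers \<and> (\<forall>i\<in>I - T. C i = D i)"
proof
  assume "E.near T C D"
  then show "C \<in> prod_chambers \<and> D \<in> prod_chambers \<and> (\<forall>i\<in>I - T. C i = D i)"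
    using E.near_F E.near_p[OF _ T] by blast
next
  assume "C \<in> prod_chambers \<and> D \<in> prod_chambers \<and> (\<forall>i\<in>I - T. C i = D i)"
  then show "E.near T C D" using E.near_ex[OF _ T, of C D] by blast
qed

text \<open>The subgroup generated by the mirrors of a point describes the residue in which the point is
  glued.\<close>

lemma U_rel_eq: "U_rel I edges prod_chambers = E.glue"
proof -
  have "product_dist I C D \<in> generate (Z2_product I) (Z2_gen I ` {i \<in> I. x \<in> davis_mirror I edges i})
      \<longleftrightarrow> (\<forall>i\<in>I - mirrors x. C i = D i)" for C D :: "'i \<Rightarrow> 'c" and x
    using product_dist_generate[OF finite_I, of "mirrors x" C D] by (simp add: mirror_set_def subset_eq)
  then show ?thesis
    unfolding U_rel_def E.glue_def using E_near_iff[OF clique_mirrors] by auto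
qed

lemma U_space_eq: "U_space I edges prod_chambers = E.realization"
  by (simp add: U_space_def E.realization_def U_rel_eq)

lemma U_pt_eq: "U_rel I edges prod_chambers `` {(C, k)} = E.pt C k"
  by (simp add: E.pt_def U_rel_eq)

end

context chamber_system
begin

lemma near_image: "near T x y \<Longrightarrow> clique T \<Longrightarrow> E.near T (p x) (p y)"
  using E_near_iff near_F near_p p_in by (metis DiffD2)

lemma near_lift:
  assumes "x \<in> F" "E.near T (p x) D" "clique T"
  obtains y where "near T x y" "p y = D"
  using near_ex[OF assms(1,3), of D] assms E_near_iff by metis

text \<open>The image of a point, as a set of pairs, is again a full equivalence class, because residues are
  mapped onto residues.\<close>

definition proj_pt :: "('x \<times> ('i set \<Rightarrow> real)) set \<Rightarrow> (('i \<Rightarrow> 'c) \<times> ('i set \<Rightarrow> real)) set" where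
  "proj_pt c = (\<lambda>(x, k). (p x, k)) ` c"

lemma proj_pt:
  assumes x: "x \<in> F" and k: "k \<in> davis"
  shows "proj_pt (pt x k) = E.pt (p x) k"
proof -
  note cl = clique_mirrors[OF k]
  show ?thesis
  proof (intro equalityI subsetI)
    fix w assume "w \<in> proj_pt (pt x k)"
    then obtain y where "w = (p y, k)" "near (mirrors k) x y"
      unfolding proj_pt_def pt_altdef[OF k] by auto
    then show "w \<in> E.pt (p x) k" using near_image[OF _ cl] by (auto simp: E.pt_altdef[OF k])
  next
    fix w assume "w \<in> E.pt (p x) k"
    then obtain D where D: "w = (D, k)" "E.near (mirrors k) (p x) D"
      unfolding E.pt_altdef[OF k] by auto
    then obtain y where y: "near (mirrors k) x y" "p y = D" using near_lift[OF x _ cl] by metis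
    then have "(y, k) \<in> pt x k" by (simp add: pt_altdef[OF k])
    then show "w \<in> proj_pt (pt x k)" unfolding proj_pt_def using D y by force
  qed
qed

lemma continuous_map_proj_pt: "continuous_map realization E.realization proj_pt"
proof (rule continuous_map_from_realization)
  fix x assume x: "x \<in> F"
  have "continuous_map (top_of_set davis) E.realization (E.pt (p x))"
    using E.continuous_map_pt[OF p_in[OF x]] .
  then show "continuous_map (top_of_set davis) E.realization (\<lambda>k. proj_pt (pt x k))"
    by (rule continuous_map_eq) (simp add: proj_pt[OF x])
qed

text \<open>The preimage of an open set in the copy \<open>D\<close> of the Davis chamber is the union of its preimages in
  the copies over \<open>D\<close>.\<close>

lemma open_map_proj_pt: "open_map realization E.realization proj_pt"
  unfolding open_map_def
proof (intro allI impI)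
  fix W assume W: "openin realization W"
  have Wsub: "W \<subseteq> topspace realization" using W openin_subset by blast
  show "openin E.realization (proj_pt ` W)"
    unfolding E.openin_realization
  proof (intro conjI ballI)
    show "proj_pt ` W \<subseteq> {E.pt C k | C k. C \<in> prod_chambers \<and> k \<in> davis}"
    proof
      fix c assume "c \<in> proj_pt ` W"
      then obtain b where b: "b \<in> W" "c = proj_pt b" by blast
      obtain x k where "x \<in> F" "k \<in> davis" "b = pt x k"
        by (rule realization_cases[OF subsetD[OF Wsub b(1)]])
      then have "x \<in> F" "k \<in> davis" "c = proj_pt (pt x k)" using b(2) by auto
      then show "c \<in> {E.pt C k | C k. C \<in> prod_chambers \<and> k \<in> davis}"
        using proj_pt p_in by blast
    qed
    fix D assume D: "D \<in> prod_chambers"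
    have "{k \<in> davis. E.pt D k \<in> proj_pt ` W} = (\<Union>y\<in>{y \<in> F. p y = D}. {k \<in> davis. pt y k \<in> W})"
    proof (intro equalityI subsetI)
      fix k assume "k \<in> {k \<in> davis. E.pt D k \<in> proj_pt ` W}"
      then obtain c where k: "k \<in> davis" and c: "c \<in> W" "E.pt D k = proj_pt c" by auto
      obtain x l where x: "x \<in> F" "l \<in> davis" "c = pt x l"
        by (rule realization_cases[OF subsetD[OF Wsub c(1)]])
      then have "E.pt D k = E.pt (p x) l" using c(2) proj_pt by simp
      then have "k = l" "E.near (mirrors l) (p x) D"
        using E.pt_eq_iff[OF D p_in[OF x(1)] k x(2)] E.near_sym clique_mirrors[OF k] by auto
      then obtain y where y: "near (mirrors k) x y" "p y = D"
        using near_lift[OF x(1) _ clique_mirrors[OF x(2)]] by metis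
      then have "pt y k = c" using pt_eq_iff[OF x(1) _ k k, of y] near_F[OF y(1)] x(3) \<open>k = l\<close> by simp
      then show "k \<in> (\<Union>y\<in>{y \<in> F. p y = D}. {k \<in> davis. pt y k \<in> W})"
        using y near_F[OF y(1)] c(1) k by auto
    next
      fix k assume "k \<in> (\<Union>y\<in>{y \<in> F. p y = D}. {k \<in> davis. pt y k \<in> W})"
      then obtain y where y: "y \<in> F" "p y = D" "k \<in> davis" "pt y k \<in> W" by auto
      then have "E.pt D k = proj_pt (pt y k)" using proj_pt by simp
      then show "k \<in> {k \<in> davis. E.pt D k \<in> proj_pt ` W}" using y by blast
    qed
    moreover have "openin (top_of_set davis) {k \<in> davis. pt y k \<in> W}" if "y \<in> F" for y
      using W that by (simp add: openin_realization)
    ultimately show "openin (top_of_set davis) {k \<in> davis. E.pt D k \<in> proj_pt ` W}"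
      by (simp only:) (rule openin_Union, blast)
  qed
qed

lemma proj_pt_star:
  assumes k: "k \<in> davis" and x: "x \<in> F"
  shows "proj_pt ` star k x = E.star k (p x)"
proof (intro equalityI subsetI)
  note cl = clique_mirrors[OF k]
  fix c assume "c \<in> proj_pt ` star k x"
  then obtain y l where y: "c = proj_pt (pt y l)" "near (mirrors k) x y" "l \<in> davis" "mirrors l \<subseteq> mirrors k"
    by (auto simp: star_def)
  then have "c = E.pt (p y) l" using proj_pt near_F by blast
  then show "c \<in> E.star k (p x)" using near_image[OF y(2) cl] y by (auto simp: E.star_def)
next
  note cl = clique_mirrors[OF k]
  fix c assume "c \<in> E.star k (p x)"
  then obtain D l where D: "c = E.pt D l" "E.near (mirrors k) (p x) D" "l \<in> davis" "mirrors l \<subseteq> mirrors k"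
    by (auto simp: E.star_def)
  then obtain y where y: "near (mirrors k) x y" "p y = D" using near_lift[OF x _ cl] by metis
  then have "c = proj_pt (pt y l)" "pt y l \<in> star k x"
    using D proj_pt near_F[OF y(1)] by (auto simp: star_def)
  then show "c \<in> proj_pt ` star k x" by blast
qed

lemma homeomorphic_map_star:
  assumes k: "k \<in> davis" and x: "x \<in> F"
  shows "homeomorphic_map (subtopology realization (star k x)) (subtopology E.realization (E.star k (p x))) proj_pt"
proof -
  note cl = clique_mirrors[OF k]
  have top: "topspace (subtopology realization (star k x)) = star k x"
    "topspace (subtopology E.realization (E.star k (p x))) = E.star k (p x)"
    using star_subset E.star_subset by (auto simp: inf.absorb2)
  show ?thesis
  proof (rule bijective_open_imp_homeomorphic_map)
    show "continuous_map (subtopology realization (star k x)) (subtopology E.realization (E.star k (p x))) proj_pt"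
      using continuous_map_from_subtopology[OF continuous_map_proj_pt] proj_pt_star[OF k x]
      by (auto simp: continuous_map_in_subtopology)
    show "open_map (subtopology realization (star k x)) (subtopology E.realization (E.star k (p x))) proj_pt"
      using open_map_into_subtopology[OF open_map_from_subtopology[OF open_map_proj_pt openin_star[OF k x]]]
        proj_pt_star[OF k x] by (auto simp: top)
    show "proj_pt ` topspace (subtopology realization (star k x))
        = topspace (subtopology E.realization (E.star k (p x)))"
      unfolding top by (rule proj_pt_star[OF k x])
    show "inj_on proj_pt (topspace (subtopology realization (star k x)))"
      unfolding top
    proof (rule inj_onI)
      fix c c' assume "c \<in> star k x" "c' \<in> star k x" and eq: "proj_pt c = proj_pt c'"
      then obtain y l y' l' where y: "c = pt y l" "near (mirrors k) x y" "l \<in> davis" "mirrors l \<subseteq> mirrors k"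
        and y': "c' = pt y' l'" "near (mirrors k) x y'" "l' \<in> davis"
        by (auto simp: star_def)
      have F: "y \<in> F" "y' \<in> F" using near_F y(2) y'(2) by auto
      then have "E.pt (p y) l = E.pt (p y') l'" using eq y y' proj_pt by simp
      then have l: "l = l'" and E: "E.near (mirrors l) (p y) (p y')"
        using E.pt_eq_iff[of "p y" "p y'" l l'] p_in F y(3) y'(3) by auto
      obtain z where z: "near (mirrors l) y z" "p z = p y'"
        using near_lift[OF F(1) E clique_mirrors[OF y(3)]] .
      have "near (mirrors k) x z" using near_trans[OF y(2) near_mono[OF z(1) y(4) cl] cl] .
      then have "z = y'" using near_unique[OF _ y'(2)] z(2) by blast
      then show "c = c'" using z(1) l y y' pt_eq_iff[OF F y(3) y'(3)] by simp
    qed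
  qed
qed

text \<open>The preimage of a star is the disjoint union of the stars of the residues above it, each of
  which is mapped bijectively.\<close>

theorem covering_map_proj_pt: "covering_map realization E.realization proj_pt"
  unfolding covering_map_def
proof (intro conjI ballI)
  show "continuous_map realization E.realization proj_pt" by (rule continuous_map_proj_pt)
  show "proj_pt ` topspace realization = topspace E.realization"
  proof
    show "proj_pt ` topspace realization \<subseteq> topspace E.realization"
      by (rule continuous_map_image_subset_topspace[OF continuous_map_proj_pt])
    show "topspace E.realization \<subseteq> proj_pt ` topspace realization"
    proof
      fix c assume "c \<in> topspace E.realization"
      then obtain D k where D: "D \<in> prod_chambers" "k \<in> davis" "c = E.pt D k" by (rule E.realization_cases)
      obtain x0 where x0: "x0 \<in> F" using F_nonempty by blast
      let ?x = "walk op D (enum I) x0"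
      have x: "?x \<in> F" using x0 D walk_in set_enum[OF finite_I] by simp
      have "p ?x i = D i" for i
        using x0 D p_walk[of x0 "enum I" D] set_enum[OF finite_I] PiE_arb[OF D(1)] PiE_arb[OF p_in[OF x0]] by auto
      then have "p ?x = D" by blast
      then show "c \<in> proj_pt ` topspace realization"
        using proj_pt[OF x D(2)] D(3) pt_in[OF x D(2)] by (metis imageI)
    qed
  qed
  fix c assume "c \<in> topspace E.realization"
  then obtain C k where C: "C \<in> prod_chambers" "k \<in> davis" "c = E.pt C k" by (rule E.realization_cases)
  note cl = clique_mirrors[OF C(2)]
  let ?V = "E.star k C" and ?U = "star k ` {x \<in> F. p x = C}"
  have "c \<in> ?V" using C E.pt_in_star[OF C(2,1,1,2)] E.near_refl[OF cl] by simp
  moreover have "openin E.realization ?V" by (rule E.openin_star[OF C(2,1)])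
  moreover have "\<Union>?U = {b \<in> topspace realization. proj_pt b \<in> ?V}"
  proof (intro equalityI subsetI)
    fix b assume "b \<in> \<Union>?U"
    then obtain x where x: "x \<in> F" "p x = C" "b \<in> star k x" by auto
    then show "b \<in> {b \<in> topspace realization. proj_pt b \<in> ?V}"
      using proj_pt_star[OF C(2) x(1)] star_subset by blast
  next
    fix b assume b: "b \<in> {b \<in> topspace realization. proj_pt b \<in> ?V}"
    then obtain y l where y: "y \<in> F" "l \<in> davis" "b = pt y l" by (auto simp: topspace_realization)
    then have "E.pt (p y) l \<in> ?V" using b proj_pt by simp
    then have l: "mirrors l \<subseteq> mirrors k" "E.near (mirrors k) C (p y)"
      using E.pt_in_star[OF C(2,1) p_in[OF y(1)] y(2)] by auto
    obtain x where x: "near (mirrors k) y x" "p x = C"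
      using near_lift[OF y(1) E.near_sym[OF l(2) cl] cl] .
    then have "b \<in> star k x" using pt_in_star[OF C(2) _ y(1,2)] near_F[OF x(1)] near_sym[OF x(1) cl] l y by simp
    then show "b \<in> \<Union>?U" using x near_F by blast
  qed
  moreover have "\<forall>U\<in>?U. openin realization U" using openin_star[OF C(2)] by blast
  moreover have "pairwise disjnt ?U"
  proof (rule pairwiseI)
    fix U U' assume "U \<in> ?U" "U' \<in> ?U" "U \<noteq> U'"
    then obtain x x' where x: "x \<in> F" "p x = C" "U = star k x" "x' \<in> F" "p x' = C" "U' = star k x'" "x \<noteq> x'"
      by auto
    show "disjnt U U'"
    proof (rule ccontr)
      assume "\<not> disjnt U U'"
      then obtain b where b: "b \<in> star k x" "b \<in> star k x'" using x by (auto simp: disjnt_def)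
      obtain y l where y: "y \<in> F" "l \<in> davis" "b = pt y l"
        by (rule realization_cases[OF subsetD[OF star_subset b(1)]])
      then have "near (mirrors k) x y" "near (mirrors k) x' y"
        using b pt_in_star[OF C(2) _ y(1,2)] x by auto
      then have "near (mirrors k) x x'" using near_trans near_sym cl by blast
      then show False using near_unique[OF near_refl[OF cl x(1)]] x by metis
    qed
  qed
  moreover have "\<forall>U\<in>?U. homeomorphic_map (subtopology realization U) (subtopology E.realization ?V) proj_pt"
    using homeomorphic_map_star[OF C(2)] by blast
  ultimately show "\<exists>V. c \<in> V \<and> openin E.realization V \<and>
      (\<exists>\<U>. \<Union>\<U> = {b \<in> topspace realization. proj_pt b \<in> V} \<and> (\<forall>U\<in>\<U>. openin realization U) \<and>
        pairwise disjnt \<U> \<and>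
        (\<forall>U\<in>\<U>. homeomorphic_map (subtopology realization U) (subtopology E.realization V) proj_pt))"
    by (intro exI[of _ ?V] exI[of _ ?U] conjI)
qed

end

section \<open>Pilings\<close>

text \<open>
  A gallery from \<open>x0\<close> is recorded by one stack of beads and markers for every generator. Leaving the
  base chamber of an \<open>i\<close>-panel puts a bead on stack \<open>i\<close>, carrying the \<open>i\<close>-th coordinate of that base
  chamber, and a marker on the stack of every generator that does not commute with \<open>i\<close>; returning to
  the base chamber removes them. Commuting generators meet on a common stack only with their
  markers, which are interchangeable, so the record does not depend on the order of their steps.
\<close>

context chamber_data
begin

definition push :: "'i \<Rightarrow> 'c \<Rightarrow> ('i \<Rightarrow> 'c option list) \<Rightarrow> 'i \<Rightarrow> 'c option list" where
  "push i b \<pi> j = (if j = i then Some b # \<pi> j else if j \<in> I \<and> {i, j} \<notin> edges then None # \<pi> j else \<pi> j)"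

definition pop :: "'i \<Rightarrow> ('i \<Rightarrow> 'c option list) \<Rightarrow> 'i \<Rightarrow> 'c option list" where
  "pop i \<pi> j = (if j = i \<or> j \<in> I \<and> {i, j} \<notin> edges then tl (\<pi> j) else \<pi> j)"

definition bead :: "'i \<Rightarrow> ('i \<Rightarrow> 'c option list) \<Rightarrow> bool" where
  "bead i \<pi> \<longleftrightarrow> (\<exists>b l. \<pi> i = Some b # l)"

definition beads :: "'i \<Rightarrow> ('i \<Rightarrow> 'c option list) \<Rightarrow> nat" where
  "beads i \<pi> = length (filter (\<lambda>s. s \<noteq> None) (\<pi> i))"

text \<open>A chamber with coordinates \<open>v\<close> is the base chamber of its \<open>i\<close>-panel unless stack \<open>i\<close> has a bead on
  top, which then carries the coordinate of the base chamber.\<close>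

definition restack :: "'i \<Rightarrow> 'c \<Rightarrow> ('i \<Rightarrow> 'c) \<Rightarrow> ('i \<Rightarrow> 'c option list) \<Rightarrow> 'i \<Rightarrow> 'c option list" where
  "restack i d v \<pi> =
    (if bead i \<pi> then (if hd (\<pi> i) = Some d then pop i \<pi> else \<pi>)
     else if d = v i then \<pi> else push i (v i) \<pi>)"

lemma pop_push: "pop i (push i b \<pi>) = \<pi>"
  by (auto simp: pop_def push_def fun_eq_iff)

lemma bead_push: "bead i (push i b \<pi>)"
  by (simp add: bead_def push_def)

lemma edge_neq: "{i, j} \<in> edges \<Longrightarrow> i \<noteq> j"
  using edges_card by fastforce

lemma edge_in: "{i, j} \<in> edges \<Longrightarrow> i \<in> I \<and> j \<in> I"
  using edges_card by fastforce

lemma push_commute: "{i, j} \<in> edges \<Longrightarrow> push i b (push j c \<pi>) = push j c (push i b \<pi>)"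
  using edge_neq by (fastforce simp: push_def fun_eq_iff insert_commute)

lemma pop_push_commute:
  assumes "{i, j} \<in> edges"
  shows "pop i (push j c (push i b \<pi>)) = push j c \<pi>"
  using push_commute[OF assms] pop_push by metis

lemma push_other: "{i, j} \<in> edges \<Longrightarrow> push i b \<pi> j = \<pi> j"
  and pop_other: "{i, j} \<in> edges \<Longrightarrow> pop i \<pi> j = \<pi> j"
  using edge_neq by (auto simp: push_def pop_def)

lemma restack_other: "{i, j} \<in> edges \<Longrightarrow> restack i d v \<pi> j = \<pi> j"
  by (simp add: restack_def push_other pop_other)

lemma beads_push: "beads j (push i b \<pi>) = beads j \<pi> + (if j = i then 1 else 0)"
  by (simp add: beads_def push_def)

end

context chamber_system
begin

inductive reach :: "'x \<Rightarrow> ('i \<Rightarrow> 'c option list) \<Rightarrow> 'x \<Rightarrow> bool" for x0 where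
  start: "reach x0 (\<lambda>_. []) x0"
| step: "\<lbrakk>reach x0 \<pi> x; i \<in> I; \<not> bead i \<pi>; d \<in> \<Delta> i; d \<noteq> p x i\<rbrakk>
    \<Longrightarrow> reach x0 (push i (p x i) \<pi>) (op i d x)"

lemma reach_in: "reach x0 \<pi> x \<Longrightarrow> x0 \<in> F \<Longrightarrow> x \<in> F"
  by (induction rule: reach.induct) (auto intro: op_in)

lemma reach_nil:
  assumes "reach x0 (\<lambda>_. []) x"
  shows "x = x0"
proof -
  have "\<pi> = (\<lambda>_. []) \<longrightarrow> x = x0" if "reach x0 \<pi> x" for \<pi>
    using that
  proof cases
    case (step \<pi>' x' i d)
    have "push i (p x' i) \<pi>' i \<noteq> []" by (simp add: push_def)
    then show ?thesis using step(1) by metis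
  qed simp
  with assms show ?thesis by blast
qed

text \<open>
  A bead on top of stack \<open>i\<close> was put there by a step that commutes with all later ones, so that
  step may be assumed to be the last one.
\<close>

lemma reach_pop:
  assumes "reach x0 \<pi> x" "x0 \<in> F" "\<pi> i = Some b # l" "i \<in> I"
  shows "\<exists>x'. reach x0 (pop i \<pi>) x' \<and> p x' i = b \<and> p x i \<noteq> b \<and> x = op i (p x i) x' \<and>
    \<not> bead i (pop i \<pi>) \<and> \<pi> = push i b (pop i \<pi>)"
  using assms
proof (induction arbitrary: l rule: reach.induct)
  case (step \<pi> x j d)
  note j = \<open>j \<in> I\<close> and d = \<open>d \<in> \<Delta> j\<close>
  have x: "x \<in> F" using reach_in step by blast
  show ?case
  proof (cases "i = j")
    case True
    then have "b = p x j" using step.prems by (simp add: push_def)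
    then show ?thesis using True step x by (intro exI[of _ x]) (simp add: pop_push p_op)
  next
    case False
    then have e: "{j, i} \<in> edges" and \<pi>i: "\<pi> i = Some b # l"
      using step.prems by (auto simp: push_def split: if_splits)
    have e': "{i, j} \<in> edges" using e by (simp add: insert_commute)
    obtain x' where x': "reach x0 (pop i \<pi>) x'" "p x' i = b" "p x i \<noteq> b" "x = op i (p x i) x'"
      "\<not> bead i (pop i \<pi>)" "\<pi> = push i b (pop i \<pi>)"
      using step.IH[OF step.prems(1) \<pi>i step.prems(3)] by blast
    have F': "x' \<in> F" using reach_in x'(1) step.prems by blast
    have pxi: "p x i \<in> \<Delta> i" using p_coord x step.prems by blast
    have pj: "p x' j = p x j"
      using x'(4) p_op[OF F' step.prems(3) pxi] False by (metis fun_upd_other)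
    have pop: "pop i (push j (p x j) \<pi>) = push j (p x j) (pop i \<pi>)"
      using pop_push_commute[OF e'] x'(6) by metis
    have nb: "\<not> bead j (pop i \<pi>)"
      using step.hyps pop_other[OF e'] by (simp add: bead_def)
    have "reach x0 (push j (p x' j) (pop i \<pi>)) (op j d x')"
      using reach.step[OF x'(1) j nb d] step.hyps pj by simp
    then have "reach x0 (pop i (push j (p x j) \<pi>)) (op j d x')" using pop pj by simp
    moreover have "p (op j d x') i = b" "p (op j d x) i \<noteq> b"
      using p_op[OF F' j d] p_op[OF x j d] False x' by simp_all
    moreover have "op j d x = op i (p (op j d x) i) (op j d x')"
      using op_commute[OF F' e d pxi] x'(4) p_op[OF x j d] False by (metis fun_upd_other)
    moreover have "\<not> bead i (pop i (push j (p x j) \<pi>))"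
      unfolding pop using x'(5) push_other[OF e] by (simp add: bead_def)
    moreover have "push j (p x j) \<pi> = push i b (pop i (push j (p x j) \<pi>))"
      unfolding pop using push_commute[OF e'] x'(6) by metis
    ultimately show ?thesis by blast
  qed
qed simp

lemma beadE:
  assumes "bead i \<pi>"
  obtains b l where "\<pi> i = Some b # l"
  using assms by (auto simp: bead_def)

lemma reach_restack:
  assumes r: "reach x0 \<pi> x" and x0: "x0 \<in> F" and i: "i \<in> I" and d: "d \<in> \<Delta> i"
  shows "reach x0 (restack i d (p x) \<pi>) (op i d x)"
proof (cases "bead i \<pi>")
  case True
  then obtain b l where b: "\<pi> i = Some b # l" by (rule beadE)
  obtain x' where x': "reach x0 (pop i \<pi>) x'" "p x' i = b" "p x i \<noteq> b" "x = op i (p x i) x'"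
    "\<not> bead i (pop i \<pi>)" "\<pi> = push i b (pop i \<pi>)"
    using reach_pop[OF r x0 b i] by blast
  have F: "x' \<in> F" "x \<in> F" using reach_in x'(1) r x0 by auto
  have opd: "op i d x = op i d x'"
    using op_op[OF F(1) i p_coord[OF F(2) i] d] x'(4) by simp
  show ?thesis
  proof (cases "d = b")
    case True
    then have "op i d x = x'" using opd op_self[OF F(1) i] x'(2) by simp
    then show ?thesis using True x'(1) b \<open>bead i \<pi>\<close> by (simp add: restack_def)
  next
    case False
    then have "reach x0 (push i b (pop i \<pi>)) (op i d x')"
      using reach.step[OF x'(1) i x'(5) d] x'(2) by simp
    then show ?thesis using False b \<open>bead i \<pi>\<close> opd x'(6) by (simp add: restack_def)
  qed
next
  case False
  have "x \<in> F" using reach_in r x0 by blast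
  then show ?thesis
    using False reach.step[OF r i False d] op_self[OF _ i] r by (auto simp: restack_def)
qed

lemma restack_self:
  assumes "reach x0 \<pi> x" "x0 \<in> F" "i \<in> I"
  shows "restack i (p x i) (p x) \<pi> = \<pi>"
proof (cases "bead i \<pi>")
  case True
  then obtain b l where "\<pi> i = Some b # l" by (rule beadE)
  then show ?thesis using reach_pop[OF assms(1,2) _ assms(3)] True by (auto simp: restack_def)
qed (simp add: restack_def)

lemma restack_restack:
  assumes r: "reach x0 \<pi> x" and x0: "x0 \<in> F" and i: "i \<in> I" and v: "v = p x"
  shows "restack i d (v(i := c)) (restack i c v \<pi>) = restack i d v \<pi>"
proof (cases "bead i \<pi>")
  case True
  then obtain b l where b: "\<pi> i = Some b # l" by (rule beadE)
  then obtain x' where "\<not> bead i (pop i \<pi>)" "\<pi> = push i b (pop i \<pi>)"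
    using reach_pop[OF r x0 b i] by blast
  then show ?thesis using b True by (auto simp: restack_def)
next
  case False
  have "push i (v i) \<pi> i = Some (v i) # \<pi> i" by (simp add: push_def)
  then show ?thesis using False by (auto simp: restack_def pop_push bead_push)
qed

text \<open>A removed bead has markers next to it that were put on top by the same step, so that pushing for
  \<open>j\<close> and removing for \<open>i\<close> commute on the stacks they share.\<close>

lemma restack_commute:
  assumes r: "reach x0 \<pi> x" and x0: "x0 \<in> F" and e: "{i, j} \<in> edges"
  shows "restack i c (v(j := d)) (restack j d v \<pi>) = restack j d (v(i := c)) (restack i c v \<pi>)"
proof -
  have e': "{j, i} \<in> edges" and ij: "i \<noteq> j" "i \<in> I" "j \<in> I"
    using e edge_neq edge_in by (auto simp: insert_commute)
  have pp: "pop i (pop j \<pi>) = pop j (pop i \<pi>)"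
    by (auto simp: pop_def fun_eq_iff)
  have pu: "pop i' (push j' a \<pi>) = push j' a (pop i' \<pi>)"
    if t: "bead i' \<pi>" "i' \<in> I" "{i', j'} \<in> edges" for i' j' a
  proof -
    obtain b l where b: "\<pi> i' = Some b # l" using t(1) by (rule beadE)
    then have "\<pi> = push i' b (pop i' \<pi>)" using reach_pop[OF r x0 b t(2)] by blast
    then show ?thesis using pop_push_commute[OF t(3)] by metis
  qed
  have bi: "bead i (restack j d v \<pi>) = bead i \<pi>" "restack j d v \<pi> i = \<pi> i"
    "bead j (restack i c v \<pi>) = bead j \<pi>" "restack i c v \<pi> j = \<pi> j"
    using restack_other[OF e] restack_other[OF e'] by (simp_all add: bead_def)
  show ?thesis
    unfolding restack_def[of i c "v(j := d)"] restack_def[of j d "v(i := c)"] bi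
    using ij pp pu[of i j] pu[of j i] e e' push_commute[OF e]
    by (auto simp: restack_def)
qed

lemma beads_restack:
  assumes r: "reach x0 \<pi> x" and x0: "x0 \<in> F" and i: "i \<in> I"
  shows "beads j (restack i d v \<pi>) \<le> beads j \<pi> + (if j = i \<and> \<not> bead i \<pi> then 1 else 0)"
    and "bead i \<pi> \<Longrightarrow> \<not> bead i (restack i d v \<pi>) \<Longrightarrow> beads i (restack i d v \<pi>) < beads i \<pi>"
proof -
  have pop: "beads j \<pi> = beads j (pop i \<pi>) + (if j = i then 1 else 0)" if b: "bead i \<pi>" for j
  proof -
    obtain b l where b: "\<pi> i = Some b # l" using b by (rule beadE)
    then have "\<pi> = push i b (pop i \<pi>)" using reach_pop[OF r x0 b i] by blast
    then show ?thesis using beads_push by metis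
  qed
  show "beads j (restack i d v \<pi>) \<le> beads j \<pi> + (if j = i \<and> \<not> bead i \<pi> then 1 else 0)"
    using pop[of j] by (auto simp: restack_def beads_push)
  show "bead i \<pi> \<Longrightarrow> \<not> bead i (restack i d v \<pi>) \<Longrightarrow> beads i (restack i d v \<pi>) < beads i \<pi>"
    using pop[of i] by (auto simp: restack_def split: if_splits)
qed

text \<open>Every step that lengthens a stack adds one bead, so bounding the beads bounds the stacks.\<close>

lemma reach_bounds:
  assumes "reach x0 \<pi> x" "x0 \<in> F"
  shows "(\<forall>j. j \<notin> I \<longrightarrow> \<pi> j = []) \<and> (\<forall>j. set (\<pi> j) \<subseteq> insert None (Some ` (\<Union>i\<in>I. \<Delta> i))) \<and>
    (\<forall>j. length (\<pi> j) \<le> (\<Sum>i\<in>I. beads i \<pi>))"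
  using assms
proof (induction rule: reach.induct)
  case (step \<pi> x i d)
  then have x: "x \<in> F" using reach_in by blast
  have "(\<Sum>j\<in>I. beads j (push i (p x i) \<pi>)) = (\<Sum>j\<in>I. beads j \<pi>) + 1"
    using finite_I step.hyps by (simp add: beads_push sum.distrib)
  moreover have "length (push i (p x i) \<pi> j) \<le> length (\<pi> j) + 1" for j by (simp add: push_def)
  ultimately have "\<forall>j. length (push i (p x i) \<pi> j) \<le> (\<Sum>j\<in>I. beads j (push i (p x i) \<pi>))"
    using step.IH[OF step.prems] by (metis add_le_mono1 order_trans)
  moreover have "Some (p x i) \<in> Some ` (\<Union>i\<in>I. \<Delta> i)" using p_coord[OF x \<open>i \<in> I\<close>] \<open>i \<in> I\<close> by blast
  moreover have "push i (p x i) \<pi> j = []" if "j \<notin> I" for j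
    using step.IH[OF step.prems] \<open>i \<in> I\<close> that by (auto simp: push_def)
  moreover have "set (push i (p x i) \<pi> j) \<subseteq> insert (Some (p x i)) (insert None (set (\<pi> j)))" for j
    by (auto simp: push_def)
  moreover have "set (push i (p x i) \<pi> j) \<subseteq> insert None (Some ` (\<Union>i\<in>I. \<Delta> i))" for j
    using step.IH[OF step.prems] calculation(2) calculation(4)[of j] by blast
  ultimately show ?case by blast
qed simp

section \<open>Truncated pilings\<close>

text \<open>
  A panel is left alone when it would require more than \<open>N\<close> beads on stack \<open>i\<close>. Whether this
  happens does not depend on the stacks of the generators commuting with \<open>i\<close>, which is why the
  operations of commuting generators still commute. As coordinates can no longer be changed freely
  in such a panel, a state of the truncated system consists of the actual coordinates \<open>e\<close> and of
  virtual ones, on which \<open>e i \<mapsto> c\<close> acts by a permutation of \<open>\<Delta> i\<close> that depends on \<open>e i\<close> and \<open>c\<close> in a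
  multiplicative way and maps \<open>e i\<close> to \<open>c\<close>.
\<close>

text \<open>Any family of permutations \<open>\<sigma> c\<close> with \<open>\<sigma> c b = c\<close> for a fixed \<open>b\<close> would do, with \<open>\<sigma> c \<circ> inv (\<sigma> e)\<close>.\<close>

definition shift :: "'i \<Rightarrow> 'c \<Rightarrow> 'c \<Rightarrow> 'c \<Rightarrow> 'c" where
  "shift i e c = (let b = SOME b. b \<in> \<Delta> i in Transposition.transpose b c \<circ> Transposition.transpose b e)"

definition active :: "nat \<Rightarrow> 'i \<Rightarrow> ('i \<Rightarrow> 'c option list) \<Rightarrow> bool" where
  "active N i \<pi> \<longleftrightarrow> bead i \<pi> \<or> beads i \<pi> < N"

definition states :: "'x \<Rightarrow> nat \<Rightarrow> (('i \<Rightarrow> 'c) \<times> ('i \<Rightarrow> 'c option list)) set" where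
  "states x0 N = {(p x, \<pi>) | x \<pi>. reach x0 \<pi> x \<and> (\<forall>i\<in>I. beads i \<pi> \<le> N)}"

definition act :: "nat \<Rightarrow> 'i \<Rightarrow> ('c \<Rightarrow> 'c) \<Rightarrow>
    ('i \<Rightarrow> 'c) \<times> ('i \<Rightarrow> 'c option list) \<Rightarrow> ('i \<Rightarrow> 'c) \<times> ('i \<Rightarrow> 'c option list)" where
  "act N i \<sigma> = (\<lambda>(v, \<pi>). if active N i \<pi> then (v(i := \<sigma> (v i)), restack i (\<sigma> (v i)) v \<pi>) else (v, \<pi>))"

definition trunc_op :: "nat \<Rightarrow> 'i \<Rightarrow> 'c \<Rightarrow> ('i \<Rightarrow> 'c) \<times> ('i \<Rightarrow> 'c) \<times> ('i \<Rightarrow> 'c option list)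
    \<Rightarrow> ('i \<Rightarrow> 'c) \<times> ('i \<Rightarrow> 'c) \<times> ('i \<Rightarrow> 'c option list)" where
  "trunc_op N i c = (\<lambda>(e, s). (e(i := c), act N i (shift i (e i) c) s))"

lemma shift_in:
  assumes "i \<in> I" "e \<in> \<Delta> i" "c \<in> \<Delta> i" "a \<in> \<Delta> i"
  shows "shift i e c a \<in> \<Delta> i"
proof -
  have "(SOME b. b \<in> \<Delta> i) \<in> \<Delta> i" using assms(2) by (rule someI)
  then show ?thesis using assms by (auto simp: shift_def Let_def Transposition.transpose_def)
qed

lemma shift_self: "shift i e e = id"
  by (simp add: shift_def Let_def)

lemma shift_apply: "shift i e c e = c"
  by (simp add: shift_def Let_def)

lemma shift_shift: "shift i c d (shift i e c a) = shift i e d a"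
  by (simp add: shift_def Let_def)

lemma states_coord: "x0 \<in> F \<Longrightarrow> (v, \<pi>) \<in> states x0 N \<Longrightarrow> i \<in> I \<Longrightarrow> v i \<in> \<Delta> i"
  using reach_in p_coord by (fastforce simp: states_def)

lemma active_restack:
  assumes r: "reach x0 \<pi> x" and x0: "x0 \<in> F" and i: "i \<in> I"
    and N: "beads i \<pi> \<le> N" and a: "active N i \<pi>"
  shows "active N i (restack i d v \<pi>)"
proof (cases "bead i \<pi>")
  case True
  show ?thesis
  proof (cases "bead i (restack i d v \<pi>)")
    case False
    from beads_restack(2)[OF r x0 i True this] N show ?thesis by (simp add: active_def)
  qed (simp add: active_def)
next
  case False
  then show ?thesis using a by (auto simp: active_def restack_def bead_push)
qed

lemma act_states:
  assumes x0: "x0 \<in> F" and s: "(v, \<pi>) \<in> states x0 N" and i: "i \<in> I" and \<sigma>: "\<sigma> (v i) \<in> \<Delta> i"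
  shows "act N i \<sigma> (v, \<pi>) \<in> states x0 N"
proof (cases "active N i \<pi>")
  case True
  obtain x where x: "v = p x" "reach x0 \<pi> x" "\<forall>i\<in>I. beads i \<pi> \<le> N" using s by (auto simp: states_def)
  have F: "x \<in> F" using reach_in x x0 by blast
  have "reach x0 (restack i (\<sigma> (v i)) v \<pi>) (op i (\<sigma> (v i)) x)"
    unfolding x(1) by (rule reach_restack[OF x(2) x0 i]) (use \<sigma> x in simp)
  moreover have "p (op i (\<sigma> (v i)) x) = v(i := \<sigma> (v i))" using p_op[OF F i \<sigma>] x by simp
  moreover have "beads j (restack i (\<sigma> (v i)) v \<pi>) \<le> N" if "j \<in> I" for j
    using beads_restack(1)[OF x(2) x0 i, of j "\<sigma> (v i)" v] x(3) that True
    by (fastforce simp: active_def split: if_splits)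
  ultimately show ?thesis using True by (auto simp: act_def states_def) metis
qed (use s in \<open>simp add: act_def\<close>)

lemma act_act:
  assumes x0: "x0 \<in> F" and s: "(v, \<pi>) \<in> states x0 N" and i: "i \<in> I"
  shows "act N i \<tau> (act N i \<sigma> (v, \<pi>)) = act N i (\<tau> \<circ> \<sigma>) (v, \<pi>)"
proof (cases "active N i \<pi>")
  case True
  obtain x where x: "v = p x" "reach x0 \<pi> x" "\<forall>i\<in>I. beads i \<pi> \<le> N" using s by (auto simp: states_def)
  have "active N i (restack i (\<sigma> (v i)) v \<pi>)" using active_restack[OF x(2) x0 i _ True] x i by blast
  then show ?thesis using True restack_restack[OF x(2) x0 i x(1)] by (simp add: act_def)
qed (simp add: act_def)

lemma act_id:
  assumes x0: "x0 \<in> F" and s: "(v, \<pi>) \<in> states x0 N" and i: "i \<in> I"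
  shows "act N i id (v, \<pi>) = (v, \<pi>)"
proof -
  obtain x where x: "v = p x" "reach x0 \<pi> x" using s by (auto simp: states_def)
  then show ?thesis using restack_self[OF x(2) x0 i] by (simp add: act_def)
qed

lemma act_commute:
  assumes x0: "x0 \<in> F" and s: "(v, \<pi>) \<in> states x0 N" and e: "{i, j} \<in> edges"
  shows "act N i \<sigma> (act N j \<tau> (v, \<pi>)) = act N j \<tau> (act N i \<sigma> (v, \<pi>))"
proof -
  have e': "{j, i} \<in> edges" and ij: "i \<noteq> j" using e edge_neq by (auto simp: insert_commute)
  obtain x where x: "reach x0 \<pi> x" using s by (auto simp: states_def)
  have a: "active N i (restack j d w \<pi>) = active N i \<pi>" "active N j (restack i d w \<pi>) = active N j \<pi>" for d w
    using restack_other[OF e, of d w \<pi>] restack_other[OF e', of d w \<pi>] by (simp_all add: active_def bead_def beads_def)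
  show ?thesis using ij a restack_commute[OF x x0 e] by (simp add: act_def fun_upd_twist)
qed

lemma finite_states:
  assumes x0: "x0 \<in> F"
  shows "finite (states x0 N)"
proof -
  let ?B = "{l. set l \<subseteq> insert None (Some ` (\<Union>i\<in>I. \<Delta> i)) \<and> length l \<le> card I * N}"
  let ?P = "{\<pi> :: 'i \<Rightarrow> 'c option list. \<forall>j. (j \<in> I \<longrightarrow> \<pi> j \<in> ?B) \<and> (j \<notin> I \<longrightarrow> \<pi> j = [])}"
  have "finite ?B" using finite_I finite_\<Delta> by (intro finite_lists_length_le) auto
  then have P: "finite ?P" using finite_I by (rule finite_set_of_finite_funs[rotated])
  have E: "finite prod_chambers" using finite_I finite_\<Delta> by (rule finite_PiE)
  have "states x0 N \<subseteq> prod_chambers \<times> ?P"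
  proof
    fix s assume "s \<in> states x0 N"
    then obtain x \<pi> where x: "s = (p x, \<pi>)" "reach x0 \<pi> x" "\<forall>i\<in>I. beads i \<pi> \<le> N"
      by (auto simp: states_def)
    have "(\<Sum>i\<in>I. beads i \<pi>) \<le> card I * N" using sum_bounded_above[of I "\<lambda>i. beads i \<pi>" N] x(3) by simp
    then have "\<pi> \<in> ?P" using reach_bounds[OF x(2) x0] by (auto intro: order_trans)
    moreover have "p x \<in> prod_chambers" using p_in[OF reach_in[OF x(2) x0]] .
    ultimately show "s \<in> prod_chambers \<times> ?P" unfolding x(1) by (rule SigmaI[rotated])
  qed
  from finite_subset[OF this finite_cartesian_product[OF E P]] show ?thesis .
qed

lemma trunc_system:
  assumes x0: "x0 \<in> F"
  shows "chamber_system I edges \<Delta> (prod_chambers \<times> states x0 N) fst (trunc_op N)"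
proof
  have "(p x0, \<lambda>_. []) \<in> states x0 N" using reach.start by (fastforce simp: states_def beads_def)
  then show "prod_chambers \<times> states x0 N \<noteq> {}" using p_in[OF x0] by blast
  fix w :: "('i \<Rightarrow> 'c) \<times> ('i \<Rightarrow> 'c) \<times> ('i \<Rightarrow> 'c option list)" and i j :: 'i and c d
  assume w: "w \<in> prod_chambers \<times> states x0 N"
  then obtain e v \<pi> where w': "w = (e, v, \<pi>)" "e \<in> prod_chambers" "(v, \<pi>) \<in> states x0 N" by auto
  note coord = states_coord[OF x0 w'(3)]
  show "fst w \<in> prod_chambers" using w by auto
  show "trunc_op N i c w \<in> prod_chambers \<times> states x0 N" if i: "i \<in> I" "c \<in> \<Delta> i"
  proof -
    have "e i \<in> \<Delta> i" using w'(2) i by auto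
    then have "act N i (shift i (e i) c) (v, \<pi>) \<in> states x0 N"
      using i coord shift_in by (intro act_states x0 w'(3)) auto
    then show ?thesis using E.op_in[OF w'(2) i] w'(1) by (simp add: trunc_op_def)
  qed
  show "fst (trunc_op N i c w) = (fst w)(i := c)" by (simp add: trunc_op_def w'(1))
  show "trunc_op N i (fst w i) w = w" if "i \<in> I"
    using act_id[OF x0 w'(3) that] by (simp add: trunc_op_def w'(1) shift_self)
  show "trunc_op N i d (trunc_op N i c w) = trunc_op N i d w" if "i \<in> I"
    using act_act[OF x0 w'(3) that] by (simp add: trunc_op_def w'(1) o_def shift_shift)
  show "trunc_op N i c (trunc_op N j d w) = trunc_op N j d (trunc_op N i c w)" if "{i, j} \<in> edges"
    using act_commute[OF x0 w'(3) that] edge_neq[OF that] by (simp add: trunc_op_def w'(1) fun_upd_twist)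
qed

inductive gallery :: "'x \<Rightarrow> nat \<Rightarrow> 'x \<Rightarrow> bool" for x0 where
  "gallery x0 0 x0"
| "\<lbrakk>gallery x0 n x; i \<in> I; c \<in> \<Delta> i\<rbrakk> \<Longrightarrow> gallery x0 (Suc n) (op i c x)"

text \<open>Along galleries of length at most \<open>N\<close> no panel is truncated, so a morphism to the truncated
  system records the piling of the gallery, and an empty piling means that the gallery is closed.\<close>

theorem truncation_separates:
  assumes x0: "x0 \<in> F" and y: "gallery x0 n y" "y \<noteq> x0"
    and f0: "f x0 = (p x0, p x0, \<lambda>_. [])"
    and f: "\<And>x i c. \<lbrakk>x \<in> F; i \<in> I; c \<in> \<Delta> i\<rbrakk> \<Longrightarrow> f (op i c x) = trunc_op n i c (f x)"
  shows "f y \<noteq> f x0"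
proof -
  have "x \<in> F \<and> (m \<le> n \<longrightarrow> (\<exists>\<pi>. f x = (p x, p x, \<pi>) \<and> reach x0 \<pi> x \<and> (\<forall>i\<in>I. beads i \<pi> \<le> m)))"
    if "gallery x0 m x" for m x
    using that
  proof (induction rule: gallery.induct)
    case 1
    then show ?case using x0 f0 reach.start by (auto simp: beads_def)
  next
    case (2 m x i c)
    note i = \<open>i \<in> I\<close> \<open>c \<in> \<Delta> i\<close>
    have x: "x \<in> F" using 2 by blast
    show ?case
    proof (intro conjI impI)
      show "op i c x \<in> F" using op_in[OF x i] .
      assume m: "Suc m \<le> n"
      then obtain \<pi> where \<pi>: "f x = (p x, p x, \<pi>)" "reach x0 \<pi> x" "\<forall>i\<in>I. beads i \<pi> \<le> m" using 2 by auto
      have "active n i \<pi>" using \<pi>(3) i m by (fastforce simp: active_def)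
      then have "f (op i c x) = (p (op i c x), p (op i c x), restack i c (p x) \<pi>)"
        using f[OF x i] \<pi>(1) by (simp add: trunc_op_def act_def shift_apply p_op[OF x i])
      moreover have "reach x0 (restack i c (p x) \<pi>) (op i c x)" using reach_restack[OF \<pi>(2) x0 i] .
      moreover have "beads j (restack i c (p x) \<pi>) \<le> Suc m" if "j \<in> I" for j
        using beads_restack(1)[OF \<pi>(2) x0 i(1), of j c "p x"] \<pi>(3) that by (fastforce split: if_splits)
      ultimately show "\<exists>\<pi>. f (op i c x) = (p (op i c x), p (op i c x), \<pi>) \<and> reach x0 \<pi> (op i c x) \<and>
          (\<forall>i\<in>I. beads i \<pi> \<le> Suc m)" by blast
    qed
  qed
  from this[OF y(1)] obtain \<pi> where "f y = (p y, p y, \<pi>)" "reach x0 \<pi> y" by blast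
  then show ?thesis using f0 reach_nil y(2) by auto
qed

end

section \<open>The chamber system of the graph product\<close>

locale graph_product = chamber_data I edges \<Delta>
  for I :: "'i set" and edges :: "'i set set" and \<Delta> :: "'i \<Rightarrow> 'c set" +
  fixes Ut :: "'u topology" and q :: "'u \<Rightarrow> (('i \<Rightarrow> 'c) \<times> ('i set \<Rightarrow> real)) set"
  assumes universal: "universal_cover Ut (U_space I edges prod_chambers) q"
begin

lemma cov: "covering_map Ut E.realization q"
  and sc: "simply_connected_space Ut"
  using universal by (simp_all add: universal_cover_def U_space_eq)

lemma q_continuous: "continuous_map Ut E.realization q"
  using covering_map_continuous[OF cov] .

abbreviation apex :: "'i set \<Rightarrow> real" where
  "apex \<equiv> davis_vertex {}"

lemma apex_in: "apex \<in> davis"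
  using davis_vertex_chamber[OF spherical_empty] .

lemma mirrors_apex: "mirrors apex = {}"
  using mirror_set_vertex[OF spherical_empty] .

lemma edge_vertex_in: "i \<in> I \<Longrightarrow> davis_vertex {i} \<in> davis"
  and mirrors_edge_vertex: "i \<in> I \<Longrightarrow> mirrors (davis_vertex {i}) = {i}"
  using spherical_pair[of i I i edges] davis_vertex_chamber mirror_set_vertex by fastforce+

lemma edge_vertex_mirror: "i \<in> I \<Longrightarrow> davis_vertex {i} \<in> davis_mirror I edges i"
  using mirrors_edge_vertex by (fastforce simp: mirror_set_def)

lemma mirrors_iff: "k \<in> davis_mirror I edges i \<Longrightarrow> i \<in> I \<Longrightarrow> k \<in> davis \<and> i \<in> mirrors k"
  using davis_mirror_subset by (fastforce simp: mirror_set_def)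

lemma pathin_davis_segment:
  assumes "\<And>t. t \<in> {0..1} \<Longrightarrow> davis_segment k l t \<in> davis"
  shows "pathin (top_of_set davis) (davis_segment k l)"
proof -
  have "continuous_on {0..1} (\<lambda>t. davis_segment k l t)"
    by (rule continuous_on_davis_segment) (auto intro!: continuous_intros)
  then show ?thesis using assms by (auto simp: pathin_def)
qed

lemma pathin_cone: "k \<in> davis \<Longrightarrow> pathin (top_of_set davis) (davis_segment apex k)"
  using pathin_davis_segment davis_chamber_cone by blast

text \<open>Sections of \<open>q\<close> over the copy \<open>C\<close> of the Davis chamber, as maps on the Davis chamber.\<close>

definition lifted :: "('i \<Rightarrow> 'c) \<Rightarrow> (('i set \<Rightarrow> real) \<Rightarrow> 'u) \<Rightarrow> bool" where
  "lifted C s \<longleftrightarrow> continuous_map (top_of_set davis) Ut s \<and> (\<forall>k\<in>davis. q (s k) = E.pt C k)"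

lemma pathin_lifted: "lifted C s \<Longrightarrow> pathin (top_of_set davis) g \<Longrightarrow> pathin Ut (\<lambda>t. s (g t))"
  using continuous_map_compose[of unit_interval "top_of_set davis" g Ut s]
  by (simp add: lifted_def pathin_def o_def)

lemma pathin_in: "pathin X g \<Longrightarrow> t \<in> {0..1} \<Longrightarrow> g t \<in> topspace X"
  using continuous_map_image_subset_topspace[of unit_interval X g] by (auto simp: pathin_def)

text \<open>Sections over a copy of the Davis chamber are determined by one value because the chamber is
  a cone, hence connected by paths.\<close>

lemma lifted_unique:
  assumes s: "lifted C s" "lifted C s'" and k: "k \<in> davis" "s k = s' k" and l: "l \<in> davis"
  shows "s l = s' l"
proof -
  have eq: "s (davis_segment apex m a) = s' (davis_segment apex m a)"
    if m: "m \<in> davis" and a: "a \<in> {0..1}" and b: "b \<in> {0..1}"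
      and e: "s (davis_segment apex m b) = s' (davis_segment apex m b)" for m a b
    by (rule path_lift_unique[OF cov pathin_lifted[OF s(1) pathin_cone[OF m]] pathin_lifted[OF s(2) pathin_cone[OF m]] _ b e a])
      (use s davis_chamber_cone[OF m] in \<open>simp add: lifted_def\<close>)
  have "s apex = s' apex" using eq[OF k(1), of 0 1] k(2) by simp
  then show ?thesis using eq[OF l, of 1 0] by simp
qed

text \<open>The cone is contracted to its apex, and lifting this homotopy yields a section; it passes
  through \<open>u\<close> if its apex is the end of the lifted path from \<open>u\<close>.\<close>

lemma lifted_ex:
  assumes C: "C \<in> prod_chambers" and u: "u \<in> topspace Ut" and k: "k \<in> davis" "q u = E.pt C k"
  shows "\<exists>s. lifted C s \<and> s k = u"
proof -
  let ?r = "\<lambda>t. E.pt C (davis_segment apex k t)"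
  have r: "pathin E.realization ?r"
    using continuous_map_compose[OF pathin_cone[OF k(1), unfolded pathin_def] E.continuous_map_pt[OF C]]
    by (simp add: pathin_def o_def)
  have "pathin E.realization (\<lambda>t. ?r (1 - t))"
    by (rule pathin_reparam[OF r, where r = "\<lambda>t. 1 - t"]) (auto intro!: continuous_intros)
  from covering_path_lift[OF cov this u] k(2)
  obtain \<kappa> where \<kappa>: "pathin Ut \<kappa>" "\<kappa> 0 = u" "\<forall>t\<in>{0..1}. q (\<kappa> t) = ?r (1 - t)" by auto
  have \<kappa>1: "\<kappa> 1 \<in> topspace Ut" "q (\<kappa> 1) = E.pt C apex"
    using pathin_in[OF \<kappa>(1), of 1] \<kappa>(3) by auto
  let ?Z = "top_of_set davis"
  let ?h = "\<lambda>w. E.pt C (davis_segment apex (snd w) (fst w))"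
  have "continuous_on ({0..1} \<times> davis) (\<lambda>w. davis_segment apex (snd w) (fst w))"
    by (rule continuous_on_davis_segment[OF continuous_on_const
          continuous_on_snd[OF continuous_on_id] continuous_on_fst[OF continuous_on_id]])
  then have "continuous_map (prod_topology unit_interval ?Z) ?Z (\<lambda>w. davis_segment apex (snd w) (fst w))"
    by (auto intro!: davis_chamber_cone)
  from continuous_map_compose[OF this E.continuous_map_pt[OF C]]
  have h: "continuous_map (prod_topology unit_interval ?Z) E.realization ?h"
    unfolding o_def .
  have "continuous_map ?Z Ut (\<lambda>_. \<kappa> 1)" using \<kappa>1 by (simp add: continuous_map_const)
  from covering_homotopy_lift[OF cov h this] \<kappa>1(2)
  obtain G where G: "continuous_map (prod_topology unit_interval ?Z) Ut G"
    "\<forall>t\<in>{0..1}. \<forall>l\<in>davis. q (G (t, l)) = ?h (t, l)" "\<forall>l\<in>davis. G (0, l) = \<kappa> 1"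
    by auto
  have slice: "continuous_map ?Z Ut (\<lambda>l. G (1, l))" "pathin Ut (\<lambda>t. G (t, k))"
    unfolding pathin_def
    by (rule continuous_map_compose[OF _ G(1), unfolded o_def];
        use k in \<open>auto intro!: continuous_map_pairedI simp: continuous_map_const simp del: prod_topology_subtopology_eu\<close>)+
  have "lifted C (\<lambda>l. G (1, l))"
    unfolding lifted_def using slice(1) G(2) by auto
  moreover have "G (1, k) = \<kappa> (1 - 1)"
  proof (rule path_lift_unique[OF cov slice(2), where g = "\<lambda>t. \<kappa> (1 - t)" and s = 0])
    show "pathin Ut (\<lambda>t. \<kappa> (1 - t))"
      by (rule pathin_reparam[OF \<kappa>(1), where r = "\<lambda>t. 1 - t"]) (auto intro!: continuous_intros)
    show "q (G (t, k)) = q (\<kappa> (1 - t))" if "t \<in> {0..1}" for t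
      using G(2) \<kappa>(3) that k by auto
  qed (use G(3) k in auto)
  ultimately show ?thesis using \<kappa>(2) by auto
qed

text \<open>Points are only identified with points at the same position in the Davis chamber; this
  position gives a continuous left inverse on each copy.\<close>

definition kpt :: "(('i \<Rightarrow> 'c) \<times> ('i set \<Rightarrow> real)) set \<Rightarrow> 'i set \<Rightarrow> real" where
  "kpt c = snd (SOME w. w \<in> c)"

lemma kpt:
  assumes "C \<in> prod_chambers" "k \<in> davis"
  shows "kpt (E.pt C k) = k"
proof -
  have "(C, k) \<in> E.pt C k"
    using assms E.near_refl clique_mirrors by (simp add: E.pt_altdef)
  then have "(SOME w. w \<in> E.pt C k) \<in> E.pt C k" by (rule someI)
  then show ?thesis using assms(2) by (auto simp: kpt_def E.pt_altdef)
qed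

lemma kpt_continuous: "continuous_map E.realization (top_of_set davis) kpt"
proof (rule E.continuous_map_from_realization)
  fix C assume "C \<in> prod_chambers"
  then show "continuous_map (top_of_set davis) (top_of_set davis) (\<lambda>k. kpt (E.pt C k))"
    by (intro continuous_map_eq[OF continuous_map_id]) (simp add: kpt)
qed

abbreviation chambers :: "'u set set" where
  "chambers \<equiv> gp_chambers I edges prod_chambers Ut q"

abbreviation prj :: "'u set \<Rightarrow> 'i \<Rightarrow> 'c" where
  "prj \<equiv> gp_proj I edges prod_chambers q"

abbreviation copy :: "('i \<Rightarrow> 'c) \<Rightarrow> (('i \<Rightarrow> 'c) \<times> ('i set \<Rightarrow> real)) set set" where
  "copy \<equiv> U_chamber I edges prod_chambers"

abbreviation mirror :: "'i \<Rightarrow> 'u set \<Rightarrow> 'u set" where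
  "mirror \<equiv> gp_mirror I edges prod_chambers q"

abbreviation adjacent :: "'i \<Rightarrow> 'u set \<Rightarrow> 'u set \<Rightarrow> bool" where
  "adjacent \<equiv> gp_adjacent I edges prod_chambers q"

abbreviation automorphisms :: "('u set \<Rightarrow> 'u set) set" where
  "automorphisms \<equiv> gp_aut I edges prod_chambers Ut q"

lemma U_chamber_eq: "copy C = {E.pt C k | k. k \<in> davis}"
  by (simp add: U_chamber_def U_pt_eq)

lemma U_mirror_eq: "U_mirror I edges prod_chambers C i = {E.pt C k | k. k \<in> davis_mirror I edges i}"
  by (simp add: U_mirror_def U_pt_eq)

lemma U_chamber_inj:
  assumes "C \<in> prod_chambers" "D \<in> prod_chambers"
    and "copy C = copy D"
  shows "C = D"
proof -
  have "E.pt C apex \<in> copy D"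
    using assms(3) apex_in by (auto simp: U_chamber_eq)
  then obtain k where "k \<in> davis" "E.pt C apex = E.pt D k" by (auto simp: U_chamber_eq)
  then show ?thesis using E.pt_eq_iff[OF assms(1,2) apex_in, of k] mirrors_apex E.near_empty by simp
qed

lemma U_chamber_subset: "C \<in> prod_chambers \<Longrightarrow> copy C \<subseteq> topspace E.realization"
  using E.pt_in by (auto simp: U_chamber_eq)

lemma lifted_chamber:
  assumes C: "C \<in> prod_chambers" and s: "lifted C s"
  shows "s ` davis \<in> chambers" and "prj (s ` davis) = C"
proof -
  let ?U = "copy C"
  have sUt: "s ` davis \<subseteq> topspace Ut"
    using s continuous_map_image_subset_topspace[of "top_of_set davis" Ut s] by (simp add: lifted_def)
  have qs: "q (s k) = E.pt C k" "kpt (q (s k)) = k" if "k \<in> davis" for k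
    using s kpt[OF C that] that by (simp_all add: lifted_def)
  have top: "topspace (subtopology Ut (s ` davis)) = s ` davis" "topspace (subtopology E.realization ?U) = ?U"
    using sUt U_chamber_subset[OF C] by auto
  have img: "q ` s ` davis = ?U" using qs(1) by (auto simp: U_chamber_eq image_image)
  have "homeomorphic_maps (subtopology Ut (s ` davis)) (subtopology E.realization ?U) q (\<lambda>c. s (kpt c))"
    unfolding homeomorphic_maps_def
  proof (intro conjI ballI)
    show "continuous_map (subtopology Ut (s ` davis)) (subtopology E.realization ?U) q"
      unfolding continuous_map_in_subtopology
      using continuous_map_from_subtopology[OF q_continuous, of "s ` davis"] img by (auto simp: top)
    have "continuous_map (top_of_set davis) Ut s" using s by (simp add: lifted_def)
    from continuous_map_compose[OF kpt_continuous this]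
    have "continuous_map E.realization Ut (\<lambda>c. s (kpt c))" by (simp add: o_def)
    then show "continuous_map (subtopology E.realization ?U) (subtopology Ut (s ` davis)) (\<lambda>c. s (kpt c))"
      unfolding continuous_map_in_subtopology
      using continuous_map_from_subtopology kpt[OF C] by (auto simp: top U_chamber_eq)
    show "s (kpt (q u)) = u" if "u \<in> topspace (subtopology Ut (s ` davis))" for u
      using that qs unfolding top by auto
    show "q (s (kpt c)) = c" if "c \<in> topspace (subtopology E.realization ?U)" for c
      using that qs kpt[OF C] unfolding top U_chamber_eq by auto
  qed
  then have "homeomorphic_map (subtopology Ut (s ` davis)) (subtopology E.realization ?U) q"
    using homeomorphic_map_maps by blast
  then show "s ` davis \<in> chambers"
    unfolding gp_chambers_def U_space_eq using sUt C by blast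
  show "prj (s ` davis) = C"
    unfolding gp_proj_def img using C U_chamber_inj by (intro the_equality) auto
qed

lemma chamber_lifted:
  assumes A: "A \<in> chambers"
  shows "\<exists>s. lifted (prj A) s \<and> s ` davis = A \<and> prj A \<in> prod_chambers"
proof -
  obtain C where C: "C \<in> prod_chambers" and AU: "A \<subseteq> topspace Ut"
    and hom: "homeomorphic_map (subtopology Ut A) (subtopology E.realization (copy C)) q"
    using A unfolding gp_chambers_def U_space_eq by blast
  let ?U = "copy C"
  obtain g where g: "homeomorphic_maps (subtopology Ut A) (subtopology E.realization ?U) q g"
    using hom homeomorphic_map_maps by blast
  have top: "topspace (subtopology Ut A) = A" "topspace (subtopology E.realization ?U) = ?U"
    using AU U_chamber_subset[OF C] by auto
  have g': "continuous_map (subtopology E.realization ?U) (subtopology Ut A) g"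
    "\<forall>u\<in>A. g (q u) = u" "\<forall>c\<in>?U. q (g c) = c"
    "q ` A \<subseteq> ?U" "g ` ?U \<subseteq> A"
    using g continuous_map_image_subset_topspace unfolding homeomorphic_maps_def top
    by (blast, blast, blast, (metis top)+)
  let ?s = "\<lambda>k. g (E.pt C k)"
  have "continuous_map (top_of_set davis) (subtopology E.realization ?U) (E.pt C)"
    unfolding continuous_map_in_subtopology using E.continuous_map_pt[OF C] by (auto simp: U_chamber_eq)
  from continuous_map_compose[OF this g'(1)] have "continuous_map (top_of_set davis) Ut ?s"
    by (simp add: o_def continuous_map_in_subtopology)
  then have s: "lifted C ?s" using g'(3) by (auto simp: lifted_def U_chamber_eq)
  have "?s ` davis = g ` ?U" by (auto simp: U_chamber_eq)
  also have "\<dots> = A"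
  proof
    show "A \<subseteq> g ` ?U"
    proof
      fix u assume "u \<in> A"
      then have "q u \<in> ?U" "u = g (q u)" using g'(2,4) by auto
      then show "u \<in> g ` ?U" by blast
    qed
  qed (rule g'(5))
  finally have "?s ` davis = A" .
  then show ?thesis using s lifted_chamber[OF C s] C by auto
qed

text \<open>A chamber \<open>A\<close> as a copy of the Davis chamber, parametrized by the inverse of \<open>q\<close>.\<close>

definition pnt :: "'u set \<Rightarrow> ('i set \<Rightarrow> real) \<Rightarrow> 'u" where
  "pnt A = (SOME s. lifted (prj A) s \<and> s ` davis = A)"

lemma pnt:
  assumes "A \<in> chambers"
  shows "lifted (prj A) (pnt A)" "pnt A ` davis = A"
proof -
  have "\<exists>s. lifted (prj A) s \<and> s ` davis = A" using chamber_lifted[OF assms] by blast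
  from someI_ex[OF this] show "lifted (prj A) (pnt A)" "pnt A ` davis = A" by (simp_all add: pnt_def)
qed

lemma prj_in: "A \<in> chambers \<Longrightarrow> prj A \<in> prod_chambers"
  using chamber_lifted by blast

lemma q_pnt: "A \<in> chambers \<Longrightarrow> k \<in> davis \<Longrightarrow> q (pnt A k) = E.pt (prj A) k"
  using pnt(1) by (simp add: lifted_def)

lemma pnt_in: "A \<in> chambers \<Longrightarrow> k \<in> davis \<Longrightarrow> pnt A k \<in> topspace Ut"
  using pnt(1) continuous_map_image_subset_topspace[of "top_of_set davis" Ut "pnt A"] by (auto simp: lifted_def)

lemma chamber_eqI:
  assumes "A \<in> chambers" "B \<in> chambers" "prj A = prj B" "k \<in> davis" "pnt A k = pnt B k"
  shows "A = B"
proof -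
  have "lifted (prj A) (pnt B)" using pnt(1)[OF assms(2)] assms(3) by simp
  from lifted_unique[OF pnt(1)[OF assms(1)] this assms(4,5)]
  have "pnt A l = pnt B l" if "l \<in> davis" for l using that .
  then have "pnt A ` davis = pnt B ` davis" by auto
  then show ?thesis using pnt(2) assms(1,2) by simp
qed

lemma chamber_ex:
  assumes C: "C \<in> prod_chambers" and u: "u \<in> topspace Ut" and k: "k \<in> davis" "q u = E.pt C k"
  shows "\<exists>A\<in>chambers. prj A = C \<and> pnt A k = u"
proof -
  obtain s where s: "lifted C s" "s k = u" using lifted_ex[OF assms] by blast
  let ?A = "s ` davis"
  note A = lifted_chamber[OF C s(1)]
  have "u \<in> pnt ?A ` davis" using pnt(2)[OF A(1)] s(2) k(1) by auto
  then obtain l where l: "l \<in> davis" "u = pnt ?A l" by blast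
  then have "E.pt C k = E.pt C l" using q_pnt[OF A(1) l(1)] A(2) k(2) by simp
  then have "l = k" using E.pt_eq_iff[OF C C k(1) l(1)] by simp
  then show ?thesis using A l by blast
qed

text \<open>Two \<open>i\<close>-adjacent chambers share the cone point of their \<open>i\<close>-mirrors, and only those coordinates
  differ whose mirrors contain this point, that is, the \<open>i\<close>-th.\<close>

definition gop :: "'i \<Rightarrow> 'c \<Rightarrow> 'u set \<Rightarrow> 'u set" where
  "gop i c A = (THE B. B \<in> chambers \<and> prj B = (prj A)(i := c) \<and>
     pnt B (davis_vertex {i}) = pnt A (davis_vertex {i}))"

lemma gop_ex1:
  assumes A: "A \<in> chambers" and i: "i \<in> I" "c \<in> \<Delta> i"
  shows "\<exists>!B. B \<in> chambers \<and> prj B = (prj A)(i := c) \<and> pnt B (davis_vertex {i}) = pnt A (davis_vertex {i})"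
proof -
  let ?v = "davis_vertex {i}"
  have C: "(prj A)(i := c) \<in> prod_chambers" using E.op_in[OF prj_in[OF A] i] .
  have v: "?v \<in> davis" using edge_vertex_in[OF i(1)] .
  have "E.near (mirrors ?v) (prj A) ((prj A)(i := c))"
    using E.near_op[OF prj_in[OF A] clique_mirrors[OF v], of i c] i mirrors_edge_vertex by simp
  then have "q (pnt A ?v) = E.pt ((prj A)(i := c)) ?v"
    using q_pnt[OF A v] E.pt_eq_iff[OF prj_in[OF A] C v v] by simp
  then obtain B where "B \<in> chambers" "prj B = (prj A)(i := c)" "pnt B ?v = pnt A ?v"
    using chamber_ex[OF C pnt_in[OF A v] v] by blast
  then show ?thesis using chamber_eqI[OF _ _ _ v] by (intro ex1I[of _ B]) auto
qed

lemma gop: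
  assumes "A \<in> chambers" "i \<in> I" "c \<in> \<Delta> i"
  shows "gop i c A \<in> chambers" "prj (gop i c A) = (prj A)(i := c)"
    "pnt (gop i c A) (davis_vertex {i}) = pnt A (davis_vertex {i})"
  using theI'[OF gop_ex1[OF assms]] by (simp_all add: gop_def)

lemma gop_eqI:
  assumes "A \<in> chambers" "i \<in> I" "c \<in> \<Delta> i"
    and "B \<in> chambers" "prj B = (prj A)(i := c)" "pnt B (davis_vertex {i}) = pnt A (davis_vertex {i})"
  shows "B = gop i c A"
  using gop_ex1[OF assms(1-3)] gop[OF assms(1-3)] assms(4-) by blast

text \<open>An \<open>i\<close>-mirror is a cone, and lifts of its paths are unique, so chambers sharing the cone point
  share the whole mirror.\<close>

lemma gop_mirror:
  assumes A: "A \<in> chambers" and i: "i \<in> I" "c \<in> \<Delta> i" and k: "k \<in> davis_mirror I edges i"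
  shows "pnt (gop i c A) k = pnt A k"
proof -
  let ?B = "gop i c A" and ?g = "davis_segment (davis_vertex {i}) k"
  note B = gop[OF A i]
  have g: "?g t \<in> davis_mirror I edges i" if "t \<in> {0..1}" for t
    using davis_mirror_cone[OF i(1) k that] .
  then have path: "pathin (top_of_set davis) ?g"
    using pathin_davis_segment mirrors_iff i(1) by blast
  have "q (pnt ?B (?g t)) = q (pnt A (?g t))" if "t \<in> {0..1}" for t
  proof -
    have t: "?g t \<in> davis" "i \<in> mirrors (?g t)" using mirrors_iff[OF g[OF that] i(1)] by auto
    have "E.near (mirrors (?g t)) (prj A) (prj ?B)"
      using E.near_op[OF prj_in[OF A] clique_mirrors[OF t(1)] t(2) i(2)] B(2) by simp
    then show ?thesis
      using q_pnt[OF A t(1)] q_pnt[OF B(1) t(1)] E.pt_eq_iff[OF prj_in[OF A] prj_in[OF B(1)] t(1) t(1)] by simp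
  qed
  from path_lift_unique[OF cov pathin_lifted[OF pnt(1)[OF B(1)] path] pathin_lifted[OF pnt(1)[OF A] path] this, of 0 1]
  show ?thesis using B(3) by simp
qed

lemma chambers_nonempty: "chambers \<noteq> {}"
proof -
  obtain C where C: "C \<in> prod_chambers" using E.F_nonempty by blast
  have "E.pt C apex \<in> topspace E.realization" using E.pt_in[OF C apex_in] .
  also have "topspace E.realization = q ` topspace Ut"
    using cov[unfolded covering_map_def, THEN conjunct2, THEN conjunct1] by simp
  finally obtain u where "u \<in> topspace Ut" "q u = E.pt C apex" by force
  then show ?thesis using chamber_ex[OF C _ apex_in] by blast
qed

end

sublocale graph_product \<subseteq> X: chamber_system I edges \<Delta> chambers prj gop
proof
  show "chambers \<noteq> {}" by (rule chambers_nonempty)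
  fix A i j c d assume A: "A \<in> chambers"
  show "prj A \<in> prod_chambers" by (rule prj_in[OF A])
  show "gop i c A \<in> chambers" "prj (gop i c A) = (prj A)(i := c)" if "i \<in> I" "c \<in> \<Delta> i"
    using gop[OF A that] by auto
  show "gop i (prj A i) A = A" if i: "i \<in> I"
    by (rule gop_eqI[symmetric]) (use A i prj_in[OF A] in auto)
  show "gop i d (gop i c A) = gop i d A" if i: "i \<in> I" "c \<in> \<Delta> i" "d \<in> \<Delta> i"
    using gop[OF A i(1,2)] gop[OF gop(1)[OF A i(1,2)] i(1,3)]
    by (intro gop_eqI A i) auto
  show "gop i c (gop j d A) = gop j d (gop i c A)" if e: "{i, j} \<in> edges" and cd: "c \<in> \<Delta> i" "d \<in> \<Delta> j"
  proof -
    note ij = edge_in[OF e]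
    let ?v = "davis_vertex {i, j}"
    have v: "?v \<in> davis" "?v \<in> davis_mirror I edges i" "?v \<in> davis_mirror I edges j"
      using spherical_pair[of i I j edges] e ij davis_vertex_chamber[of "{i, j}"] mirror_set_vertex[of "{i, j}" I edges]
      by (auto simp: mirror_set_def)
    have i: "i \<in> I" and j: "j \<in> I" using ij by auto
    note Ai = gop[OF A i cd(1)] and Aj = gop[OF A j cd(2)]
    note Aij = gop[OF Ai(1) j cd(2)] and Aji = gop[OF Aj(1) i cd(1)]
    show ?thesis
    proof (rule chamber_eqI[OF Aji(1) Aij(1) _ v(1)])
      show "prj (gop i c (gop j d A)) = prj (gop j d (gop i c A))"
        using Ai(2) Aj(2) Aij(2) Aji(2) edge_neq[OF e] by (simp add: fun_upd_twist)
      show "pnt (gop i c (gop j d A)) ?v = pnt (gop j d (gop i c A)) ?v"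
        using gop_mirror[OF Aj(1) i cd(1) v(2)] gop_mirror[OF A j cd(2) v(3)]
          gop_mirror[OF Ai(1) j cd(2) v(3)] gop_mirror[OF A i cd(1) v(2)] by simp
    qed
  qed
qed

section \<open>Universality of the graph product\<close>

context graph_product
begin

text \<open>
  As \<open>Ut\<close> is simply connected, its projection lifts to the covering given by the realization of any
  chamber system, and the lift maps copies of the Davis chamber to copies of the Davis chamber. So
  every chamber system receives a morphism from the graph product with a prescribed value.
\<close>

lemma lift_to_system:
  fixes F :: "'x set" and p :: "'x \<Rightarrow> 'i \<Rightarrow> 'c" and op :: "'i \<Rightarrow> 'c \<Rightarrow> 'x \<Rightarrow> 'x"
  assumes S: "chamber_system I edges \<Delta> F p op"
    and A0: "A0 \<in> chambers" and x0: "x0 \<in> F" "p x0 = prj A0"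
  shows "\<exists>\<Lambda> f. f A0 = x0 \<and> (\<forall>g. pathin Ut g \<longrightarrow> pathin (chamber_system.realization I edges F p op) (\<lambda>t. \<Lambda> (g t)))
    \<and> (\<forall>u\<in>topspace Ut. chamber_system.proj_pt p (\<Lambda> u) = q u)
    \<and> (\<forall>A\<in>chambers. f A \<in> F \<and> p (f A) = prj A \<and>
          (\<forall>k\<in>davis. \<Lambda> (pnt A k) = chamber_system.pt I edges F p op (f A) k))"
proof -
  interpret S: chamber_system I edges \<Delta> F p op by fact
  let ?u0 = "pnt A0 apex" and ?z0 = "S.pt x0 apex"
  have z0: "S.proj_pt ?z0 = q ?u0"
    using S.proj_pt[OF x0(1) apex_in] x0(2) q_pnt[OF A0 apex_in] by simp
  from simply_connected_lift[OF sc q_continuous S.covering_map_proj_pt pnt_in[OF A0 apex_in] S.pt_in[OF x0(1) apex_in] z0]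
  obtain \<Lambda> where \<Lambda>: "\<Lambda> ?u0 = ?z0" "\<forall>g. pathin Ut g \<longrightarrow> pathin S.realization (\<lambda>t. \<Lambda> (g t))"
    "\<forall>u\<in>topspace Ut. S.proj_pt (\<Lambda> u) = q u" by blast
  have \<Lambda>in: "\<Lambda> u \<in> topspace S.realization" if "u \<in> topspace Ut" for u
  proof -
    have "pathin Ut (\<lambda>_. u)" using that by (simp add: pathin_def continuous_map_const)
    then have "pathin S.realization (\<lambda>_. \<Lambda> u)" using \<Lambda>(2) by blast
    from pathin_in[OF this, of 0] show ?thesis by simp
  qed
  define f where "f A = (SOME x. x \<in> F \<and> p x = prj A \<and> \<Lambda> (pnt A apex) = S.pt x apex)" for A
  have f: "f A \<in> F \<and> p (f A) = prj A \<and> \<Lambda> (pnt A apex) = S.pt (f A) apex" if A: "A \<in> chambers" for A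
  proof -
    obtain x k where x: "x \<in> F" "k \<in> davis" "\<Lambda> (pnt A apex) = S.pt x k"
      using S.realization_cases[OF \<Lambda>in[OF pnt_in[OF A apex_in]]] .
    have "E.pt (p x) k = S.proj_pt (\<Lambda> (pnt A apex))"
      unfolding x(3) by (rule S.proj_pt[OF x(1,2), symmetric])
    also have "\<dots> = E.pt (prj A) apex"
      using \<Lambda>(3) pnt_in[OF A apex_in] q_pnt[OF A apex_in] by simp
    finally have "E.pt (p x) k = E.pt (prj A) apex" .
    then have "k = apex" "E.near {} (p x) (prj A)"
      using E.pt_eq_iff[OF S.p_in[OF x(1)] prj_in[OF A] x(2) apex_in] mirrors_apex by auto
    then have "x \<in> F \<and> p x = prj A \<and> \<Lambda> (pnt A apex) = S.pt x apex" using x E.near_empty by simp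
    then show ?thesis unfolding f_def by (rule someI)
  qed
  have "S.pt (f A0) apex = S.pt x0 apex" using f[OF A0] \<Lambda>(1) by simp
  then have f0: "f A0 = x0"
    using S.pt_eq_iff[OF _ x0(1) apex_in apex_in, of "f A0"] f[OF A0] mirrors_apex S.near_empty by simp
  have "\<Lambda> (pnt A k) = S.pt (f A) k" if A: "A \<in> chambers" and k: "k \<in> davis" for A k
  proof -
    note fA = f[OF A]
    let ?g = "davis_segment apex k"
    have p1: "pathin S.realization (\<lambda>t. S.pt (f A) (?g t))"
      using continuous_map_compose[OF pathin_cone[OF k, unfolded pathin_def] S.continuous_map_pt, of "f A"] fA
      by (simp add: pathin_def o_def)
    have p2: "pathin S.realization (\<lambda>t. \<Lambda> (pnt A (?g t)))"
      using \<Lambda>(2) pathin_lifted[OF pnt(1)[OF A] pathin_cone[OF k]] by blast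
    have "S.proj_pt (\<Lambda> (pnt A (?g t))) = S.proj_pt (S.pt (f A) (?g t))" if t: "t \<in> {0..1}" for t
      using \<Lambda>(3) pnt_in[OF A] q_pnt[OF A] S.proj_pt fA davis_chamber_cone[OF k t] by simp
    from path_lift_unique[OF S.covering_map_proj_pt p2 p1 this, of 0 1]
    show ?thesis using fA by simp
  qed
  then show ?thesis using f f0 \<Lambda>(2,3) by (intro exI[of _ \<Lambda>] exI[of _ f]) auto
qed

theorem universality:
  fixes F :: "'x set" and p :: "'x \<Rightarrow> 'i \<Rightarrow> 'c" and op :: "'i \<Rightarrow> 'c \<Rightarrow> 'x \<Rightarrow> 'x"
  assumes S: "chamber_system I edges \<Delta> F p op"
    and A0: "A0 \<in> chambers" and x0: "x0 \<in> F" "p x0 = prj A0"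
  shows "\<exists>f. f A0 = x0 \<and> (\<forall>A\<in>chambers. f A \<in> F \<and> p (f A) = prj A) \<and>
    (\<forall>A\<in>chambers. \<forall>i\<in>I. \<forall>c\<in>\<Delta> i. f (gop i c A) = op i c (f A))"
proof -
  interpret S: chamber_system I edges \<Delta> F p op by fact
  obtain \<Lambda> f where f0: "f A0 = x0"
    and f: "\<forall>A\<in>chambers. f A \<in> F \<and> p (f A) = prj A \<and> (\<forall>k\<in>davis. \<Lambda> (pnt A k) = S.pt (f A) k)"
    using lift_to_system[OF assms] by blast
  have "f (gop i c A) = op i c (f A)" if A: "A \<in> chambers" and i: "i \<in> I" "c \<in> \<Delta> i" for A i c
  proof -
    let ?B = "gop i c A" and ?v = "davis_vertex {i}"
    note B = gop[OF A i] and v = edge_vertex_in[OF i(1)]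
    have cl: "clique {i}" using i by (simp add: clique_def)
    have F: "f A \<in> F" "f ?B \<in> F" using f A B(1) by auto
    have "S.pt (f A) ?v = S.pt (f ?B) ?v" using f A B v by metis
    then have "S.near {i} (f A) (f ?B)"
      using S.pt_eq_iff[OF F v v] mirrors_edge_vertex[OF i(1)] by simp
    moreover have "S.near {i} (f A) (op i c (f A))" using S.near_op[OF F(1) cl] i by simp
    moreover have "p (f ?B) = p (op i c (f A))" using f A B S.p_op[OF F(1) i] by simp
    ultimately show ?thesis using S.near_unique by blast
  qed
  then show ?thesis using f0 f by blast
qed

text \<open>
  The graph product is connected by galleries: a set \<open>X0\<close> of chambers closed under the operations is
  itself a chamber system, and its realization maps back to \<open>Ut\<close>. Going from \<open>Ut\<close> to the realization
  and back lifts \<open>q\<close> and fixes the base point; as \<open>Ut\<close> is path-connected, it is the identity.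
\<close>

theorem chambers_induct:
  assumes X0: "X0 \<subseteq> chambers" "A0 \<in> X0" and closed: "\<And>A i c. \<lbrakk>A \<in> X0; i \<in> I; c \<in> \<Delta> i\<rbrakk> \<Longrightarrow> gop i c A \<in> X0"
  shows "X0 = chambers"
proof
  have A0: "A0 \<in> chambers" using X0 by blast
  interpret S: chamber_system I edges \<Delta> X0 prj gop
  proof
    show "X0 \<noteq> {}" using X0 by blast
    fix A i j c d assume "A \<in> X0"
    then have A: "A \<in> chambers" using X0 by blast
    show "prj A \<in> prod_chambers" by (rule X.p_in[OF A])
    show "gop i c A \<in> X0" if "i \<in> I" "c \<in> \<Delta> i" by (rule closed[OF \<open>A \<in> X0\<close> that])
    show "prj (gop i c A) = (prj A)(i := c)" if "i \<in> I" "c \<in> \<Delta> i" by (rule X.p_op[OF A that])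
    show "gop i (prj A i) A = A" if "i \<in> I" by (rule X.op_self[OF A that])
    show "gop i d (gop i c A) = gop i d A" if "i \<in> I" "c \<in> \<Delta> i" "d \<in> \<Delta> i" by (rule X.op_op[OF A that])
    show "gop i c (gop j d A) = gop j d (gop i c A)" if "{i, j} \<in> edges" "c \<in> \<Delta> i" "d \<in> \<Delta> j"
      by (rule X.op_commute[OF A that])
  qed
  obtain \<Lambda> f where f0: "f A0 = A0"
    and path: "\<forall>g. pathin Ut g \<longrightarrow> pathin S.realization (\<lambda>t. \<Lambda> (g t))"
    and proj: "\<forall>u\<in>topspace Ut. S.proj_pt (\<Lambda> u) = q u"
    and f: "\<forall>A\<in>chambers. f A \<in> X0 \<and> prj (f A) = prj A \<and> (\<forall>k\<in>davis. \<Lambda> (pnt A k) = S.pt (f A) k)"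
    using lift_to_system[OF S.chamber_system_axioms A0 X0(2) HOL.refl] by blast
  define \<Theta> where "\<Theta> c = (let w = (SOME w. w \<in> c) in pnt (fst w) (snd w))"
    for c :: "('u set \<times> ('i set \<Rightarrow> real)) set"
  have \<Theta>: "\<Theta> (S.pt A k) = pnt A k" if A: "A \<in> X0" and k: "k \<in> davis" for A k
  proof -
    note cl = clique_mirrors[OF k]
    have "(A, k) \<in> S.pt A k" using S.near_refl[OF cl A] k by (simp add: S.pt_altdef)
    then have "(SOME w. w \<in> S.pt A k) \<in> S.pt A k" by (rule someI)
    then obtain B where B: "(SOME w. w \<in> S.pt A k) = (B, k)" "S.near (mirrors k) A B"
      unfolding S.pt_altdef[OF k] by auto
    have "pnt B k = pnt A k"
    proof (rule S.near_induct[OF B(2) cl, where Q = "\<lambda>B. pnt B k = pnt A k"])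
      fix B i c assume "B \<in> X0" "i \<in> mirrors k" "c \<in> \<Delta> i" "pnt B k = pnt A k"
      moreover from this have "B \<in> chambers" "i \<in> I" "k \<in> davis_mirror I edges i"
        using X0 by (auto simp: mirror_set_def)
      ultimately show "pnt (gop i c B) k = pnt A k" using gop_mirror by simp
    qed simp
    then show ?thesis using B(1) by (simp add: \<Theta>_def)
  qed
  have \<Theta>cont: "continuous_map S.realization Ut \<Theta>"
  proof (rule S.continuous_map_from_realization)
    fix A assume A: "A \<in> X0"
    then have "continuous_map (top_of_set davis) Ut (pnt A)" using pnt(1) X0 by (auto simp: lifted_def)
    then show "continuous_map (top_of_set davis) Ut (\<lambda>k. \<Theta> (S.pt A k))"
      by (rule continuous_map_eq) (simp add: \<Theta>[OF A])
  qed
  have q\<Theta>: "q (\<Theta> c) = S.proj_pt c" if c: "c \<in> topspace S.realization" for c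
  proof -
    obtain A k where "A \<in> X0" "k \<in> davis" "c = S.pt A k" using S.realization_cases[OF c] .
    then show ?thesis using \<Theta> q_pnt S.proj_pt X0 by auto
  qed
  show "chambers \<subseteq> X0"
  proof
    fix B assume B: "B \<in> chambers"
    obtain g where g: "pathin Ut g" "g 0 = pnt A0 apex" "g 1 = pnt B apex"
      using simply_connected_space_path[OF sc pnt_in[OF A0 apex_in] pnt_in[OF B apex_in]] by blast
    have \<Lambda>g: "pathin S.realization (\<lambda>t. \<Lambda> (g t))" using path g(1) by blast
    have p1: "pathin Ut (\<lambda>t. \<Theta> (\<Lambda> (g t)))"
      using continuous_map_compose[OF \<Lambda>g[unfolded pathin_def] \<Theta>cont] by (simp add: pathin_def o_def)
    have p2: "q (\<Theta> (\<Lambda> (g t))) = q (g t)" if "t \<in> {0..1}" for t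
      using q\<Theta>[OF pathin_in[OF \<Lambda>g that]] proj pathin_in[OF g(1) that] by simp
    have "\<Theta> (\<Lambda> (g 0)) = g 0"
      using f A0 apex_in f0 \<Theta>[OF X0(2) apex_in] g(2) by simp
    with path_lift_unique[OF cov p1 g(1) p2, of 0 1] have "\<Theta> (\<Lambda> (g 1)) = g 1" by simp
    then have "pnt (f B) apex = pnt B apex" using f B apex_in \<Theta> g(3) by simp
    then have "f B = B" using chamber_eqI[OF _ B _ apex_in, of "f B"] f B X0 by blast
    then show "B \<in> X0" using f B by metis
  qed
qed (rule X0(1))

lemma gallery_ex:
  assumes "A0 \<in> chambers" "A \<in> chambers"
  shows "\<exists>n. X.gallery A0 n A"
proof -
  let ?X0 = "{A \<in> chambers. \<exists>n. X.gallery A0 n A}"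
  have "?X0 = chambers"
  proof (rule chambers_induct)
    show "A0 \<in> ?X0" using assms(1) X.gallery.intros(1) by blast
    fix A i c assume "A \<in> ?X0" "i \<in> I" "c \<in> \<Delta> i"
    then show "gop i c A \<in> ?X0" using X.op_in X.gallery.intros(2) by blast
  qed auto
  then show ?thesis using assms(2) by blast
qed

text \<open>The target is the system of pilings based at \<open>A\<close>, truncated at the length of a gallery from \<open>A\<close>
  to \<open>B\<close>.\<close>

theorem finite_separation:
  assumes "A \<in> chambers" "B \<in> chambers" "B \<noteq> A"
  shows "\<exists>F op (f :: 'u set \<Rightarrow> ('i \<Rightarrow> 'c) \<times> ('i \<Rightarrow> 'c) \<times> ('i \<Rightarrow> 'c option list)). finite F \<and>
    (\<forall>A\<in>chambers. f A \<in> F) \<and> (\<forall>A\<in>chambers. \<forall>i\<in>I. \<forall>c\<in>\<Delta> i. f (gop i c A) = op i c (f A)) \<and> f B \<noteq> f A"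
proof -
  obtain n where n: "X.gallery A n B" using gallery_ex[OF assms(1,2)] by blast
  let ?F = "prod_chambers \<times> X.states A n" and ?z = "(prj A, prj A, \<lambda>_. [])"
  have fin: "finite ?F" 
    by (rule finite_cartesian_product[OF finite_PiE[OF finite_I finite_\<Delta>] X.finite_states[OF assms(1)]])
  have "(prj A, \<lambda>_. []) \<in> X.states A n"
    using X.reach.start[of A] unfolding X.states_def by (fastforce simp: beads_def)
  then have "?z \<in> ?F" "fst ?z = prj A" using prj_in[OF assms(1)] by auto
  from universality[OF X.trunc_system[OF assms(1)] assms(1) this]
  obtain f where f: "f A = ?z" "\<forall>A\<in>chambers. f A \<in> ?F \<and> fst (f A) = prj A"
    "\<forall>A\<in>chambers. \<forall>i\<in>I. \<forall>c\<in>\<Delta> i. f (gop i c A) = X.trunc_op n i c (f A)" by blast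
  have "f B \<noteq> f A"
    by (rule X.truncation_separates[OF assms(1) n assms(3), where f = f]) (use f(1,3) in blast)+
  then show ?thesis using fin f(2,3) by blast
qed

lemma gp_mirror_eq:
  assumes A: "A \<in> chambers"
  shows "mirror i A = pnt A ` davis_mirror I edges i"
proof (intro equalityI subsetI)
  fix a assume "a \<in> mirror i A"
  then have a: "a \<in> A" "q a \<in> U_mirror I edges prod_chambers (prj A) i" by (auto simp: gp_mirror_def)
  then obtain k where k: "k \<in> davis" "a = pnt A k" using pnt(2)[OF A] by blast
  obtain l where l: "l \<in> davis_mirror I edges i" "q a = E.pt (prj A) l" using a(2) by (auto simp: U_mirror_eq)
  then have "k = l"
    using k q_pnt[OF A k(1)] E.pt_eq_iff[OF prj_in[OF A] prj_in[OF A] k(1), of l] davis_mirror_subset by fastforce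
  then show "a \<in> pnt A ` davis_mirror I edges i" using k l by blast
next
  fix a assume "a \<in> pnt A ` davis_mirror I edges i"
  then obtain k where k: "k \<in> davis_mirror I edges i" "a = pnt A k" by blast
  have "k \<in> davis" by (rule subsetD[OF davis_mirror_subset k(1)])
  then show "a \<in> mirror i A"
    using k q_pnt[OF A] pnt(2)[OF A] by (auto simp: gp_mirror_def U_mirror_eq)
qed

text \<open>A common \<open>i\<close>-mirror contains the cone point, whose only mirror is the \<open>i\<close>-th; so the coordinates
  other than the \<open>i\<close>-th agree.\<close>

lemma gp_mirror_eq_iff:
  assumes A: "A \<in> chambers" and B: "B \<in> chambers" and i: "i \<in> I"
  shows "mirror i A = mirror i B
    \<longleftrightarrow> (\<exists>c\<in>\<Delta> i. B = gop i c A)"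
proof
  assume eq: "mirror i A = mirror i B"
  let ?v = "davis_vertex {i}"
  note v = edge_vertex_in[OF i]
  have "pnt A ?v \<in> pnt B ` davis_mirror I edges i"
    using eq gp_mirror_eq[OF A] gp_mirror_eq[OF B] edge_vertex_mirror[OF i] by blast
  then obtain k where "k \<in> davis_mirror I edges i" "pnt A ?v = pnt B k" by auto
  then have k: "k \<in> davis" "pnt A ?v = pnt B k" using mirrors_iff i by auto
  then have "E.pt (prj A) ?v = E.pt (prj B) k" using q_pnt[OF A v] q_pnt[OF B k(1)] by simp
  then have kv: "?v = k" and near: "E.near {i} (prj A) (prj B)"
    using E.pt_eq_iff[OF prj_in[OF A] prj_in[OF B] v k(1)] mirrors_edge_vertex[OF i] by auto
  have cl: "clique {i}" using i by (simp add: clique_def)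
  have c: "prj B i \<in> \<Delta> i" using X.p_coord[OF B i] .
  have "prj B = (prj A)(i := prj B i)"
    using E.near_p[OF near cl] by (auto simp: fun_eq_iff)
  then have "B = gop i (prj B i) A" using gop_eqI[OF A i c B] k(2) kv by simp
  then show "\<exists>c\<in>\<Delta> i. B = gop i c A" using c by blast
next
  assume "\<exists>c\<in>\<Delta> i. B = gop i c A"
  then obtain c where c: "c \<in> \<Delta> i" "B = gop i c A" by blast
  have "pnt A ` davis_mirror I edges i = pnt B ` davis_mirror I edges i"
    using gop_mirror[OF A i c(1)] c(2) by simp
  then show "mirror i A = mirror i B"
    using gp_mirror_eq[OF A] gp_mirror_eq[OF B] by simp
qed

end

section \<open>Groups of lifts\<close>

text \<open>The kernel of an action on a finite set has finite index: a coset is determined by the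
  permutation it induces.\<close>

lemma finite_action_separates:
  assumes G: "group G" and fin: "finite T"
    and act: "\<And>x t. \<lbrakk>x \<in> carrier G; t \<in> T\<rbrakk> \<Longrightarrow> act x t \<in> T"
    and mult: "\<And>x y t. \<lbrakk>x \<in> carrier G; y \<in> carrier G; t \<in> T\<rbrakk> \<Longrightarrow> act (x \<otimes>\<^bsub>G\<^esub> y) t = act y (act x t)"
    and one: "\<And>t. t \<in> T \<Longrightarrow> act \<one>\<^bsub>G\<^esub> t = t"
    and g: "t \<in> T" "act g t \<noteq> t"
  shows "\<exists>N. N \<lhd> G \<and> finite (carrier (G Mod N)) \<and> g \<notin> N"
proof -
  interpret group G by fact
  let ?N = "{n \<in> carrier G. \<forall>t\<in>T. act n t = t}"
  have cancel: "act (inv\<^bsub>G\<^esub> x) (act x t) = t" if "x \<in> carrier G" "t \<in> T" for x t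
    using mult[of x "inv\<^bsub>G\<^esub> x" t] one that by simp
  have cancel': "act x (act (inv\<^bsub>G\<^esub> x) t) = t" if "x \<in> carrier G" "t \<in> T" for x t
    using cancel[of "inv\<^bsub>G\<^esub> x" t] that by simp
  have sub: "subgroup ?N G"
  proof (rule subgroupI)
    show "?N \<noteq> {}" using one one_closed by blast
    fix a assume a: "a \<in> ?N"
    have "act (inv\<^bsub>G\<^esub> a) t = t" if "t \<in> T" for t using cancel[of a t] a that by simp
    then show "inv\<^bsub>G\<^esub> a \<in> ?N" using a by simp
    fix b assume b: "b \<in> ?N"
    have "act (a \<otimes>\<^bsub>G\<^esub> b) t = t" if "t \<in> T" for t using mult[of a b t] a b that by simp
    then show "a \<otimes>\<^bsub>G\<^esub> b \<in> ?N" using a b by simp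
  qed auto
  have "?N \<lhd> G"
    unfolding normal_inv_iff
  proof (intro conjI ballI sub)
    fix x h assume x: "x \<in> carrier G" and h: "h \<in> ?N"
    have "act (x \<otimes>\<^bsub>G\<^esub> h \<otimes>\<^bsub>G\<^esub> inv\<^bsub>G\<^esub> x) t = t" if t: "t \<in> T" for t
      using x h t act cancel by (simp add: mult)
    then show "x \<otimes>\<^bsub>G\<^esub> h \<otimes>\<^bsub>G\<^esub> inv\<^bsub>G\<^esub> x \<in> ?N" using x h by simp
  qed
  moreover have "finite (carrier (G Mod ?N))"
  proof -
    let ?\<kappa> = "\<lambda>x. restrict (act x) T"
    have eq: "?N #>\<^bsub>G\<^esub> x = ?N #>\<^bsub>G\<^esub> y" if xy: "x \<in> carrier G" "y \<in> carrier G" "?\<kappa> x = ?\<kappa> y" for x y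
    proof -
      have "act x t = act y t" if "t \<in> T" for t using xy(3) that by (metis restrict_apply')
      then have "act (x \<otimes>\<^bsub>G\<^esub> inv\<^bsub>G\<^esub> y) t = t" if "t \<in> T" for t
        using that xy by (simp add: mult cancel)
      then have "x \<otimes>\<^bsub>G\<^esub> inv\<^bsub>G\<^esub> y \<in> ?N" using xy by simp
      then have "?N #>\<^bsub>G\<^esub> (x \<otimes>\<^bsub>G\<^esub> inv\<^bsub>G\<^esub> y) = ?N" using coset_join2[OF _ sub] xy by simp
      then show ?thesis using xy by (intro coset_mult_inv1) auto
    qed
    have "?\<kappa> ` carrier G \<subseteq> T \<rightarrow>\<^sub>E T" using act by auto
    then have "finite (?\<kappa> ` carrier G)" using finite_PiE[OF fin fin] finite_subset by blast
    moreover have "carrier (G Mod ?N) \<subseteq> (\<lambda>k. ?N #>\<^bsub>G\<^esub> (SOME x. x \<in> carrier G \<and> ?\<kappa> x = k)) ` ?\<kappa> ` carrier G"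
    proof
      fix c assume "c \<in> carrier (G Mod ?N)"
      then obtain x where x: "x \<in> carrier G" "c = ?N #>\<^bsub>G\<^esub> x" by (auto simp: FactGroup_def RCOSETS_def)
      let ?y = "SOME y. y \<in> carrier G \<and> ?\<kappa> y = ?\<kappa> x"
      have "?y \<in> carrier G \<and> ?\<kappa> ?y = ?\<kappa> x" by (rule someI[of _ x]) (use x in simp)
      then have "c = ?N #>\<^bsub>G\<^esub> ?y" using eq[of x ?y] x by simp
      then show "c \<in> (\<lambda>k. ?N #>\<^bsub>G\<^esub> (SOME x. x \<in> carrier G \<and> ?\<kappa> x = k)) ` ?\<kappa> ` carrier G" using x(1) by blast
    qed
    ultimately show ?thesis using finite_surj by blast
  qed
  moreover have "g \<notin> ?N" using g by blast
  ultimately show ?thesis by blast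
qed

lemma panels_subset: "P \<in> panels Ch dst s \<Longrightarrow> P \<subseteq> Ch"
  by (auto simp: panels_def)

lemma BijGroup_mult: "f \<in> Bij S \<Longrightarrow> g \<in> Bij S \<Longrightarrow> f \<otimes>\<^bsub>BijGroup S\<^esub> g = compose S f g"
  by (simp add: BijGroup_def)

lemma BijGroup_one: "\<one>\<^bsub>BijGroup S\<^esub> = (\<lambda>x\<in>S. x)"
  and BijGroup_carrier: "carrier (BijGroup S) = Bij S"
  by (simp_all add: BijGroup_def)

lemma Bij_apply: "f \<in> Bij S \<Longrightarrow> x \<in> S \<Longrightarrow> f x \<in> S"
  using Bij_imp_funcset by fastforce

lemma Bij_inv_into: "f \<in> Bij S \<Longrightarrow> x \<in> S \<Longrightarrow> inv_into S f (f x) = x"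
  and Bij_f_inv_into: "f \<in> Bij S \<Longrightarrow> x \<in> S \<Longrightarrow> f (inv_into S f x) = x"
  by (auto simp: Bij_def bij_betw_def inv_into_f_f f_inv_into_f)

text \<open>Closure under inverses uses that there are only finitely many panels of each type.\<close>

lemma building_aut_subgroup:
  assumes fin: "finite Ch"
  shows "subgroup (carrier (building_aut S Ch dst)) (BijGroup Ch)"
proof (rule group.subgroupI[OF group_BijGroup])
  let ?K = "carrier (building_aut S Ch dst)"
  have K: "f \<in> ?K \<longleftrightarrow> f \<in> Bij Ch \<and> (\<forall>s\<in>S. \<forall>P\<in>panels Ch dst s. f ` P \<in> panels Ch dst s)" for f
    by (simp add: building_aut_def)
  show "?K \<subseteq> carrier (BijGroup Ch)" using K by (auto simp: BijGroup_carrier)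
  have "(\<lambda>x\<in>Ch. x) \<in> ?K"
    unfolding K
  proof (intro conjI ballI id_Bij)
    fix s P assume P: "P \<in> panels Ch dst s"
    then have "(\<lambda>x\<in>Ch. x) ` P = P" using panels_subset by force
    then show "(\<lambda>x\<in>Ch. x) ` P \<in> panels Ch dst s" using P by simp
  qed
  then show "?K \<noteq> {}" by blast
  fix f assume f: "f \<in> ?K"
  then have fB: "f \<in> Bij Ch" using K by blast
  show "inv\<^bsub>BijGroup Ch\<^esub> f \<in> ?K"
    unfolding K inv_BijGroup[OF fB]
  proof (rule conjI[OF restrict_inv_into_Bij[OF fB]], intro ballI)
    fix s P assume s: "s \<in> S" and P: "P \<in> panels Ch dst s"
    have sub: "panels Ch dst s \<subseteq> Pow Ch" using panels_subset[of _ Ch dst s] by (simp add: subset_eq)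
    have inj: "inj_on f Ch" using fB by (simp add: Bij_def bij_betw_def)
    have "(`) f ` panels Ch dst s = panels Ch dst s"
    proof (rule endo_inj_surj)
      show "finite (panels Ch dst s)" using finite_subset[OF sub] fin by simp
      show "(`) f ` panels Ch dst s \<subseteq> panels Ch dst s" using f s unfolding K by blast
      show "inj_on ((`) f) (panels Ch dst s)" by (rule inj_on_subset[OF inj_on_image_Pow[OF inj] sub])
    qed
    then obtain Q where Q: "Q \<in> panels Ch dst s" "P = f ` Q" using P by blast
    have "(\<lambda>x\<in>Ch. inv_into Ch f x) ` P = (\<lambda>x. x) ` Q"
      unfolding Q(2) image_image
      using panels_subset[OF Q(1)] Bij_apply[OF fB] Bij_inv_into[OF fB] by (intro image_cong) auto
    then show "(\<lambda>x\<in>Ch. inv_into Ch f x) ` P \<in> panels Ch dst s" using Q(1) by simp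
  qed
  fix g assume g: "g \<in> ?K"
  then have gB: "g \<in> Bij Ch" using K by blast
  show "f \<otimes>\<^bsub>BijGroup Ch\<^esub> g \<in> ?K"
    unfolding K BijGroup_mult[OF fB gB]
  proof (rule conjI[OF compose_Bij[OF fB gB]], intro ballI)
    fix s P assume s: "s \<in> S" and P: "P \<in> panels Ch dst s"
    have "compose Ch f g ` P = f ` g ` P"
      unfolding image_image using panels_subset[OF P] by (intro image_cong) (auto simp: compose_def)
    then show "compose Ch f g ` P \<in> panels Ch dst s" using f g K s P by simp
  qed
qed

context graph_product
begin

context
  fixes G :: "'i \<Rightarrow> ('c \<Rightarrow> 'c) monoid" and K :: "'i \<Rightarrow> ('c \<Rightarrow> 'c) set"
  assumes G: "\<And>i. i \<in> I \<Longrightarrow> G i = BijGroup (\<Delta> i) \<lparr>carrier := K i\<rparr>"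
    and K: "\<And>i. i \<in> I \<Longrightarrow> subgroup (K i) (BijGroup (\<Delta> i))"
begin

definition lifts :: "('u set \<Rightarrow> 'u set) \<Rightarrow> ('i \<Rightarrow> 'c \<Rightarrow> 'c) \<Rightarrow> bool" where
  "lifts h g \<longleftrightarrow> h \<in> automorphisms \<and> g \<in> (\<Pi>\<^sub>E i\<in>I. K i) \<and>
    (\<forall>A\<in>chambers. prj (h A) = product_action I g (prj A))"

lemma K_Bij: "i \<in> I \<Longrightarrow> g \<in> K i \<Longrightarrow> g \<in> Bij (\<Delta> i)"
  using subgroup.subset[OF K] by (auto simp: BijGroup_carrier)

lemma lifts_Bij: "lifts h g \<Longrightarrow> h \<in> Bij chambers"
  by (simp add: lifts_def gp_aut_def)

lemma lifts_K: "lifts h g \<Longrightarrow> i \<in> I \<Longrightarrow> g i \<in> K i"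
  by (auto simp: lifts_def)

lemma lift_group_eq:
  "lift_group I edges prod_chambers Ut q G = BijGroup chambers \<lparr>carrier := {h. \<exists>g. lifts h g}\<rparr>"
proof -
  have "carrier (product_group I G) = (\<Pi>\<^sub>E i\<in>I. K i)"
    using G by (auto simp: PiE_iff)
  then show ?thesis unfolding lift_group_def lifts_def by (auto intro!: arg_cong[where f = "\<lambda>c. BijGroup chambers \<lparr>carrier := c\<rparr>"])
qed

lemma gp_aut_adjacent:
  assumes "h \<in> automorphisms" "A \<in> chambers" "B \<in> chambers" "i \<in> I"
  shows "adjacent i (h A) (h B) \<longleftrightarrow> adjacent i A B"
  using assms by (simp add: gp_aut_def)

lemma lifts_id: "lifts (\<lambda>A\<in>chambers. A) (\<lambda>i\<in>I. \<lambda>c\<in>\<Delta> i. c)"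
  unfolding lifts_def
proof (intro conjI ballI)
  show "(\<lambda>A\<in>chambers. A) \<in> automorphisms"
    using id_Bij by (simp add: gp_aut_def)
  show "(\<lambda>i\<in>I. \<lambda>c\<in>\<Delta> i. c) \<in> (\<Pi>\<^sub>E i\<in>I. K i)"
    using subgroup.one_closed[OF K] by (simp add: BijGroup_one)
  fix A assume A: "A \<in> chambers"
  show "prj ((\<lambda>A\<in>chambers. A) A) = product_action I (\<lambda>i\<in>I. \<lambda>c\<in>\<Delta> i. c) (prj A)"
    using A prj_in[OF A] X.p_coord[OF A] by (auto simp: product_action_def fun_eq_iff PiE_def extensional_def)
qed

lemma lifts_inv:
  assumes h: "lifts h g"
  shows "lifts (\<lambda>A\<in>chambers. inv_into chambers h A) (\<lambda>i\<in>I. \<lambda>c\<in>\<Delta> i. inv_into (\<Delta> i) (g i) c)"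
proof -
  note hB = lifts_Bij[OF h]
  let ?k = "\<lambda>A\<in>chambers. inv_into chambers h A"
  have k: "?k A \<in> chambers" "h (?k A) = A" if "A \<in> chambers" for A
    using that Bij_inv_into_mem[OF hB that] Bij_f_inv_into[OF hB that] by simp_all
  show ?thesis
    unfolding lifts_def
  proof (intro conjI ballI)
    have "h \<in> automorphisms" using h by (simp add: lifts_def)
    then have "adjacent i (?k A) (?k B) \<longleftrightarrow> adjacent i A B"
      if "A \<in> chambers" "B \<in> chambers" "i \<in> I" for A B i
      using gp_aut_adjacent[of h "?k A" "?k B" i] k that by simp
    then show "?k \<in> automorphisms"
      unfolding gp_aut_def using restrict_inv_into_Bij[OF hB] by blast
    show "(\<lambda>i\<in>I. \<lambda>c\<in>\<Delta> i. inv_into (\<Delta> i) (g i) c) \<in> (\<Pi>\<^sub>E i\<in>I. K i)"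
    proof
      fix i assume i: "i \<in> I"
      note gi = lifts_K[OF h i]
      show "(\<lambda>i\<in>I. \<lambda>c\<in>\<Delta> i. inv_into (\<Delta> i) (g i) c) i \<in> K i"
        using subgroup.m_inv_closed[OF K[OF i] gi] inv_BijGroup[OF K_Bij[OF i gi]] i by simp
    qed auto
    fix A assume A: "A \<in> chambers"
    have pA: "prj A = product_action I g (prj (?k A))"
      using h k[OF A] unfolding lifts_def by metis
    have "product_action I (\<lambda>i\<in>I. \<lambda>c\<in>\<Delta> i. inv_into (\<Delta> i) (g i) c) (prj A) i = prj (?k A) i" for i
    proof (cases "i \<in> I")
      case True
      have gi: "g i \<in> Bij (\<Delta> i)" and ki: "prj (?k A) i \<in> \<Delta> i"
        using K_Bij lifts_K[OF h] True X.p_coord k(1)[OF A] by auto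
      have "prj A i = g i (prj (?k A) i)" using pA True by (simp add: product_action_def)
      then show ?thesis using True Bij_inv_into[OF gi ki] Bij_apply[OF gi ki] by (simp add: product_action_def)
    next
      case False
      then show ?thesis using prj_in[OF k(1)[OF A]] by (auto simp: product_action_def PiE_def extensional_def)
    qed
    then show "prj (?k A) = product_action I (\<lambda>i\<in>I. \<lambda>c\<in>\<Delta> i. inv_into (\<Delta> i) (g i) c) (prj A)" by (simp add: fun_eq_iff)
  qed
qed

lemma lifts_compose:
  assumes h: "lifts h g" and h': "lifts h' g'"
  shows "lifts (compose chambers h h') (\<lambda>i\<in>I. compose (\<Delta> i) (g i) (g' i))"
  unfolding lifts_def
proof (intro conjI ballI)
  note hB = lifts_Bij[OF h] lifts_Bij[OF h']
  have aut: "h \<in> automorphisms" "h' \<in> automorphisms"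
    using h h' by (simp_all add: lifts_def)
  have "adjacent i (compose chambers h h' A) (compose chambers h h' B)
      \<longleftrightarrow> adjacent i A B" if "A \<in> chambers" "B \<in> chambers" "i \<in> I" for A B i
    using gp_aut_adjacent[OF aut(2) that] that Bij_apply[OF hB(2)]
      gp_aut_adjacent[OF aut(1), of "h' A" "h' B" i] by (simp add: compose_eq)
  then show "compose chambers h h' \<in> automorphisms"
    unfolding gp_aut_def using compose_Bij[OF hB] by blast
  show "(\<lambda>i\<in>I. compose (\<Delta> i) (g i) (g' i)) \<in> (\<Pi>\<^sub>E i\<in>I. K i)"
  proof
    fix i assume i: "i \<in> I"
    note gi = lifts_K[OF h i] lifts_K[OF h' i]
    show "(\<lambda>i\<in>I. compose (\<Delta> i) (g i) (g' i)) i \<in> K i"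
      using subgroup.m_closed[OF K[OF i] gi] BijGroup_mult[OF K_Bij[OF i gi(1)] K_Bij[OF i gi(2)]] i by simp
  qed auto
  fix A assume A: "A \<in> chambers"
  have "prj (h (h' A)) = product_action I g (prj (h' A))"
    using h Bij_apply[OF hB(2) A] by (simp add: lifts_def)
  moreover have "prj (h' A) = product_action I g' (prj A)" using h' A by (simp add: lifts_def)
  ultimately show "prj (compose chambers h h' A) = product_action I (\<lambda>i\<in>I. compose (\<Delta> i) (g i) (g' i)) (prj A)"
    using A X.p_coord[OF A] by (simp add: compose_eq product_action_def fun_eq_iff)
qed

lemma group_lifts: "group (BijGroup chambers \<lparr>carrier := {h. \<exists>g. lifts h g}\<rparr>)"
proof (rule subgroup.subgroup_is_group[OF group.subgroupI[OF group_BijGroup] group_BijGroup])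
  show "{h. \<exists>g. lifts h g} \<subseteq> carrier (BijGroup chambers)" using lifts_Bij by (auto simp: BijGroup_carrier)
  show "{h. \<exists>g. lifts h g} \<noteq> {}" using lifts_id by blast
  fix h assume "h \<in> {h. \<exists>g. lifts h g}"
  then obtain g where h: "lifts h g" by blast
  show "inv\<^bsub>BijGroup chambers\<^esub> h \<in> {h. \<exists>g. lifts h g}"
    unfolding inv_BijGroup[OF lifts_Bij[OF h]] using lifts_inv[OF h] by blast
  fix h' assume "h' \<in> {h. \<exists>g. lifts h g}"
  then obtain g' where h': "lifts h' g'" by blast
  show "h \<otimes>\<^bsub>BijGroup chambers\<^esub> h' \<in> {h. \<exists>g. lifts h g}"
    unfolding BijGroup_mult[OF lifts_Bij[OF h] lifts_Bij[OF h']] using lifts_compose[OF h h'] by blast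
qed

text \<open>A lift preserves panels, and within a panel a chamber is determined by its coordinate.\<close>

lemma lifts_gop:
  assumes h: "lifts h g" and A: "A \<in> chambers" and i: "i \<in> I" "c \<in> \<Delta> i"
  shows "h (gop i c A) = gop i (g i c) (h A)"
proof -
  let ?B = "gop i c A"
  note B = gop[OF A i]
  have hA: "h A \<in> chambers" "h ?B \<in> chambers" using Bij_apply[OF lifts_Bij[OF h]] A B(1) by auto
  have "mirror i A = mirror i ?B"
    using gp_mirror_eq_iff[OF A B(1) i(1)] i(2) by blast
  then have "A = ?B \<or> adjacent i A ?B" by (auto simp: gp_adjacent_def)
  then have "A = ?B \<or> adjacent i (h A) (h ?B)"
    using gp_aut_adjacent[OF _ A B(1) i(1)] h by (simp add: lifts_def)
  then have "mirror i (h A) = mirror i (h ?B)"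
    by (auto simp: gp_adjacent_def)
  then obtain d where d: "d \<in> \<Delta> i" "h ?B = gop i d (h A)"
    using gp_mirror_eq_iff[OF hA i(1)] by blast
  then have "prj (h ?B) i = d" using gop(2)[OF hA(1) i(1) d(1)] by simp
  moreover have "prj (h ?B) i = g i c"
    using h B i by (simp add: lifts_def product_action_def)
  ultimately show ?thesis using d by simp
qed

text \<open>
  As \<open>f\<close> is compatible with the operations and galleries connect all chambers, \<open>f \<circ> h\<close> is determined
  by its value at one chamber and by the action that \<open>h\<close> covers. The group of lifts acts
  on this finite set.
\<close>

lemma finite_translates:
  assumes fin: "finite F" and f: "\<forall>A\<in>chambers. f A \<in> F"
    and mor: "\<forall>A\<in>chambers. \<forall>i\<in>I. \<forall>c\<in>\<Delta> i. f (gop i c A) = op i c (f A)"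
  shows "finite (compose chambers f ` {h. \<exists>g. lifts h g})"
proof -
  obtain A0 where A0: "A0 \<in> chambers" using chambers_nonempty by blast
  have det: "compose chambers f h = compose chambers f h'"
    if h: "lifts h g" and h': "lifts h' g" and e: "f (h A0) = f (h' A0)" for h h' g
  proof -
    let ?X0 = "{A \<in> chambers. f (h A) = f (h' A)}"
    have "?X0 = chambers"
    proof (rule chambers_induct)
      show "A0 \<in> ?X0" using A0 e by simp
      fix A i c assume A: "A \<in> ?X0" and i: "i \<in> I" "c \<in> \<Delta> i"
      have hA: "h A \<in> chambers" "h' A \<in> chambers"
        using A Bij_apply[OF lifts_Bij[OF h]] Bij_apply[OF lifts_Bij[OF h']] by auto
      have gc: "g i c \<in> \<Delta> i" using Bij_apply[OF K_Bij[OF i(1) lifts_K[OF h i(1)]] i(2)] .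
      have "f (h (gop i c A)) = op i (g i c) (f (h A))"
        using lifts_gop[OF h _ i] mor hA gc i A by simp
      moreover have "f (h' (gop i c A)) = op i (g i c) (f (h' A))"
        using lifts_gop[OF h' _ i] mor hA gc i A by simp
      ultimately show "gop i c A \<in> ?X0" using A gop(1)[OF _ i] by simp
    qed auto
    then show ?thesis by (fastforce simp: compose_def)
  qed
  let ?P = "(\<Pi>\<^sub>E i\<in>I. K i) \<times> F"
  have "finite (K i)" if i: "i \<in> I" for i
  proof (rule finite_subset)
    show "K i \<subseteq> \<Delta> i \<rightarrow>\<^sub>E \<Delta> i"
    proof
      fix g assume "g \<in> K i"
      from K_Bij[OF i this] show "g \<in> \<Delta> i \<rightarrow>\<^sub>E \<Delta> i"
        by (simp add: PiE_def Bij_imp_funcset Bij_imp_extensional)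
    qed
    show "finite (\<Delta> i \<rightarrow>\<^sub>E \<Delta> i)" using finite_\<Delta>[OF i] by (intro finite_PiE)
  qed
  then have P: "finite ?P" using finite_I fin by (intro finite_cartesian_product finite_PiE)
  let ?c = "\<lambda>(g, z). SOME h. lifts h g \<and> f (h A0) = z"
  have "compose chambers f ` {h. \<exists>g. lifts h g} \<subseteq> (\<lambda>w. compose chambers f (?c w)) ` ?P"
  proof
    fix t assume "t \<in> compose chambers f ` {h. \<exists>g. lifts h g}"
    then obtain h g where h: "lifts h g" "t = compose chambers f h" by blast
    define k where "k = ?c (g, f (h A0))"
    have "lifts k g \<and> f (k A0) = f (h A0)"
      unfolding k_def prod.case by (rule someI[of _ h]) (use h in simp)
    then have k: "lifts k g" "f (h A0) = f (k A0)" by simp_all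
    have "t = compose chambers f (?c (g, f (h A0)))"
      using det[OF h(1) k] h(2) unfolding k_def by (simp only:)
    moreover have "(g, f (h A0)) \<in> ?P"
      using h(1) f Bij_apply[OF lifts_Bij[OF h(1)] A0] by (simp add: lifts_def)
    ultimately show "t \<in> (\<lambda>w. compose chambers f (?c w)) ` ?P" by (rule image_eqI)
  qed
  from finite_subset[OF this finite_imageI[OF P]] show ?thesis .
qed

text \<open>The group acts from the right on the translates of a morphism \<open>f\<close> that separates a chamber \<open>A\<close>
  from \<open>h A\<close>, and \<open>h\<close> moves \<open>f\<close> itself.\<close>

theorem lift_group_residually_finite: "residually_finite (lift_group I edges prod_chambers Ut q G)"
  unfolding lift_group_eq residually_finite_def
proof (intro conjI ballI)
  let ?H = "{h. \<exists>g. lifts h g}"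
  let ?L = "BijGroup chambers \<lparr>carrier := ?H\<rparr>"
  show grp: "group ?L" by (rule group_lifts)
  fix h assume "h \<in> carrier ?L - {\<one>\<^bsub>?L\<^esub>}"
  then have h: "h \<in> ?H" "h \<noteq> (\<lambda>A\<in>chambers. A)" by (auto simp: BijGroup_one)
  then have hB: "h \<in> Bij chambers" using lifts_Bij by blast
  have "\<exists>A\<in>chambers. h A \<noteq> A"
  proof (rule ccontr)
    assume "\<not> (\<exists>A\<in>chambers. h A \<noteq> A)"
    then have "h A = (\<lambda>A\<in>chambers. A) A" for A
      using Bij_imp_extensional[OF hB] by (auto simp: extensional_def)
    then show False using h(2) by blast
  qed
  then obtain A where A: "A \<in> chambers" "h A \<noteq> A" by blast
  have hA: "h A \<in> chambers" using Bij_apply[OF hB A(1)] .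
  from finite_separation[OF A(1) hA A(2)] obtain F op and f :: "'u set \<Rightarrow> ('i \<Rightarrow> 'c) \<times> ('i \<Rightarrow> 'c) \<times> ('i \<Rightarrow> 'c option list)"
    where f: "finite F" "\<forall>A\<in>chambers. f A \<in> F"
      "\<forall>A\<in>chambers. \<forall>i\<in>I. \<forall>c\<in>\<Delta> i. f (gop i c A) = op i c (f A)" and fA: "f (h A) \<noteq> f A"
    by (elim exE conjE)
  let ?T = "compose chambers f ` ?H"
  have mult: "x \<otimes>\<^bsub>?L\<^esub> y = compose chambers x y" if "x \<in> ?H" "y \<in> ?H" for x y
    using that lifts_Bij by (auto simp: BijGroup_mult)
  have assoc: "compose chambers t (compose chambers x y) = compose chambers (compose chambers t x) y"
    if "y \<in> ?H" for t :: "'u set \<Rightarrow> ('i \<Rightarrow> 'c) \<times> ('i \<Rightarrow> 'c) \<times> ('i \<Rightarrow> 'c option list)" and x y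
    using that compose_assoc[of y chambers chambers t x] Bij_imp_funcset lifts_Bij by blast
  show "\<exists>N. N \<lhd> ?L \<and> finite (carrier (?L Mod N)) \<and> h \<notin> N"
  proof (rule finite_action_separates[OF grp, where T = ?T and act = "\<lambda>x t. compose chambers t x"
        and t = "compose chambers f (\<lambda>A\<in>chambers. A)"])
    show "finite ?T" by (rule finite_translates[OF f])
    show "compose chambers t x \<in> ?T" if xt: "x \<in> carrier ?L" "t \<in> ?T" for x t
    proof -
      obtain y where y: "y \<in> ?H" "t = compose chambers f y" using xt(2) by blast
      have x: "x \<in> ?H" using xt(1) by simp
      have yx: "compose chambers y x \<in> ?H" using lifts_compose x y(1) by blast
      show ?thesis unfolding y(2) assoc[OF x, symmetric] by (rule imageI[OF yx])
    qed
    show "compose chambers t (x \<otimes>\<^bsub>?L\<^esub> y) = compose chambers (compose chambers t x) y"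
      if "x \<in> carrier ?L" "y \<in> carrier ?L" "t \<in> ?T" for x y t
      using that mult[of x y] assoc[of y t x] by simp
    show "compose chambers t \<one>\<^bsub>?L\<^esub> = t" if "t \<in> ?T" for t
      using that by (auto simp: BijGroup_one compose_def fun_eq_iff)
    show "compose chambers f (\<lambda>A\<in>chambers. A) \<in> ?T" using lifts_id by blast
    have "compose chambers (compose chambers f (\<lambda>A\<in>chambers. A)) h A = f (h A)"
      "compose chambers f (\<lambda>A\<in>chambers. A) A = f A" using A hA by (simp_all add: compose_eq)
    then show "compose chambers (compose chambers f (\<lambda>A\<in>chambers. A)) h \<noteq> compose chambers f (\<lambda>A\<in>chambers. A)"
      using fA by metis
  qed
qed

end

end

theorem theorem12p2:
  fixes I :: "'i set" and edges :: "'i set set"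
    and W :: "'i \<Rightarrow> 'w monoid" and S :: "'i \<Rightarrow> 'w set"
    and \<Delta> :: "'i \<Rightarrow> 'c set" and \<delta> :: "'i \<Rightarrow> 'c \<Rightarrow> 'c \<Rightarrow> 'w"
    and G :: "'i \<Rightarrow> ('c \<Rightarrow> 'c) monoid" and E :: "('i \<Rightarrow> 'c) set"
    and Ut :: "'u topology" and q :: "'u \<Rightarrow> (('i \<Rightarrow> 'c) \<times> ('i set \<Rightarrow> real)) set"
  assumes "finite I"
    and "\<And>e. e \<in> edges \<Longrightarrow> e \<subseteq> I \<and> card e = 2"
    and "\<And>i. i \<in> I \<Longrightarrow> building (W i) (S i) (\<Delta> i) (\<delta> i)"
    and "\<And>i. i \<in> I \<Longrightarrow> finite (\<Delta> i)"
    and "\<And>i. i \<in> I \<Longrightarrow> G i = building_aut (S i) (\<Delta> i) (\<delta> i)"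
    and "\<And>i C D. \<lbrakk>i \<in> I; C \<in> \<Delta> i; D \<in> \<Delta> i\<rbrakk> \<Longrightarrow> \<exists>g \<in> carrier (G i). g C = D"
    and "E = (\<Pi>\<^sub>E i\<in>I. \<Delta> i)"
    and "universal_cover Ut (U_space I edges E) q"
  shows "residually_finite (lift_group I edges E Ut q G)"
proof -
  interpret graph_product I edges \<Delta> Ut q
  proof
    show "\<Delta> i \<noteq> {}" if "i \<in> I" for i using building.nonempty[OF assms(3)[OF that]] .
    show "universal_cover Ut (U_space I edges (\<Pi>\<^sub>E i\<in>I. \<Delta> i)) q" using assms(7,8) by simp
  qed (use assms in auto)
  have "residually_finite (lift_group I edges (\<Pi>\<^sub>E i\<in>I. \<Delta> i) Ut q G)"
  proof (rule lift_group_residually_finite)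
    fix i assume i: "i \<in> I"
    show "G i = BijGroup (\<Delta> i) \<lparr>carrier := carrier (G i)\<rparr>"
      using assms(5)[OF i] by (simp add: building_aut_def)
    show "subgroup (carrier (G i)) (BijGroup (\<Delta> i))"
      using building_aut_subgroup[OF assms(4)[OF i]] assms(5)[OF i] by simp
  qed
  then show ?thesis using assms(7) by simp
qed

end
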